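(* Let $(B_t)_{t\ge 0}$ be a standard one-dimensional Brownian motion with $B_0=0$, and for $\varepsilon>0$ set $B^{\varepsilon}_t:=\varepsilon B_{t/\varepsilon}$, $t\in[0,1]$. Define $S:\mathcal{C}[0,1]\to[0,\infty]$ by $$S(\phi)=\begin{cases}\frac12\int_0^1|\phi'(t)|^2\,dt, & \phi\in AC[0,1],\\ \infty, & \text{otherwise.}\end{cases}$$ Then $(B^{\varepsilon})_{\varepsilon>0}$ satisfies a large deviation principle in $(\mathcal{C}[0,1],\|\cdot\|_\infty)$ as $\varepsilon\to0$ with action functional $S$; i.e. for every open set $U\subset\mathcal{C}[0,1]$ and every closed set $F\subset\mathcal{C}[0,1]$, $$\liminf_{\varepsilon\to0}\varepsilon\log\mathbb{P}(B^{\varepsilon}\in U)\ge-\inf_{\phi\in U}S(\phi),\qquad \limsup_{\varepsilon\to0}\varepsilon\log\mathbb{P}(B^{\varepsilon}\in F)\le-\inf_{\phi\in F}S(\phi).$$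
   Context: $\mathcal{C}[0,1]$ is the space of continuous functions $f:[0,1]\to\mathbb{R}$ with $f(0)=0$, with the uniform norm $\|f\|_\infty=\sup_{t\in[0,1]}|f(t)|$. $AC[0,1]$ is the space of absolutely continuous functions on $[0,1]$ with value $0$ at $0$. An action functional on a metric space $M$ is a function $S:M\to[0,\infty]$ all of whose sublevel sets $\{x: S(x)\le r\}$, $r\ge0$, are compact (a "good rate function"). A family of $M$-valued random variables $(X_\varepsilon)_{\varepsilon>0}$ satisfies a large deviation principle with action functional $S$ (as $\varepsilon\to0$) if $S$ is an action functional, $\liminf_{\varepsilon\to0}\varepsilon\log\mathbb{P}(X_\varepsilon\in U)\ge-\inf_U S$ for all open $U$, and $\limsup_{\varepsilon\to0}\varepsilon\log\mathbb{P}(X_\varepsilon\in F)\le-\inf_F S$ for all closed $F$. Conventions: $\log 0=-\infty$, $\inf\emptyset=+\infty$. *)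

theory Defs
  imports "HOL-Probability.Probability"
begin

definition metric_borel :: "'b metric \<Rightarrow> 'b measure" where
  "metric_borel m = sigma (mspace m) {U. openin (mtopology_of m) U}"

definition action_functional :: "'b metric \<Rightarrow> ('b \<Rightarrow> ennreal) \<Rightarrow> bool" where
  "action_functional m S \<longleftrightarrow>
     (\<forall>r::real. 0 \<le> r \<longrightarrow> compactin (mtopology_of m) {x \<in> mspace m. S x \<le> ennreal r})"

text \<open>The library's \<^term>\<open>ln (0::real)\<close> is \<^term>\<open>0::real\<close>, hence the explicit convention
  \<open>log 0 = -\<infinity>\<close>.\<close>

definition log_prob :: "real \<Rightarrow> ereal" where
  "log_prob p = (if p = 0 then - \<infinity> else ereal (ln p))"

text \<open>Only the members \<open>X \<epsilon>\<close> with \<open>\<epsilon> > 0\<close> matter, and \<open>S\<close> matters only on \<^term>\<open>mspace m\<close>.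
  An infimum over the empty set is \<open>\<infinity>\<close>.\<close>

definition large_deviation_principle ::
  "'a measure \<Rightarrow> 'b metric \<Rightarrow> (real \<Rightarrow> 'a \<Rightarrow> 'b) \<Rightarrow> ('b \<Rightarrow> ennreal) \<Rightarrow> bool" where
  "large_deviation_principle M m X S \<longleftrightarrow>
     prob_space M \<and>
     (\<forall>\<epsilon>>0. X \<epsilon> \<in> measurable M (metric_borel m)) \<and>
     action_functional m S \<and>
     (\<forall>U. openin (mtopology_of m) U \<longrightarrow>
        Liminf (at_right 0) (\<lambda>\<epsilon>. ereal \<epsilon> * log_prob (measure M {\<omega> \<in> space M. X \<epsilon> \<omega> \<in> U}))
          \<ge> - enn2ereal (INF x\<in>U. S x)) \<and>
     (\<forall>F. closedin (mtopology_of m) F \<longrightarrow>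
        Limsup (at_right 0) (\<lambda>\<epsilon>. ereal \<epsilon> * log_prob (measure M {\<omega> \<in> space M. X \<epsilon> \<omega> \<in> F}))
          \<le> - enn2ereal (INF x\<in>F. S x))"

text \<open>Elements are functions that are \<^term>\<open>undefined\<close> outside \<open>[0,1]\<close>; the metric is the supremum
  metric over \<open>[0,1]\<close>.\<close>

definition C01 :: "(real \<Rightarrow> real) metric" where
  "C01 = submetric (cfunspace (top_of_set {0..1}) euclidean_metric) {f. f 0 = 0}"

text \<open>The intervals may be degenerate, which is harmless.\<close>

definition absolutely_continuous_on :: "real set \<Rightarrow> (real \<Rightarrow> real) \<Rightarrow> bool" where
  "absolutely_continuous_on I f \<longleftrightarrow>
     (\<forall>e>0. \<exists>d>0. \<forall>(n::nat) a b.
        (\<forall>i<n. a i \<le> b i \<and> {a i..b i} \<subseteq> I) \<and>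
        disjoint_family_on (\<lambda>i. {a i<..<b i}) {..<n} \<and>
        (\<Sum>i<n. b i - a i) < d
        \<longrightarrow> (\<Sum>i<n. \<bar>f (b i) - f (a i)\<bar>) < e)"

definition AC01 :: "(real \<Rightarrow> real) set" where
  "AC01 = {f. absolutely_continuous_on {0..1} f \<and> f 0 = 0}"

text \<open>An absolutely continuous function is differentiable only almost everywhere on \<open>[0,1]\<close>;
  \<^const>\<open>deriv\<close> is unspecified on the exceptional null set (which may include the end points).
  The integral is with respect to the completed Lebesgue measure, so that this null set
  cannot affect measurability.\<close>

definition action :: "(real \<Rightarrow> real) \<Rightarrow> ennreal" where
  "action \<phi> =
     (if \<phi> \<in> AC01
      then ennreal (1/2) * (\<integral>\<^sup>+ t\<in>{0..1}. ennreal (\<bar>deriv \<phi> t\<bar>\<^sup>2) \<partial>lebesgue)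
      else \<infinity>)"

text \<open>\<^const>\<open>normal_density\<close> takes the standard deviation, not the variance.\<close>

locale standard_brownian_motion = prob_space M
  for M :: "'a measure" and B :: "real \<Rightarrow> 'a \<Rightarrow> real" +
  assumes random_variable: "\<And>t. 0 \<le> t \<Longrightarrow> B t \<in> borel_measurable M"
    and start: "\<And>\<omega>. \<omega> \<in> space M \<Longrightarrow> B 0 \<omega> = 0"
    and indep_increments:
      "\<And>(n::nat) (t :: nat \<Rightarrow> real). 0 \<le> t 0 \<Longrightarrow> (\<And>i. i < n \<Longrightarrow> t i \<le> t (Suc i)) \<Longrightarrow>
         indep_vars (\<lambda>_. borel) (\<lambda>i \<omega>. B (t (Suc i)) \<omega> - B (t i) \<omega>) {..<n}"
    and normal_increments:
      "\<And>s t. 0 \<le> s \<Longrightarrow> s < t \<Longrightarrow>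
         distributed M lborel (\<lambda>\<omega>. B t \<omega> - B s \<omega>) (normal_density 0 (sqrt (t - s)))"
    and continuous_paths: "\<And>\<omega>. \<omega> \<in> space M \<Longrightarrow> continuous_on {0..} (\<lambda>t. B t \<omega>)"

definition rescaled_path :: "(real \<Rightarrow> 'a \<Rightarrow> real) \<Rightarrow> real \<Rightarrow> 'a \<Rightarrow> real \<Rightarrow> real" where
  "rescaled_path B \<epsilon> \<omega> = (\<lambda>t\<in>{0..1}. \<epsilon> * B (t / \<epsilon>) \<omega>)"

end

theory Submission
  imports Defs "HOL-Complex_Analysis.Great_Picard"
begin

text \<open>Let \<open>E N \<phi>\<close> be half the sum of the squared increments of \<open>\<phi>\<close> over the dyadic grid of level \<open>N\<close>,
  weighted by \<open>2 ^ N\<close>. The action of a path is the supremum of its dyadic energies: Cauchy--Schwarz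
  gives one inequality, Fatou's lemma the other, both resting on the fact that an absolutely
  continuous function is the integral of its almost everywhere existing derivative. Bounded energy
  forces a uniform Hoelder modulus, so Arzela--Ascoli makes the action a good rate function.

  For the rescaled Brownian path the level-\<open>N\<close> energy is \<open>\<epsilon> / 2\<close> times a chi-square variable with
  \<open>2 ^ N\<close> degrees of freedom, while a chaining bound shows that the path stays within a fixed distance
  of its level-\<open>N\<close> polygon up to an event of probability \<open>exp (- a / \<epsilon>)\<close>, with \<open>a\<close> as large as we
  please once \<open>N\<close> is large. The polygon's action is the level-\<open>N\<close> energy, so the Chernoff bound gives
  the upper estimate. For the lower one, the probability that all level-\<open>N\<close> increments are close to
  those of \<open>\<phi>\<close> is computed by independence, and the chaining event is simply subtracted; no change of
  measure is needed.\<close>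

text \<open>The action is stated through \<open>deriv\<close>, so it cannot be compared with the
  energies before an absolutely continuous \<open>F\<close> has been recovered from its derivative.
  This is done by writing \<open>F\<close> as the difference of the increasing functions
  \<open>V + F\<close> and \<open>V\<close>, with \<open>V\<close> the variation, taking
  Radon--Nikodym densities of both, and differentiating the integrals by a Vitali covering argument.
  The supremum formula is what joins analysis and probability: each energy depends on finitely many
  values of the path, so it passes to uniform limits and its law is explicit. The order of choices
  matters: the level \<open>N\<close> is fixed first, from the tolerance and the target rate, and
  only then does \<open>\<epsilon>\<close> tend to zero. Constants such as
  \<open>2 ^ (N + 2)\<close>, or the Chernoff factor to the power \<open>2 ^ N\<close>, are enormous
  but independent of \<open>\<epsilon>\<close>, so any gap between two rates absorbs them. Hence
  both bounds work with strict intermediate rates, and crude Gaussian constants suffice in the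
  chaining step, whose exponent carries the factor \<open>2 ^ N\<close>.\<close>

section \<open>Differentiation of integrals\<close>

text \<open>Some open \<open>U\<close> containing \<open>A\<close> has \<open>\<nu>\<close>-mass
  below \<open>c * e\<close>. Each point of the set lies in arbitrarily short intervals inside
  \<open>U\<close> whose length is less than their mass divided by \<open>c\<close>; Vitali's
  theorem selects disjoint ones that cover almost all of the set, with total length at most
  \<open>e\<close>.\<close>

lemma negligible_density_zero_points:
  fixes \<nu> :: "real measure"
  assumes sets: "sets \<nu> = sets borel" and fin: "emeasure \<nu> UNIV \<noteq> \<infinity>"
    and A: "A \<in> sets borel" "emeasure \<nu> A = 0" and "0 < c"
  shows "negligible {x \<in> A. \<forall>d>0. \<exists>a b. a \<le> x \<and> x \<le> b \<and> a < b \<and> b - a < d \<and>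
                        ennreal (c * (b - a)) < emeasure \<nu> {a..b}}" (is "negligible ?E")
  unfolding negligible_outer_le
proof (intro allI impI)
  fix e :: real assume "0 < e"
  have sp: "space \<nu> = UNIV" using sets_eq_imp_space_eq[OF sets] by simp
  have "(INF U\<in>{U. A \<subseteq> U \<and> open U}. emeasure \<nu> U) = emeasure \<nu> A"
    using outer_regular[OF sets _ A(1)] fin sp by simp
  then have "(INF U\<in>{U. A \<subseteq> U \<and> open U}. emeasure \<nu> U) < ennreal (c * e)"
    using A \<open>0 < c\<close> \<open>0 < e\<close> by simp
  then obtain U where U: "A \<subseteq> U" "open U" "emeasure \<nu> U < ennreal (c * e)"
    by (auto simp: INF_less_iff)
  define K where "K = {(a::real, b). a < b \<and> {a..b} \<subseteq> U \<and> ennreal (c * (b - a)) < emeasure \<nu> {a..b}}"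
  \<comment> \<open>The covering theorem speaks of balls, so an interval is recorded by its midpoint
    and half-length; the point to be covered need not be the midpoint.\<close>
  define m where "m = (\<lambda>(a::real, b). (a + b) / 2)"
  define r where "r = (\<lambda>(a::real, b). (b - a) / 2)"
  have cb: "cball (m i) (r i) = {fst i..snd i}" for i
    by (auto simp: m_def r_def case_prod_unfold cball_eq_atLeastAtMost field_simps)
  obtain C where C: "countable C" "C \<subseteq> K"
     "pairwise (\<lambda>i j. disjnt (cball (m i) (r i)) (cball (m j) (r j))) C"
     "negligible (?E - (\<Union>i \<in> C. cball (m i) (r i)))"
  proof (rule Vitali_covering_theorem_cballs[of K r ?E m])
    show "0 < r i" if "i \<in> K" for i
      using that by (auto simp: K_def r_def)
    fix x d :: real assume x: "x \<in> ?E" and "0 < d"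
    have "x \<in> U" using x U(1) by blast
    then obtain d' where d': "0 < d'" "ball x d' \<subseteq> U"
      using U(2) by (auto simp: open_contains_ball)
    have *: "\<forall>d>0. \<exists>a b. a \<le> x \<and> x \<le> b \<and> a < b \<and> b - a < d \<and>
                        ennreal (c * (b - a)) < emeasure \<nu> {a..b}"
      using x by simp
    have "0 < min d d'" using \<open>0 < d\<close> d'(1) by simp
    from *[rule_format, OF this] obtain a b where ab: "a \<le> x" "x \<le> b" "a < b" "b - a < min d d'"
      "ennreal (c * (b - a)) < emeasure \<nu> {a..b}"
      by blast
    have "{a..b} \<subseteq> U"
      using ab d'(2) by (force simp: dist_real_def subset_iff)
    then show "\<exists>i. i \<in> K \<and> x \<in> cball (m i) (r i) \<and> r i < d"
      using ab by (intro exI[of _ "(a, b)"]) (auto simp: K_def cb, auto simp: r_def)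
  qed blast
  define T where "T = (\<Union>i\<in>C. {fst i..snd i})"
  have dis: "disjoint_family_on (\<lambda>i. {fst i..snd i}) C"
    using C(3) by (auto simp: pairwise_def disjnt_def disjoint_family_on_def cb)
  have T: "T \<in> sets borel"
    unfolding T_def using C(1) by (intro sets.countable_UN'') auto
  have "emeasure lborel T = (\<integral>\<^sup>+i. emeasure lborel {fst i..snd i} \<partial>count_space C)"
    unfolding T_def by (rule emeasure_UN_countable) (use C dis in auto)
  also have "\<dots> \<le> (\<integral>\<^sup>+i. emeasure \<nu> {fst i..snd i} / ennreal c \<partial>count_space C)"
  proof (intro nn_integral_mono)
    fix i assume "i \<in> space (count_space C)"
    then have "i \<in> K" using C(2) by auto
    then have i: "fst i < snd i" "ennreal (c * (snd i - fst i)) < emeasure \<nu> {fst i..snd i}"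
      by (auto simp: K_def)
    have "emeasure lborel {fst i..snd i} = ennreal (snd i - fst i)" using i by simp
    also have "\<dots> = ennreal (c * (snd i - fst i)) / ennreal c"
      using i \<open>0 < c\<close> by (simp add: divide_ennreal)
    also have "\<dots> \<le> emeasure \<nu> {fst i..snd i} / ennreal c"
      using i by (intro divide_right_mono_ennreal) auto
    finally show "emeasure lborel {fst i..snd i} \<le> emeasure \<nu> {fst i..snd i} / ennreal c" .
  qed
  also have "\<dots> = (\<integral>\<^sup>+i. emeasure \<nu> {fst i..snd i} \<partial>count_space C) / ennreal c"
    by (rule nn_integral_divide) auto
  also have "(\<integral>\<^sup>+i. emeasure \<nu> {fst i..snd i} \<partial>count_space C) = emeasure \<nu> T"
    unfolding T_def by (rule emeasure_UN_countable[symmetric]) (use C dis sets in auto)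
  also have "emeasure \<nu> T / ennreal c \<le> ennreal (c * e) / ennreal c"
  proof (intro divide_right_mono_ennreal)
    have "T \<subseteq> U" using C(2) by (auto simp: T_def K_def subset_iff)
    then have "emeasure \<nu> T \<le> emeasure \<nu> U"
      using U sets by (intro emeasure_mono) auto
    then show "emeasure \<nu> T \<le> ennreal (c * e)" using U(3) by simp
  qed
  also have "\<dots> = ennreal e"
    using \<open>0 < c\<close> \<open>0 < e\<close> by (simp add: divide_ennreal)
  finally have Te: "emeasure lebesgue T \<le> ennreal e" using T by simp
  have Tm: "T \<in> lmeasurable" using Te T
    by (intro fmeasurableI) (auto simp: top_unique[symmetric] intro: le_less_trans[OF _ ennreal_less_top])
  define N where "N = ?E - T"
  have N: "negligible N" using C(4) by (simp add: N_def T_def cb)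
  show "\<exists>T. ?E \<subseteq> T \<and> T \<in> lmeasurable \<and> measure lebesgue T \<le> e"
  proof (intro exI conjI)
    show "?E \<subseteq> T \<union> N" by (auto simp: N_def)
    show "T \<union> N \<in> lmeasurable"
      using Tm N by (simp add: fmeasurable.Un negligible_iff_measure)
    have "measure lebesgue (T \<union> N) \<le> measure lebesgue T + measure lebesgue N"
      using Tm N by (intro measure_Un_le) (auto simp: negligible_imp_sets)
    also have "measure lebesgue N = 0" using N by (simp add: negligible_imp_measure0)
    also have "measure lebesgue T \<le> e"
      using Te \<open>0 < e\<close> by (metis enn2real_leI measure_def less_imp_le)
    finally show "measure lebesgue (T \<union> N) \<le> e" by simp
  qed
qed

text \<open>For rational \<open>p\<close> the density \<open>max 0 (f - p)\<close> vanishes on \<open>{f \<le> p}\<close>, so its averages vanish in the limit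
  at almost every point there, and the averages of \<open>f\<close> cannot exceed \<open>p\<close> in the limit.\<close>

lemma lebesgue_upper_derivate_le:
  fixes f :: "real \<Rightarrow> real"
  assumes f: "set_integrable lborel {u..v} f" and fm: "f \<in> borel_measurable borel"
  shows "AE x in lebesgue. x \<in> {u<..<v} \<longrightarrow>
    (\<forall>e>0. \<exists>d>0. \<forall>a b. a \<le> x \<longrightarrow> x \<le> b \<longrightarrow> a < b \<longrightarrow> b - a < d \<longrightarrow>
       (LINT t:{a..b}|lborel. f t) \<le> (f x + e) * (b - a))"
proof -
  define h where "h p t = indicator {u..v} t * max 0 (f t - p)" for p t
  define \<nu> where "\<nu> p = density lborel (\<lambda>t. ennreal (h p t))" for p
  have hm [measurable]: "h p \<in> borel_measurable borel" for p
    using fm unfolding h_def by measurable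
  have h0: "0 \<le> h p t" for p t by (auto simp: h_def)
  have hint: "integrable lborel (h p)" for p
  proof -
    have "emeasure lborel {u..v} < \<infinity>" by (simp add: emeasure_lborel_Icc_eq)
    then
    have "integrable lborel (\<lambda>t. indicator {u..v} t *\<^sub>R f t - p * indicator {u..v} t)"
      using f unfolding set_integrable_def
      by (intro Bochner_Integration.integrable_diff integrable_mult_right integrable_real_indicator) auto
    then show ?thesis
      by (rule Bochner_Integration.integrable_bound) (auto simp: h_def indicator_def)
  qed
  define A where "A p = {x \<in> {u<..<v}. f x \<le> p}" for p
  have Am: "A p \<in> sets borel" for p
  proof -
    have "A p = {u<..<v} \<inter> {x \<in> space borel. f x \<le> p}" by (auto simp: A_def)
    then show ?thesis using fm by simp
  qed
  define Bad where "Bad p c = {x \<in> A p. \<forall>d>0. \<exists>a b. a \<le> x \<and> x \<le> b \<and> a < b \<and> b - a < d \<and>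
                        ennreal (c * (b - a)) < emeasure (\<nu> p) {a..b}}" for p c
  have bad: "negligible (Bad p c)" if "0 < c" for p c
    unfolding Bad_def
  proof (rule negligible_density_zero_points[OF _ _ Am _ that])
    show "sets (\<nu> p) = sets borel" by (simp add: \<nu>_def)
    have "emeasure (\<nu> p) UNIV = (\<integral>\<^sup>+t. ennreal (h p t) \<partial>lborel)"
      by (simp add: \<nu>_def emeasure_density)
    also have "\<dots> < \<infinity>" using hint[of p] h0 by (simp add: integrable_iff_bounded)
    finally show "emeasure (\<nu> p) UNIV \<noteq> \<infinity>" by simp
    have "emeasure (\<nu> p) (A p) = (\<integral>\<^sup>+t. ennreal (h p t) * indicator (A p) t \<partial>lborel)"
      using Am by (simp add: \<nu>_def emeasure_density)
    also have "(\<lambda>t. ennreal (h p t) * indicator (A p) t) = (\<lambda>t. 0)"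
      by (auto simp: fun_eq_iff A_def h_def indicator_def)
    finally show "emeasure (\<nu> p) (A p) = 0" by simp
  qed
  \<comment> \<open>Rational \<open>p\<close> and the thresholds \<open>1 / real (Suc n)\<close>
    keep the exceptional set a countable union, so that one null set serves every
    \<open>e\<close>.\<close>
  have "negligible (\<Union>p\<in>\<rat>. \<Union>n. Bad p (1 / real (Suc n)))"
    by (intro negligible_countable_Union countable_image countable_rat)
       (auto intro!: negligible_Union_nat bad)
  then have "AE x in lebesgue. x \<notin> (\<Union>p\<in>\<rat>. \<Union>n. Bad p (1 / real (Suc n)))"
    unfolding negligible_iff_null_sets by (rule AE_not_in)
  then show ?thesis
  proof (rule AE_mp, intro AE_I2 impI allI)
    fix x e :: real assume nb: "x \<notin> (\<Union>p\<in>\<rat>. \<Union>n. Bad p (1 / real (Suc n)))"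
      and x: "x \<in> {u<..<v}" and "0 < e"
    obtain p where p: "p \<in> \<rat>" "f x < p" "p < f x + e / 2"
      using Rats_dense_in_real[of "f x" "f x + e/2"] \<open>0 < e\<close> by auto
    obtain n where n: "1 / real (Suc n) < e / 2"
      using \<open>0 < e\<close> by (metis half_gt_zero inverse_eq_divide reals_Archimedean)
    have "x \<in> A p" using x p by (auto simp: A_def)
    moreover have "x \<notin> Bad p (1 / real (Suc n))" using nb p(1) by blast
    ultimately obtain d where "0 < d" and d': "\<nexists>a b. a \<le> x \<and> x \<le> b \<and> a < b \<and> b - a < d \<and>
        ennreal (1 / real (Suc n) * (b - a)) < emeasure (\<nu> p) {a..b}"
      unfolding Bad_def by blast
    have d: "0 < d" "\<And>a b. a \<le> x \<Longrightarrow> x \<le> b \<Longrightarrow> a < b \<Longrightarrow> b - a < d \<Longrightarrow>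
        emeasure (\<nu> p) {a..b} \<le> ennreal (1 / real (Suc n) * (b - a))"
      using \<open>0 < d\<close> d' by (auto simp: not_less[symmetric])
    show "\<exists>d>0. \<forall>a b. a \<le> x \<longrightarrow> x \<le> b \<longrightarrow> a < b \<longrightarrow> b - a < d \<longrightarrow>
       (LINT t:{a..b}|lborel. f t) \<le> (f x + e) * (b - a)"
    \<comment> \<open>Staying inside \<open>{u..v}\<close> matters because \<open>h p\<close> is cut
      off outside it.\<close>
    proof (intro exI[of _ "min d (min (x - u) (v - x))"] conjI allI impI)
      show "0 < min d (min (x - u) (v - x))" using d x by auto
      fix a b assume ab: "a \<le> x" "x \<le> b" "a < b" "b - a < min d (min (x - u) (v - x))"
      have sub: "{a..b} \<subseteq> {u..v}" using ab by auto
      have "(\<integral>\<^sup>+t. ennreal (h p t * indicator {a..b} t) \<partial>lborel) = emeasure (\<nu> p) {a..b}"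
        by (auto simp: \<nu>_def emeasure_density ennreal_mult' h0 intro!: nn_integral_cong split: split_indicator)
      also have "\<dots> \<le> ennreal (1 / real (Suc n) * (b - a))" using d ab by auto
      finally have "enn2real (\<integral>\<^sup>+t. ennreal (h p t * indicator {a..b} t) \<partial>lborel)
           \<le> 1 / real (Suc n) * (b - a)"
        using ab by (intro enn2real_leI) auto
      then have 1: "(LINT t|lborel. h p t * indicator {a..b} t) \<le> 1 / real (Suc n) * (b - a)"
        by (subst integral_eq_nn_integral) (auto simp: h0)
      \<comment> \<open>On \<open>{u..v}\<close> the function \<open>f\<close> is at most
        \<open>p + h p\<close>, and the average of \<open>h p\<close> contributes at most
        \<open>e / 2\<close>.\<close>
      have "(LINT t:{a..b}|lborel. f t) \<le>
          (LINT t|lborel. p * indicator {a..b} t + h p t * indicator {a..b} t)"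
        unfolding set_lebesgue_integral_def
      proof (rule integral_mono)
        show "integrable lborel (\<lambda>t. indicator {a..b} t *\<^sub>R f t)"
          using set_integrable_subset[OF f _ sub] by (simp add: set_integrable_def)
        show "integrable lborel (\<lambda>t. p * indicator {a..b} t + h p t * indicator {a..b} t)"
          using hint[of p] by (intro Bochner_Integration.integrable_add integrable_mult_right
              integrable_real_mult_indicator integrable_real_indicator) (auto simp: emeasure_lborel_Icc_eq)
      qed (use sub in \<open>auto simp: h_def indicator_def\<close>)
      also have "\<dots> = p * (b - a) + (LINT t|lborel. h p t * indicator {a..b} t)"
      proof (subst Bochner_Integration.integral_add)
        show "integrable lborel (\<lambda>t. h p t * indicator {a..b} t)"
          using hint[of p] by (intro integrable_real_mult_indicator) auto
      qed (use ab in \<open>auto intro!: integrable_mult_right integrable_real_indicator\<close>)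
      also have "\<dots> \<le> p * (b - a) + e / 2 * (b - a)"
        using 1 n ab by (smt (verit) mult_right_mono)
      also have "\<dots> = (p + e / 2) * (b - a)" by (simp add: algebra_simps)
      also have "\<dots> \<le> (f x + e) * (b - a)"
        using p ab by (intro mult_right_mono) auto
      finally show "(LINT t:{a..b}|lborel. f t) \<le> (f x + e) * (b - a)" .
    qed
  qed
qed

text \<open>The upper estimates for \<open>f\<close> and \<open>- f\<close> are the two halves. The
  intervals need only contain \<open>x\<close>, because the derivative of an integral uses intervals
  with \<open>x\<close> as an end point.\<close>

theorem lebesgue_differentiation:
  fixes f :: "real \<Rightarrow> real"
  assumes f: "set_integrable lborel {u..v} f" and fm: "f \<in> borel_measurable borel"
  shows "AE x in lebesgue. x \<in> {u<..<v} \<longrightarrow>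
    (\<forall>e>0. \<exists>d>0. \<forall>a b. a \<le> x \<longrightarrow> x \<le> b \<longrightarrow> a < b \<longrightarrow> b - a < d \<longrightarrow>
       \<bar>(LINT t:{a..b}|lborel. f t) - f x * (b - a)\<bar> \<le> e * (b - a))"
proof -
  have f': "set_integrable lborel {u..v} (\<lambda>x. - f x)"
    using f by (simp add: set_integrable_def)
  have *: "(LINT t:{a..b}|lborel. - f t) = - (LINT t:{a..b}|lborel. f t)" for a b
    by (simp add: set_lebesgue_integral_def)
  show ?thesis
    using lebesgue_upper_derivate_le[OF f fm] lebesgue_upper_derivate_le[OF f' borel_measurable_uminus[OF fm]]
  proof (eventually_elim, intro impI allI)
    case (elim x)
    fix e :: real assume x: "x \<in> {u<..<v}" and "0 < e"
    obtain d1 where d1: "d1 > 0" "\<And>a b. a \<le> x \<Longrightarrow> x \<le> b \<Longrightarrow> a < b \<Longrightarrow> b - a < d1 \<Longrightarrow>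
       (LINT t:{a..b}|lborel. f t) \<le> (f x + e) * (b - a)"
      using elim(1) x \<open>0 < e\<close> by meson
    obtain d2 where d2: "d2 > 0" "\<And>a b. a \<le> x \<Longrightarrow> x \<le> b \<Longrightarrow> a < b \<Longrightarrow> b - a < d2 \<Longrightarrow>
       (LINT t:{a..b}|lborel. - f t) \<le> (- f x + e) * (b - a)"
      using elim(2) x \<open>0 < e\<close> by meson
    show "\<exists>d>0. \<forall>a b. a \<le> x \<longrightarrow> x \<le> b \<longrightarrow> a < b \<longrightarrow> b - a < d \<longrightarrow>
       \<bar>(LINT t:{a..b}|lborel. f t) - f x * (b - a)\<bar> \<le> e * (b - a)"
    proof (intro exI[of _ "min d1 d2"] conjI allI impI)
      fix a b assume "a \<le> x" "x \<le> b" "a < b" "b - a < min d1 d2"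
      with d1(2)[of a b] d2(2)[of a b]
      show "\<bar>(LINT t:{a..b}|lborel. f t) - f x * (b - a)\<bar> \<le> e * (b - a)"
        by (auto simp: * algebra_simps abs_le_iff)
    qed (use d1 d2 in auto)
  qed
qed

section \<open>Dyadic increments and absolutely continuous functions\<close>

definition dyad :: "nat \<Rightarrow> nat \<Rightarrow> real" where
  "dyad N k = real k / 2 ^ N"

definition cell_incr :: "(real \<Rightarrow> real) \<Rightarrow> nat \<Rightarrow> nat \<Rightarrow> real" where
  "cell_incr \<phi> N k = \<phi> (dyad N (Suc k)) - \<phi> (dyad N k)"

text \<open>Cells are closed on the left, so \<open>t = 1\<close> receives the index
  \<open>2 ^ N\<close>, one beyond the last cell; several proofs treat that point apart.\<close>

definition cell_index :: "nat \<Rightarrow> real \<Rightarrow> nat" where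
  "cell_index N t = nat \<lfloor>2 ^ N * t\<rfloor>"

lemma dyad_0 [simp]: "dyad N 0 = 0" by (simp add: dyad_def)

lemma dyad_full [simp]: "dyad N (2 ^ N) = 1" by (simp add: dyad_def)

lemma dyad_nonneg [simp]: "0 \<le> dyad N k" by (simp add: dyad_def)

lemma dyad_mono: "j \<le> k \<Longrightarrow> dyad N j \<le> dyad N k"
  by (simp add: dyad_def divide_right_mono)

lemma dyad_le_1 [simp]: "dyad N k \<le> 1 \<longleftrightarrow> k \<le> 2 ^ N"
  by (simp add: dyad_def divide_le_eq_1)

lemma dyad_Suc: "dyad N (Suc k) = dyad N k + 1 / 2 ^ N"
  by (simp add: dyad_def add_divide_distrib)

lemma dyad_refine: "dyad (N + m) (k * 2 ^ m) = dyad N k"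
  by (simp add: dyad_def power_add)

lemma cell_incr_halves:
  "cell_incr \<phi> N k = cell_incr \<phi> (Suc N) (2 * k) + cell_incr \<phi> (Suc N) (Suc (2 * k))"
proof -
  have "dyad (Suc N) (2 * k) = dyad N k" "dyad (Suc N) (Suc (Suc (2 * k))) = dyad N (Suc k)"
    by (simp_all add: dyad_def field_simps)
  then show ?thesis by (simp add: cell_incr_def)
qed

lemma sum_cell_incr:
  "i \<le> j \<Longrightarrow> (\<Sum>k=i..<j. cell_incr \<phi> N k) = \<phi> (dyad N j) - \<phi> (dyad N i)"
  unfolding cell_incr_def by (rule sum_Suc_diff'[where f = "\<lambda>k. \<phi> (dyad N k)"])

lemma cell_index_dyad [simp]: "cell_index N (dyad N k) = k"
  by (simp add: cell_index_def dyad_def)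

lemma cell_index_dyad_refine: "cell_index (N + m) (dyad N k) = k * 2 ^ m"
  by (metis cell_index_dyad dyad_refine)

lemma cell_index_mono: "s \<le> t \<Longrightarrow> cell_index N s \<le> cell_index N t"
  by (simp add: cell_index_def nat_mono floor_mono)

lemma dyad_cell_index_le: "0 \<le> t \<Longrightarrow> dyad N (cell_index N t) \<le> t"
  by (simp add: cell_index_def dyad_def field_simps)

lemma less_dyad_Suc_cell_index: "0 \<le> t \<Longrightarrow> t < dyad N (Suc (cell_index N t))"
  by (simp add: cell_index_def dyad_def field_simps) linarith

lemma cell_index_le: "t \<le> 1 \<Longrightarrow> cell_index N t \<le> 2 ^ N"
  using cell_index_mono[of t 1 N] cell_index_dyad[of N "2 ^ N"] by simp

lemma cell_index_less: "0 \<le> t \<Longrightarrow> t < 1 \<Longrightarrow> cell_index N t < 2 ^ N"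
proof -
  assume "0 \<le> t" "t < 1"
  then have "dyad N (cell_index N t) < 1" using dyad_cell_index_le[of t N] by linarith
  then have "real (cell_index N t) < 2 ^ N" by (simp add: dyad_def)
  then show ?thesis by (metis of_nat_less_iff of_nat_numeral of_nat_power)
qed

lemma cell_index_Suc: "0 \<le> t \<Longrightarrow> cell_index (Suc N) t = 2 * cell_index N t \<or>
    cell_index (Suc N) t = Suc (2 * cell_index N t)"
proof -
  assume t: "0 \<le> t"
  define k where "k = \<lfloor>2 ^ N * t\<rfloor>"
  have k: "of_int k \<le> 2 ^ N * t" "2 ^ N * t < of_int k + 1" "0 \<le> k"
    using t by (auto simp: k_def)
  have "\<lfloor>2 ^ Suc N * t\<rfloor> = 2 * k \<or> \<lfloor>2 ^ Suc N * t\<rfloor> = 2 * k + 1"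
    using k by (auto simp: floor_eq_iff algebra_simps)
  then show ?thesis using k(3) unfolding cell_index_def k_def[symmetric]
    by (auto simp: nat_mult_distrib nat_add_distrib)
qed

lemma tendsto_dyad_cell_index:
  assumes "0 \<le> t" shows "(\<lambda>N. dyad N (cell_index N t)) \<longlonglongrightarrow> t"
proof (rule tendsto_sandwich[where f = "\<lambda>N. t - (1/2) ^ N" and h = "\<lambda>N. t"])
  show "\<forall>\<^sub>F N in sequentially. t - (1/2) ^ N \<le> dyad N (cell_index N t)"
    using less_dyad_Suc_cell_index[OF assms] by (auto simp: dyad_Suc power_divide algebra_simps intro!: always_eventually less_imp_le)
  have "(\<lambda>N. t - (1/2) ^ N :: real) \<longlonglongrightarrow> t - 0"
    by (intro tendsto_intros) (simp add: LIMSEQ_power_zero)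
  then show "(\<lambda>N. t - (1/2) ^ N :: real) \<longlonglongrightarrow> t" by simp
  show "\<forall>\<^sub>F N in sequentially. dyad N (cell_index N t) \<le> t"
    by (intro always_eventually allI dyad_cell_index_le assms)
qed simp

section \<open>Variation, density and derivative of absolutely continuous functions\<close>

lemma absolutely_continuous_on_modulus:
  assumes "absolutely_continuous_on {0..1} F" "0 < e"
  obtains d where "0 < d" "\<And>x y. 0 \<le> x \<Longrightarrow> x \<le> y \<Longrightarrow> y \<le> 1 \<Longrightarrow> y - x < d \<Longrightarrow> \<bar>F y - F x\<bar> < e"
    "\<And>N A. A \<subseteq> {..<2 ^ N} \<Longrightarrow> real (card A) / 2 ^ N < d \<Longrightarrow> (\<Sum>k\<in>A. \<bar>cell_incr F N k\<bar>) < e"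
proof -
  from assms(1)[unfolded absolutely_continuous_on_def, rule_format, OF assms(2)]
  obtain d where "0 < d" and dd: "\<forall>(n::nat) a b.
        (\<forall>i<n. a i \<le> b i \<and> {a i..b i} \<subseteq> {0..1}) \<and>
        disjoint_family_on (\<lambda>i. {a i<..<b i}) {..<n} \<and>
        (\<Sum>i<n. b i - a i) < d \<longrightarrow> (\<Sum>i<n. \<bar>F (b i) - F (a i)\<bar>) < e"
    by (elim exE conjE)
  have d: "(\<Sum>i<n. \<bar>F (b i) - F (a i)\<bar>) < e"
    if "\<forall>i<n. a i \<le> b i \<and> {a i..b i} \<subseteq> {0..1}"
      "disjoint_family_on (\<lambda>i. {a i<..<b i}) {..<n}" "(\<Sum>i<n. b i - a i) < d" for n :: nat and a b
    by (rule dd[rule_format]) (use that in blast)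
  show thesis
  proof
    show "\<bar>F y - F x\<bar> < e" if "0 \<le> x" "x \<le> y" "y \<le> 1" "y - x < d" for x y
    proof -
      have "(\<Sum>i<(1::nat). \<bar>F y - F x\<bar>) < e"
        by (rule d) (use that in \<open>auto simp: disjoint_family_on_def\<close>)
      then show ?thesis by simp
    qed
    fix N and A :: "nat set" assume A: "A \<subseteq> {..<2 ^ N}" "real (card A) / 2 ^ N < d"
    have "finite A" using A(1) finite_subset by blast
    then obtain g where g: "bij_betw g {..<card A} A"
      using ex_bij_betw_nat_finite[of A] by (auto simp: atLeast0LessThan)
    have gA: "g i \<in> A" if "i < card A" for i using g that by (auto simp: bij_betw_def)
    have "(\<Sum>i<card A. \<bar>F (dyad N (Suc (g i))) - F (dyad N (g i))\<bar>) < e"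
    proof (rule d)
      show "\<forall>i<card A. dyad N (g i) \<le> dyad N (Suc (g i)) \<and> {dyad N (g i)..dyad N (Suc (g i))} \<subseteq> {0..1}"
      proof (intro allI impI conjI)
        fix i assume "i < card A"
        then have "Suc (g i) \<le> 2 ^ N" using gA A(1) by (force simp: Suc_le_eq)
        then have "dyad N (Suc (g i)) \<le> 1" by simp
        then show "{dyad N (g i)..dyad N (Suc (g i))} \<subseteq> {0..1}"
          using dyad_nonneg[of N "g i"] by (meson atLeastatMost_subset_iff order_trans)
      qed (simp add: dyad_mono)
      show "disjoint_family_on (\<lambda>i. {dyad N (g i)<..<dyad N (Suc (g i))}) {..<card A}"
      proof (unfold disjoint_family_on_def, intro ballI impI)
        fix i j assume ij: "i \<in> {..<card A}" "j \<in> {..<card A}" "i \<noteq> j"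
        then have "g i \<noteq> g j" using g by (auto simp: bij_betw_def inj_on_def)
        then have "Suc (g i) \<le> g j \<or> Suc (g j) \<le> g i" by linarith
        then have "dyad N (Suc (g i)) \<le> dyad N (g j) \<or> dyad N (Suc (g j)) \<le> dyad N (g i)"
          using dyad_mono by blast
        then show "{dyad N (g i)<..<dyad N (Suc (g i))} \<inter> {dyad N (g j)<..<dyad N (Suc (g j))} = {}"
          by auto
      qed
      show "(\<Sum>i<card A. dyad N (Suc (g i)) - dyad N (g i)) < d"
        using A(2) by (simp add: dyad_Suc)
    qed
    also have "(\<Sum>i<card A. \<bar>F (dyad N (Suc (g i))) - F (dyad N (g i))\<bar>) = (\<Sum>k\<in>A. \<bar>cell_incr F N k\<bar>)"
      unfolding cell_incr_def by (rule sum.reindex_bij_betw[OF g])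
    finally show "(\<Sum>k\<in>A. \<bar>cell_incr F N k\<bar>) < e" .
  qed (rule \<open>0 < d\<close>)
qed

lemma absolutely_continuous_on_continuous:
  assumes "absolutely_continuous_on {0..1} F"
  shows "continuous_on {0..1} F"
  unfolding continuous_on_iff
proof (intro ballI allI impI)
  fix x e :: real assume x: "x \<in> {0..1}" and "0 < e"
  obtain d where d: "0 < d" "\<And>x y. 0 \<le> x \<Longrightarrow> x \<le> y \<Longrightarrow> y \<le> 1 \<Longrightarrow> y - x < d \<Longrightarrow> \<bar>F y - F x\<bar> < e"
    using absolutely_continuous_on_modulus[OF assms \<open>0 < e\<close>] by metis
  show "\<exists>d>0. \<forall>x'\<in>{0..1}. dist x' x < d \<longrightarrow> dist (F x') (F x) < e"
  proof (intro exI[of _ d] conjI ballI impI)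
    fix x' assume "x' \<in> {0..1}" "dist x' x < d"
    then show "dist (F x') (F x) < e"
      using d(2)[of x x'] d(2)[of x' x] x by (cases "x \<le> x'") (auto simp: dist_real_def abs_minus_commute)
  qed (rule d(1))
qed

text \<open>Used with \<open>q = 2 ^ m\<close> to pass from cells of level \<open>N\<close> to the
  cells of level \<open>N + m\<close> inside them.\<close>

lemma finite_UN_blocks:
  fixes A :: "nat set" and q :: nat
  assumes "finite A"
  shows "(\<Sum>k\<in>A. \<Sum>j=k*q..<Suc k*q. g j) = (\<Sum>j\<in>(\<Union>k\<in>A. {k*q..<Suc k*q}). g j :: real)"
proof (rule sum.UNION_disjoint[symmetric])
  show "\<forall>i\<in>A. \<forall>j\<in>A. i \<noteq> j \<longrightarrow> {i*q..<Suc i*q} \<inter> {j*q..<Suc j*q} = {}"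
  proof (intro ballI impI)
    fix i j :: nat assume "i \<noteq> j"
    then have "Suc i \<le> j \<or> Suc j \<le> i" by linarith
    then have "Suc i * q \<le> j * q \<or> Suc j * q \<le> i * q" by (meson mult_le_mono1)
    then show "{i*q..<Suc i*q} \<inter> {j*q..<Suc j*q} = {}" by auto
  qed
qed (use assms in auto)

lemma disjoint_family_dyad_Ioc: "disjoint_family_on (\<lambda>k. {dyad N k<..dyad N (Suc k)}) A"
proof (unfold disjoint_family_on_def, intro ballI impI)
  fix i j :: nat assume "i \<noteq> j"
  then have "Suc i \<le> j \<or> Suc j \<le> i" by linarith
  then have "dyad N (Suc i) \<le> dyad N j \<or> dyad N (Suc j) \<le> dyad N i"
    using dyad_mono by blast
  then show "{dyad N i<..dyad N (Suc i)} \<inter> {dyad N j<..dyad N (Suc j)} = {}" by auto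
qed

lemma sum_halves: "(\<Sum>k<2 * n. g k) = (\<Sum>k<n. g (2 * k) + g (Suc (2 * k)) :: 'b::comm_monoid_add)"
  by (induction n) (auto simp: algebra_simps)

text \<open>Restricting the variation to dyadic partitions costs nothing for continuous functions, and makes
  disjoint families of intervals into finite sets of cell indices.\<close>

definition dyadic_variation :: "(real \<Rightarrow> real) \<Rightarrow> nat \<Rightarrow> real \<Rightarrow> real" where
  "dyadic_variation F N x = (\<Sum>k<cell_index N x. \<bar>cell_incr F N k\<bar>)"

lemma dyadic_variation_diff:
  assumes "x \<le> y"
  shows "dyadic_variation F N y - dyadic_variation F N x =
         (\<Sum>k=cell_index N x..<cell_index N y. \<bar>cell_incr F N k\<bar>)"
  unfolding dyadic_variation_def lessThan_atLeast0
  using sum_diff_nat_ivl[of 0 "cell_index N x" "cell_index N y" "\<lambda>k. \<bar>cell_incr F N k\<bar>"]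
    cell_index_mono[OF assms, of N] by simp

lemma dyadic_variation_Suc:
  assumes "0 \<le> x" shows "dyadic_variation F N x \<le> dyadic_variation F (Suc N) x"
proof -
  have "dyadic_variation F N x \<le>
      (\<Sum>k<cell_index N x. \<bar>cell_incr F (Suc N) (2 * k)\<bar> + \<bar>cell_incr F (Suc N) (Suc (2 * k))\<bar>)"
    unfolding dyadic_variation_def by (intro sum_mono) (subst cell_incr_halves, rule abs_triangle_ineq)
  also have "\<dots> = (\<Sum>k<2 * cell_index N x. \<bar>cell_incr F (Suc N) k\<bar>)"
    by (rule sum_halves[symmetric])
  also have "\<dots> \<le> dyadic_variation F (Suc N) x"
    unfolding dyadic_variation_def using cell_index_Suc[OF assms, of N]
    by (intro sum_mono2) auto
  finally show ?thesis .
qed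

text \<open>\<open>V\<close> is the limit of the dyadic variations. They increase with the level by
  the triangle inequality and stay bounded because \<open>{0..1}\<close> splits into finitely many
  pieces so short that each contributes at most \<open>1\<close>. Both smallness properties pass
  from finite levels to the limit; the one for cells is phrased with index sets because open sets
  are later exhausted by cells.\<close>

lemma absolutely_continuous_on_variation:
  assumes ac: "absolutely_continuous_on {0..1} F"
  obtains V where
    "\<And>x y. 0 \<le> x \<Longrightarrow> x \<le> y \<Longrightarrow> y \<le> 1 \<Longrightarrow> \<bar>F y - F x\<bar> \<le> V y - V x"
    "\<And>e. 0 < e \<Longrightarrow> \<exists>d>0. \<forall>x y. 0 \<le> x \<longrightarrow> x \<le> y \<longrightarrow> y \<le> 1 \<longrightarrow> y - x < d \<longrightarrow> V y - V x \<le> e"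
    "\<And>e. 0 < e \<Longrightarrow> \<exists>d>0. \<forall>N A. A \<subseteq> {..<2 ^ N} \<longrightarrow> real (card A) / 2 ^ N < d \<longrightarrow>
         (\<Sum>k\<in>A. cell_incr V N k) \<le> e"
proof -
  let ?v = "dyadic_variation F"
  \<comment> \<open>Rounding both ends down to the grid lengthens the interval by at most one cell,
    whence the extra \<open>1 / 2 ^ N\<close>.\<close>
  have v_diff: "?v N y - ?v N x \<le> e"
    if d: "\<And>N A. A \<subseteq> {..<2 ^ N} \<Longrightarrow> real (card A) / 2 ^ N < d \<Longrightarrow> (\<Sum>k\<in>A. \<bar>cell_incr F N k\<bar>) < e"
      and xy: "0 \<le> x" "x \<le> y" "y \<le> 1" "y - x + 1 / 2 ^ N < d" for x y d e N
  proof -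
    have "dyad N (cell_index N y) - dyad N (cell_index N x) \<le> y - x + 1 / 2 ^ N"
      using dyad_cell_index_le[of y N] less_dyad_Suc_cell_index[of x N] xy by (simp add: dyad_Suc)
    then have "(\<Sum>k\<in>{cell_index N x..<cell_index N y}. \<bar>cell_incr F N k\<bar>) < e"
      using xy cell_index_le[of y N] cell_index_mono[of x y N]
      by (intro d) (auto simp: dyad_def of_nat_diff diff_divide_distrib)
    then show ?thesis using dyadic_variation_diff[OF xy(2), of F N] by simp
  qed
  obtain d where d: "0 < d"
    "\<And>N A. A \<subseteq> {..<2 ^ N} \<Longrightarrow> real (card A) / 2 ^ N < d \<Longrightarrow> (\<Sum>k\<in>A. \<bar>cell_incr F N k\<bar>) < 1"
    using absolutely_continuous_on_modulus[OF ac zero_less_one] by metis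
  have ev: "\<forall>\<^sub>F N in sequentially. c + 1 / 2 ^ N < d" if "c < d" for c d :: real
  proof -
    have "(\<lambda>N. c + (1/2) ^ N :: real) \<longlonglongrightarrow> c + 0"
      by (intro tendsto_intros) (simp add: LIMSEQ_power_zero)
    then show ?thesis using that order_tendstoD(2) by (fastforce simp: power_divide)
  qed
  \<comment> \<open>Pieces shorter than \<open>d / 2\<close> leave the other half of
    \<open>d\<close> for the rounding error at levels from \<open>N0\<close> on.\<close>
  obtain n where n: "1 / real (Suc n) < d / 2" using d(1)
    by (metis half_gt_zero inverse_eq_divide reals_Archimedean)
  obtain N0 where N0: "\<And>N. N \<ge> N0 \<Longrightarrow> d / 2 + 1 / 2 ^ N < d"
    using ev[of "d / 2" d] d(1) by (auto simp: eventually_sequentially)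
  have v_mono: "?v N x \<le> ?v N y" if "x \<le> y" for N x y
    unfolding dyadic_variation_def using cell_index_mono[OF that] by (intro sum_mono2) auto
  have inc: "incseq (\<lambda>N. ?v N x)" if "0 \<le> x" for x
    using dyadic_variation_Suc[OF that] by (rule incseq_SucI)
  have "?v N 1 \<le> real (Suc n)" if "N0 \<le> N" for N
  proof -
    have "?v N 1 = (\<Sum>i<Suc n. ?v N (real (Suc i) / real (Suc n)) - ?v N (real i / real (Suc n)))"
      using sum_lessThan_telescope[of "\<lambda>i. ?v N (real i / real (Suc n))" "Suc n"]
      by (simp add: dyadic_variation_def cell_index_def)
    also have "\<dots> \<le> (\<Sum>i<Suc n. 1)"
    proof (intro sum_mono v_diff[OF d(2)])
      fix i assume "i \<in> {..<Suc n}"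
      then show "real (Suc i) / real (Suc n) \<le> 1" by (simp add: divide_le_eq)
      have "real (Suc i) / real (Suc n) - real i / real (Suc n) = 1 / real (Suc n)"
        by (simp add: diff_divide_distrib[symmetric])
      then show "real (Suc i) / real (Suc n) - real i / real (Suc n) + 1 / 2 ^ N < d"
        using n N0[OF that] by linarith
    qed (auto simp: divide_right_mono)
    finally show ?thesis by simp
  qed
  then have bd: "?v N x \<le> real (Suc n)" if "0 \<le> x" "x \<le> 1" for x N
  proof -
    have "?v N x \<le> ?v (max N N0) x" using monoD[OF inc[OF that(1)], of N "max N N0"] by simp
    also have "\<dots> \<le> ?v (max N N0) 1" using v_mono that by blast
    finally show ?thesis using \<open>\<And>N. N0 \<le> N \<Longrightarrow> ?v N 1 \<le> real (Suc n)\<close>[of "max N N0"] by linarith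
  qed
  define V where "V x = (SUP N. ?v N x)" for x
  have lim: "(\<lambda>N. ?v N x) \<longlonglongrightarrow> V x" if "0 \<le> x" "x \<le> 1" for x
    unfolding V_def using inc bd that
    by (intro LIMSEQ_incseq_SUP bdd_aboveI[of _ "real (Suc n)"]) auto
  have limd: "(\<lambda>N. ?v N y - ?v N x) \<longlonglongrightarrow> V y - V x" if "0 \<le> x" "x \<le> y" "y \<le> 1" for x y
    using that by (intro tendsto_diff lim) auto
  show thesis
  proof
    fix x y :: real assume xy: "0 \<le> x" "x \<le> y" "y \<le> 1"
    have Fc: "(\<lambda>N. F (dyad N (cell_index N t))) \<longlonglongrightarrow> F t" if "0 \<le> t" "t \<le> 1" for t
    proof (intro continuous_on_tendsto_compose[OF absolutely_continuous_on_continuous[OF ac] tendsto_dyad_cell_index])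
      have "dyad N (cell_index N t) \<le> 1" for N using dyad_cell_index_le[of t N] that by linarith
      then show "\<forall>\<^sub>F N in sequentially. dyad N (cell_index N t) \<in> {0..1}"
        by (intro always_eventually allI) simp
    qed (use that in auto)
    show "\<bar>F y - F x\<bar> \<le> V y - V x"
    proof (rule LIMSEQ_le[OF _ limd])
      show "(\<lambda>N. \<bar>F (dyad N (cell_index N y)) - F (dyad N (cell_index N x))\<bar>) \<longlonglongrightarrow> \<bar>F y - F x\<bar>"
        using xy by (intro tendsto_intros Fc) auto
      show "\<exists>N. \<forall>n\<ge>N. \<bar>F (dyad n (cell_index n y)) - F (dyad n (cell_index n x))\<bar> \<le> ?v n y - ?v n x"
        unfolding dyadic_variation_diff[OF xy(2)] sum_cell_incr[OF cell_index_mono[OF xy(2)], symmetric]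
        by (intro exI allI impI sum_abs)
    qed (use xy in auto)
  next
    fix e :: real assume "0 < e"
    then obtain d where d: "0 < d"
      "\<And>N A. A \<subseteq> {..<2 ^ N} \<Longrightarrow> real (card A) / 2 ^ N < d \<Longrightarrow> (\<Sum>k\<in>A. \<bar>cell_incr F N k\<bar>) < e"
      using absolutely_continuous_on_modulus[OF ac] by metis
    show "\<exists>d>0. \<forall>x y. 0 \<le> x \<longrightarrow> x \<le> y \<longrightarrow> y \<le> 1 \<longrightarrow> y - x < d \<longrightarrow> V y - V x \<le> e"
    proof (intro exI[of _ d] conjI allI impI)
      fix x y :: real assume xy: "0 \<le> x" "x \<le> y" "y \<le> 1" "y - x < d"
      show "V y - V x \<le> e"
        by (rule tendsto_upperbound[OF limd[OF xy(1-3)] eventually_mono[OF ev[OF xy(4)]]])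
           (use v_diff[OF d(2)] xy in auto)
    qed (rule d)
    show "\<exists>d>0. \<forall>N A. A \<subseteq> {..<2 ^ N} \<longrightarrow> real (card A) / 2 ^ N < d \<longrightarrow> (\<Sum>k\<in>A. cell_incr V N k) \<le> e"
    proof (intro exI[of _ d] conjI allI impI)
      fix N and A :: "nat set" assume A: "A \<subseteq> {..<2 ^ N}" "real (card A) / 2 ^ N < d"
      have fin: "finite A" using A(1) finite_subset by blast
      \<comment> \<open>The increments of \<open>V\<close> are limits along the levels
        \<open>N + m\<close>, where each cell of \<open>A\<close> becomes a block of
        \<open>2 ^ m\<close> cells and the total length is unchanged.\<close>
      have "(\<lambda>m. \<Sum>k\<in>A. ?v (N + m) (dyad N (Suc k)) - ?v (N + m) (dyad N k)) \<longlonglongrightarrow> (\<Sum>k\<in>A. cell_incr V N k)"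
        unfolding cell_incr_def[of V]
      proof (intro tendsto_sum)
        fix k assume "k \<in> A"
        then have "Suc k \<le> 2 ^ N" using A by auto
        then have "(\<lambda>m. ?v m (dyad N (Suc k)) - ?v m (dyad N k)) \<longlonglongrightarrow> V (dyad N (Suc k)) - V (dyad N k)"
          by (intro limd) (auto intro: dyad_mono)
        from LIMSEQ_ignore_initial_segment[OF this, of N]
        show "(\<lambda>m. ?v (N + m) (dyad N (Suc k)) - ?v (N + m) (dyad N k)) \<longlonglongrightarrow> V (dyad N (Suc k)) - V (dyad N k)"
          by (simp add: add.commute)
      qed
      then show "(\<Sum>k\<in>A. cell_incr V N k) \<le> e"
      proof (rule tendsto_upperbound[OF _ always_eventually])
        show "\<forall>m. (\<Sum>k\<in>A. ?v (N + m) (dyad N (Suc k)) - ?v (N + m) (dyad N k)) \<le> e"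
        proof
          fix m
          let ?B = "\<Union>k\<in>A. {k * 2 ^ m..<Suc k * 2 ^ m}"
          have "(\<Sum>k\<in>A. ?v (N + m) (dyad N (Suc k)) - ?v (N + m) (dyad N k)) =
             (\<Sum>k\<in>A. \<Sum>j=k * 2 ^ m..<Suc k * 2 ^ m. \<bar>cell_incr F (N + m) j\<bar>)"
            by (intro sum.cong refl)
               (simp only: dyadic_variation_diff[OF dyad_mono[OF le_SucI[OF order_refl]]] cell_index_dyad_refine)
          also have "\<dots> = (\<Sum>j\<in>?B. \<bar>cell_incr F (N + m) j\<bar>)"
            by (rule finite_UN_blocks[OF fin])
          also have "\<dots> < e"
          proof (rule d(2))
            have "Suc k * 2 ^ m \<le> 2 ^ (N + m)" if "k \<in> A" for k
            proof -
              have "Suc k \<le> 2 ^ N" using A(1) that by auto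
              then show ?thesis unfolding power_add by (rule mult_le_mono1)
            qed
            then have "{k * 2 ^ m..<Suc k * 2 ^ m} \<subseteq> {..<2 ^ (N + m)}" if "k \<in> A" for k
              using that by (meson atLeastLessThan_iff lessThan_iff order_less_le_trans subsetI)
            then show "?B \<subseteq> {..<2 ^ (N + m)}" by blast
            have "card ?B \<le> (\<Sum>k\<in>A. card {k * 2 ^ m..<Suc k * 2 ^ m})"
              by (rule card_UN_le[OF fin])
            also have "\<dots> = card A * 2 ^ m" by simp
            finally have "real (card ?B) \<le> real (card A * 2 ^ m)" by (simp only: of_nat_le_iff)
            then have "real (card ?B) / 2 ^ (N + m) \<le> real (card A * 2 ^ m) / 2 ^ (N + m)"
              by (rule divide_right_mono) simp
            also have "\<dots> = real (card A) / 2 ^ N" by (simp add: power_add)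
            finally have "real (card ?B) / 2 ^ (N + m) \<le> real (card A) / 2 ^ N" .
            then show "real (card ?B) / 2 ^ (N + m) < d" using A(2) by linarith
          qed
          finally show "(\<Sum>k\<in>A. ?v (N + m) (dyad N (Suc k)) - ?v (N + m) (dyad N k)) \<le> e" by simp
        qed
      qed simp
    qed (rule d)
  qed
qed

text \<open>\<open>G\<close> generates a Stieltjes measure, and Radon--Nikodym gives the density
  once Lebesgue null sets are seen to be null for it. Cover a null set by an open \<open>U\<close>
  of measure below \<open>d\<close>: at each level the cells inside \<open>U\<close> have total
  length below \<open>d\<close>, hence mass at most \<open>e\<close>, and with growing level they
  exhaust \<open>U\<close> within \<open>{0<..1}\<close>.\<close>

lemma cell_absolutely_continuous_density:
  fixes G :: "real \<Rightarrow> real"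
  assumes mono: "\<And>x y. 0 \<le> x \<Longrightarrow> x \<le> y \<Longrightarrow> y \<le> 1 \<Longrightarrow> G x \<le> G y"
    and modulus: "\<And>e. 0 < e \<Longrightarrow>
      \<exists>d>0. \<forall>x y. 0 \<le> x \<longrightarrow> x \<le> y \<longrightarrow> y \<le> 1 \<longrightarrow> y - x < d \<longrightarrow> G y - G x \<le> e"
    and cells: "\<And>e. 0 < e \<Longrightarrow> \<exists>d>0. \<forall>N A. A \<subseteq> {..<2 ^ N} \<longrightarrow> real (card A) / 2 ^ N < d \<longrightarrow>
         (\<Sum>k\<in>A. cell_incr G N k) \<le> e"
  shows "\<exists>f. f \<in> borel_measurable borel \<and> set_integrable lborel {0..1} f \<and>
    (\<forall>a b. 0 \<le> a \<longrightarrow> a \<le> b \<longrightarrow> b \<le> 1 \<longrightarrow> G b - G a = (LINT t:{a..b}|lborel. f t))"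
proof -
  \<comment> \<open>Clamping makes the distribution function monotone and right-continuous on the
    whole line, as a Stieltjes measure requires.\<close>
  define c where "c x = max 0 (min 1 x)" for x :: real
  define H where "H x = G (c x)" for x
  have H_mono: "H x \<le> H y" if "x \<le> y" for x y
    unfolding H_def c_def using that by (intro mono) auto
  have H_cont: "continuous (at_right a) H" for a
    unfolding continuous_within tendsto_iff
  proof (intro allI impI)
    fix e :: real assume "0 < e"
    then obtain d where d: "d > 0"
      "\<And>x y. 0 \<le> x \<Longrightarrow> x \<le> y \<Longrightarrow> y \<le> 1 \<Longrightarrow> y - x < d \<Longrightarrow> G y - G x \<le> e / 2"
      using modulus[of "e / 2"] by auto
    have "dist (H x) (H a) < e" if "a < x" "x < a + d" for x
    proof -
      have "H x - H a \<le> e / 2" unfolding H_def using that by (intro d(2)) (auto simp: c_def)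
      then show ?thesis using H_mono[of a x] that \<open>0 < e\<close> by (simp add: dist_real_def)
    qed
    then show "\<forall>\<^sub>F x in at_right a. dist (H x) (H a) < e"
      using d(1) by (auto simp: eventually_at_right_field intro!: exI[of _ "a + d"])
  qed
  have Ioc: "emeasure (interval_measure H) {a<..b} = ennreal (H b - H a)" if "a \<le> b" for a b
    using that H_mono H_cont by (intro emeasure_interval_measure_Ioc) auto
  define \<mu> where "\<mu> = density (interval_measure H) (indicator {0<..1})"
  have sets [simp, measurable_cong]: "sets \<mu> = sets borel" by (simp add: \<mu>_def)
  have mu: "emeasure \<mu> B = emeasure (interval_measure H) ({0<..1} \<inter> B)" if "B \<in> sets borel" for B
    using that unfolding \<mu>_def by (subst emeasure_density) (auto simp: nn_integral_indicator[symmetric] indicator_inter_arith intro!: nn_integral_cong)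
  have fin: "finite_measure \<mu>"
    by (rule finite_measureI) (simp add: mu \<mu>_def[THEN arg_cong[of _ _ space]] Ioc)
  have "emeasure \<mu> B \<le> ennreal e" if B: "B \<in> null_sets lborel" and "0 < e" for B e
  proof -
    obtain d where d: "0 < d" "\<And>N A. A \<subseteq> {..<2 ^ N} \<Longrightarrow> real (card A) / 2 ^ N < d \<Longrightarrow>
         (\<Sum>k\<in>A. cell_incr G N k) \<le> e" using cells[OF \<open>0 < e\<close>] by auto
    have Bb: "B \<in> sets borel" "emeasure lborel B = 0" using B by (auto simp: null_sets_def)
    then obtain U where U: "open U" "B \<subseteq> U" "emeasure lborel (U - B) < ennreal d"
      using outer_regular_lborel[OF Bb(1) d(1)] by blast
    have "emeasure lborel U = emeasure lborel (U - B)"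
      by (rule emeasure_Diff_null_set[symmetric]) (use B U(1) in auto)
    then have Ud: "emeasure lborel U < ennreal d" using U(3) by simp
    define K where "K N = {k. k < 2 ^ N \<and> {dyad N k<..dyad N (Suc k)} \<subseteq> U}" for N
    define W where "W N = (\<Union>k\<in>K N. {dyad N k<..dyad N (Suc k)})" for N
    have finK: "finite (K N)" for N by (simp add: K_def)
    have card_d: "real (card (K N)) / 2 ^ N < d" for N
    proof -
      have "emeasure lborel (W N) = (\<Sum>k\<in>K N. emeasure lborel {dyad N k<..dyad N (Suc k)})"
        unfolding W_def by (rule sum_emeasure[symmetric]) (use disjoint_family_dyad_Ioc finK in auto)
      also have "\<dots> = (\<Sum>k\<in>K N. ennreal (1 / 2 ^ N))"
        by (intro sum.cong) (auto simp: dyad_Suc)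
      also have "\<dots> = ennreal (real (card (K N)) / 2 ^ N)"
        by (subst sum_ennreal) auto
      finally have "ennreal (real (card (K N)) / 2 ^ N) \<le> emeasure lborel U"
        using emeasure_mono[of "W N" U lborel] U(1) by (auto simp: W_def K_def)
      then have "ennreal (real (card (K N)) / 2 ^ N) < ennreal d" using Ud by (rule le_less_trans)
      then show ?thesis by (simp add: ennreal_less_iff)
    qed
    have W_le: "emeasure (interval_measure H) (W N) \<le> ennreal e" for N
    proof -
      have "emeasure (interval_measure H) (W N) =
          (\<Sum>k\<in>K N. emeasure (interval_measure H) {dyad N k<..dyad N (Suc k)})"
        unfolding W_def by (rule sum_emeasure[symmetric]) (use disjoint_family_dyad_Ioc finK in auto)
      also have "\<dots> = (\<Sum>k\<in>K N. ennreal (cell_incr G N k))"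
      proof (intro sum.cong refl)
        fix k assume "k \<in> K N"
        then have "Suc k \<le> 2 ^ N" by (auto simp: K_def)
        then have "c (dyad N (Suc k)) = dyad N (Suc k)" "c (dyad N k) = dyad N k"
          by (auto simp: c_def)
        then show "emeasure (interval_measure H) {dyad N k<..dyad N (Suc k)} = ennreal (cell_incr G N k)"
          by (subst Ioc) (auto simp: dyad_mono H_def cell_incr_def)
      qed
      also have "\<dots> = ennreal (\<Sum>k\<in>K N. cell_incr G N k)"
        by (intro sum_ennreal) (auto simp: K_def cell_incr_def Suc_le_eq intro!: mono dyad_mono)
      also have "\<dots> \<le> ennreal e" by (intro ennreal_leI d(2) card_d) (auto simp: K_def)
      finally show ?thesis .
    qed
    have W_inc: "incseq W"
    proof (rule incseq_SucI)
      fix N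
      show "W N \<subseteq> W (Suc N)"
      proof
        fix x assume "x \<in> W N"
        then obtain k where k: "k < 2 ^ N" "{dyad N k<..dyad N (Suc k)} \<subseteq> U" "dyad N k < x" "x \<le> dyad N (Suc k)"
          by (auto simp: W_def K_def)
        have dd: "dyad (Suc N) (2 * k) = dyad N k" "dyad (Suc N) (Suc (Suc (2 * k))) = dyad N (Suc k)"
          by (simp_all add: dyad_def field_simps)
        have le: "dyad (Suc N) (2 * k) \<le> dyad (Suc N) (Suc (2 * k))"
          "dyad (Suc N) (Suc (2 * k)) \<le> dyad (Suc N) (Suc (Suc (2 * k)))" by (simp_all add: dyad_mono)
        show "x \<in> W (Suc N)"
        proof (cases "x \<le> dyad (Suc N) (Suc (2 * k))")
          case True
          have "{dyad (Suc N) (2 * k)<..dyad (Suc N) (Suc (2 * k))} \<subseteq> U"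
            using k(2) le dd by (intro order_trans[OF _ k(2)]) auto
          then have "2 * k \<in> K (Suc N)" using k(1) by (auto simp: K_def)
          then show ?thesis unfolding W_def using True k(3) dd by (intro UN_I[of "2 * k"]) auto
        next
          case False
          have "{dyad (Suc N) (Suc (2 * k))<..dyad (Suc N) (Suc (Suc (2 * k)))} \<subseteq> U"
            using k(2) le dd by (intro order_trans[OF _ k(2)]) auto
          then have "Suc (2 * k) \<in> K (Suc N)" using k(1) by (auto simp: K_def)
          then show ?thesis unfolding W_def using False k(4) dd by (intro UN_I[of "Suc (2 * k)"]) auto
        qed
      qed
    qed
    have W_UN: "{0<..1} \<inter> U \<subseteq> (\<Union>N. W N)"
    proof
      fix x assume x: "x \<in> {0<..1} \<inter> U"
      then obtain r where r: "0 < r" "ball x r \<subseteq> U" using U(1) by (auto simp: open_contains_ball)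
      obtain N where N: "(1/2) ^ N < r" using r(1) real_arch_pow_inv[of r "1/2"] by auto
      \<comment> \<open>The cells are open on the left here, so the index is the ceiling minus one
        and not \<open>cell_index\<close>.\<close>
      define k where "k = nat (\<lceil>2 ^ N * x\<rceil> - 1)"
      have k0: "0 \<le> \<lceil>2 ^ N * x\<rceil> - 1" using x by simp
      then have kr: "real k = of_int \<lceil>2 ^ N * x\<rceil> - 1" by (simp add: k_def of_nat_nat)
      have k: "dyad N k < x" "x \<le> dyad N (Suc k)"
        using kr ceiling_correct[of "2 ^ N * x"] by (auto simp: dyad_def field_simps)
      have "2 ^ N * x \<le> 2 ^ N" using x by simp
      then have "\<lceil>2 ^ N * x\<rceil> \<le> 2 ^ N" by (simp add: ceiling_le_iff)
      then have "real k < 2 ^ N" using kr by (metis diff_less_eq less_add_one of_int_le_iff of_int_numeral of_int_power order_le_less_trans)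
      then have "k < 2 ^ N" by (metis of_nat_less_iff of_nat_numeral of_nat_power)
      moreover have "{dyad N k<..dyad N (Suc k)} \<subseteq> U"
      proof
        fix y assume "y \<in> {dyad N k<..dyad N (Suc k)}"
        then have "\<bar>x - y\<bar> < r" using k N by (auto simp: dyad_Suc power_divide)
        then show "y \<in> U" using r(2) by (auto simp: dist_real_def subset_iff)
      qed
      ultimately show "x \<in> (\<Union>N. W N)" using k by (auto simp: W_def K_def)
    qed
    have "emeasure \<mu> B \<le> emeasure (interval_measure H) (\<Union>N. W N)"
      using Bb(1) U(2) W_UN by (subst mu) (auto intro!: emeasure_mono simp: W_def finK)
    also have "\<dots> = (SUP N. emeasure (interval_measure H) (W N))"
      by (rule SUP_emeasure_incseq[symmetric, OF _ W_inc]) (auto simp: W_def finK)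
    also have "\<dots> \<le> ennreal e" by (intro SUP_least W_le)
    finally show ?thesis .
  qed
  then have "emeasure \<mu> B = 0" if "B \<in> null_sets lborel" for B
    using ennreal_le_epsilon[of 0 "emeasure \<mu> B"] that by auto
  then have ac: "absolutely_continuous lborel \<mu>"
    unfolding absolutely_continuous_def by (auto simp: null_sets_def)
  obtain f where f: "f \<in> borel_measurable lborel" "AE x in lborel. RN_deriv lborel \<mu> x = ennreal (f x)"
    "\<And>x. 0 \<le> f x"
    using sigma_finite_measure.real_RN_deriv[OF sigma_finite_lborel fin ac] by auto
  have dens: "density lborel (RN_deriv lborel \<mu>) = \<mu>"
    using ac by (intro sigma_finite_measure.density_RN_deriv[OF sigma_finite_lborel]) auto
  have int: "emeasure \<mu> B = (\<integral>\<^sup>+x. ennreal (f x * indicator B x) \<partial>lborel)" if "B \<in> sets borel" for B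
  proof -
    have "emeasure \<mu> B = (\<integral>\<^sup>+x. RN_deriv lborel \<mu> x * indicator B x \<partial>lborel)"
      using that by (subst dens[symmetric], subst emeasure_density) auto
    also have "\<dots> = (\<integral>\<^sup>+x. ennreal (f x * indicator B x) \<partial>lborel)"
      using f(2) by (intro nn_integral_cong_AE) (auto elim!: eventually_mono split: split_indicator)
    finally show ?thesis .
  qed
  show ?thesis
  proof (intro exI[of _ f] conjI allI impI)
    show "f \<in> borel_measurable borel" using f(1) by simp
    have *: "set_integrable lborel B f" if "B \<in> sets borel" for B
      unfolding set_integrable_def
    proof (rule integrableI_nonneg)
      have "(\<integral>\<^sup>+x. ennreal (indicator B x *\<^sub>R f x) \<partial>lborel) = emeasure \<mu> B"
        using int[OF that] by (simp add: mult.commute)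
      also have "\<dots> < \<infinity>" using fin finite_measure.emeasure_finite[OF fin, of B] by (simp add: top.not_eq_extremum)
      finally show "(\<integral>\<^sup>+x. ennreal (indicator B x *\<^sub>R f x) \<partial>lborel) < \<infinity>" .
    qed (use that f in auto)
    then show "set_integrable lborel {0..1} f" by simp
    fix a b :: real assume ab: "0 \<le> a" "a \<le> b" "b \<le> 1"
    have "(LINT t:{a..b}|lborel. f t) = (LINT t:{a<..b}|lborel. f t)"
      unfolding set_lebesgue_integral_def
    proof (rule integral_cong_AE)
      show "AE t in lborel. indicator {a..b} t *\<^sub>R f t = indicator {a<..b} t *\<^sub>R f t"
        using AE_lborel_singleton[of a] by eventually_elim (auto split: split_indicator)
    qed (use f(1) in auto)
    also have "\<dots> = enn2real (\<integral>\<^sup>+x. ennreal (f x * indicator {a<..b} x) \<partial>lborel)"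
      unfolding set_lebesgue_integral_def using f by (subst integral_eq_nn_integral) (auto simp: mult.commute)
    also have "\<dots> = enn2real (emeasure \<mu> {a<..b})" by (subst int) auto
    also have "emeasure \<mu> {a<..b} = emeasure (interval_measure H) {a<..b}"
      using ab by (subst mu) (auto intro!: arg_cong2[where f = emeasure])
    also have "\<dots> = ennreal (G b - G a)" using ab by (subst Ioc) (auto simp: H_def c_def)
    finally show "G b - G a = (LINT t:{a..b}|lborel. f t)" using mono[of a b] ab by simp
  qed
qed

text \<open>Since increments of \<open>F\<close> are at most those of \<open>V\<close> in absolute
  value, those of \<open>V + F\<close> lie between \<open>0\<close> and twice those of
  \<open>V\<close>; the conditions of the density lemma therefore carry over to it.\<close>

theorem absolutely_continuous_on_fundamental:
  assumes ac: "absolutely_continuous_on {0..1} F"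
  obtains f where "f \<in> borel_measurable borel" "set_integrable lborel {0..1} f"
    "\<And>a b. 0 \<le> a \<Longrightarrow> a \<le> b \<Longrightarrow> b \<le> 1 \<Longrightarrow> F b - F a = (LINT t:{a..b}|lborel. f t)"
    "AE x in lebesgue. x \<in> {0<..<1} \<longrightarrow> (F has_real_derivative f x) (at x)"
proof (rule absolutely_continuous_on_variation[OF ac])
  fix V assume V: "\<And>x y. 0 \<le> x \<Longrightarrow> x \<le> y \<Longrightarrow> y \<le> 1 \<Longrightarrow> \<bar>F y - F x\<bar> \<le> V y - V x"
    "\<And>e. 0 < e \<Longrightarrow> \<exists>d>0. \<forall>x y. 0 \<le> x \<longrightarrow> x \<le> y \<longrightarrow> y \<le> 1 \<longrightarrow> y - x < d \<longrightarrow> V y - V x \<le> e"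
    "\<And>e. 0 < e \<Longrightarrow> \<exists>d>0. \<forall>N A. A \<subseteq> {..<2 ^ N} \<longrightarrow> real (card A) / 2 ^ N < d \<longrightarrow>
         (\<Sum>k\<in>A. cell_incr V N k) \<le> e"
  have V_mono: "V x \<le> V y" if "0 \<le> x" "x \<le> y" "y \<le> 1" for x y
    using V(1)[OF that] by linarith
  have "\<exists>f. f \<in> borel_measurable borel \<and> set_integrable lborel {0..1} f \<and>
    (\<forall>a b. 0 \<le> a \<longrightarrow> a \<le> b \<longrightarrow> b \<le> 1 \<longrightarrow> V b - V a = (LINT t:{a..b}|lborel. f t))"
    by (rule cell_absolutely_continuous_density) (fact V_mono V(2) V(3))+
  then obtain f1 where f1: "f1 \<in> borel_measurable borel" "set_integrable lborel {0..1} f1"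
    "\<And>a b. 0 \<le> a \<Longrightarrow> a \<le> b \<Longrightarrow> b \<le> 1 \<Longrightarrow> V b - V a = (LINT t:{a..b}|lborel. f1 t)"
    by blast
  define G where "G x = V x + F x" for x
  have G_le: "G y - G x \<le> 2 * (V y - V x)" if "0 \<le> x" "x \<le> y" "y \<le> 1" for x y
    using V(1)[OF that] by (simp add: G_def)
  have G_mono: "G x \<le> G y" if "0 \<le> x" "x \<le> y" "y \<le> 1" for x y
    using V(1)[OF that] by (simp add: G_def)
  have G_modulus: "\<exists>d>0. \<forall>x y. 0 \<le> x \<longrightarrow> x \<le> y \<longrightarrow> y \<le> 1 \<longrightarrow> y - x < d \<longrightarrow> G y - G x \<le> e"
    if e_pos: "0 < e" for e
  proof -
    obtain d where d: "d > 0" "\<And>x y. 0 \<le> x \<Longrightarrow> x \<le> y \<Longrightarrow> y \<le> 1 \<Longrightarrow> y - x < d \<Longrightarrow> V y - V x \<le> e / 2"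
      using V(2)[OF half_gt_zero[OF e_pos]] by blast
    have "G y - G x \<le> e" if "0 \<le> x" "x \<le> y" "y \<le> 1" "y - x < d" for x y
      using order_trans[OF G_le[OF that(1-3)] mult_left_mono[OF d(2)[OF that], of 2]] by simp
    then show ?thesis using d(1) by blast
  qed
  have G_cells: "\<exists>d>0. \<forall>N A. A \<subseteq> {..<2 ^ N} \<longrightarrow> real (card A) / 2 ^ N < d \<longrightarrow>
         (\<Sum>k\<in>A. cell_incr G N k) \<le> e" if e_pos: "0 < e" for e
  proof -
    obtain d where d: "d > 0" "\<And>N A. A \<subseteq> {..<2 ^ N} \<Longrightarrow> real (card A) / 2 ^ N < d \<Longrightarrow>
         (\<Sum>k\<in>A. cell_incr V N k) \<le> e / 2"
      using V(3)[OF half_gt_zero[OF e_pos]] by blast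
    have "(\<Sum>k\<in>A. cell_incr G N k) \<le> e" if A: "A \<subseteq> {..<2 ^ N}" "real (card A) / 2 ^ N < d" for N A
    proof -
      have "(\<Sum>k\<in>A. cell_incr G N k) \<le> (\<Sum>k\<in>A. 2 * cell_incr V N k)"
        unfolding cell_incr_def using A(1) by (intro sum_mono G_le dyad_mono) (auto simp: Suc_le_eq)
      also have "\<dots> = 2 * (\<Sum>k\<in>A. cell_incr V N k)" by (rule sum_distrib_left[symmetric])
      also have "\<dots> \<le> e" using mult_left_mono[OF d(2)[OF A], of 2] by simp
      finally show ?thesis .
    qed
    then show ?thesis using d(1) by blast
  qed
  have "\<exists>f. f \<in> borel_measurable borel \<and> set_integrable lborel {0..1} f \<and>
    (\<forall>a b. 0 \<le> a \<longrightarrow> a \<le> b \<longrightarrow> b \<le> 1 \<longrightarrow> G b - G a = (LINT t:{a..b}|lborel. f t))"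
    by (rule cell_absolutely_continuous_density) (fact G_mono G_modulus G_cells)+
  then obtain f2 where f2: "f2 \<in> borel_measurable borel" "set_integrable lborel {0..1} f2"
    "\<And>a b. 0 \<le> a \<Longrightarrow> a \<le> b \<Longrightarrow> b \<le> 1 \<Longrightarrow> G b - G a = (LINT t:{a..b}|lborel. f2 t)"
    by blast
  define f where "f x = f2 x - f1 x" for x
  have fm: "f \<in> borel_measurable borel" unfolding f_def using f1 f2 by measurable
  have fi: "set_integrable lborel {0..1} f" unfolding f_def using f1(2) f2(2) by (intro set_integral_diff)
  have F: "F b - F a = (LINT t:{a..b}|lborel. f t)" if "0 \<le> a" "a \<le> b" "b \<le> 1" for a b
  proof -
    have "set_integrable lborel {a..b} f1" "set_integrable lborel {a..b} f2"
      using that by (auto intro: set_integrable_subset[OF f1(2)] set_integrable_subset[OF f2(2)])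
    then have "(LINT t:{a..b}|lborel. f t) = (G b - G a) - (V b - V a)"
      unfolding f_def f1(3)[OF that] f2(3)[OF that] by (intro set_integral_diff)
    then show ?thesis by (simp add: G_def)
  qed
  have "AE x in lebesgue. x \<in> {0<..<1} \<longrightarrow> (F has_real_derivative f x) (at x)"
    using lebesgue_differentiation[OF fi fm]
  proof (rule AE_mp, intro AE_I2 impI)
    fix x :: real
    assume x: "x \<in> {0<..<1}" and "x \<in> {0<..<1} \<longrightarrow> (\<forall>e>0. \<exists>d>0. \<forall>a b. a \<le> x \<longrightarrow> x \<le> b \<longrightarrow> a < b \<longrightarrow> b - a < d \<longrightarrow>
       \<bar>(LINT t:{a..b}|lborel. f t) - f x * (b - a)\<bar> \<le> e * (b - a))"
    then have L: "\<exists>d>0. \<forall>a b. a \<le> x \<longrightarrow> x \<le> b \<longrightarrow> a < b \<longrightarrow> b - a < d \<longrightarrow>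
       \<bar>(LINT t:{a..b}|lborel. f t) - f x * (b - a)\<bar> \<le> e * (b - a)" if "e > 0" for e
      using that by blast
    show "(F has_real_derivative f x) (at x)"
      unfolding has_field_derivative_def has_derivative_at_alt
    proof (intro conjI allI impI bounded_linear_mult_right)
      fix e :: real assume "0 < e"
      from L[OF this] obtain d where d: "d > 0" "\<And>a b. a \<le> x \<Longrightarrow> x \<le> b \<Longrightarrow> a < b \<Longrightarrow> b - a < d \<Longrightarrow>
        \<bar>(LINT t:{a..b}|lborel. f t) - f x * (b - a)\<bar> \<le> e * (b - a)" by blast
      show "\<exists>d>0. \<forall>y. norm (y - x) < d \<longrightarrow> norm (F y - F x - f x * (y - x)) \<le> e * norm (y - x)"
      \<comment> \<open>The inner minimum keeps \<open>y\<close> inside \<open>{0..1}\<close>, where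
        increments of \<open>F\<close> are integrals of \<open>f\<close>.\<close>
      proof (intro exI[of _ "min d (min x (1 - x))"] conjI allI impI)
        fix y assume y: "norm (y - x) < min d (min x (1 - x))"
        consider "y = x" | "x < y" | "y < x" by linarith
        then show "norm (F y - F x - f x * (y - x)) \<le> e * norm (y - x)"
        proof cases
          case 2
          then show ?thesis using d(2)[of x y] F[of x y] x y by auto
        next
          case 3
          then have "\<bar>(F x - F y) - f x * (x - y)\<bar> \<le> e * (x - y)"
            using d(2)[of y x] F[of y x] x y by auto
          moreover have "F y - F x - f x * (y - x) = - ((F x - F y) - f x * (x - y))"
            by (simp add: algebra_simps)
          ultimately have "norm (F y - F x - f x * (y - x)) \<le> e * (x - y)"
            by (simp only: real_norm_def abs_minus_cancel)
          moreover have "norm (y - x) = x - y" using 3 by simp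
          ultimately show ?thesis by (simp only:)
        qed simp
      qed (use d x in auto)
    qed
  qed
  then show thesis using that fm fi F by blast
qed

section \<open>Dyadic energies and the action\<close>

text \<open>This is half the integral of the squared slope of the polygon through the grid points:
  over a cell of length \<open>1 / 2 ^ N\<close> the slope is
  \<open>2 ^ N * cell_incr \<phi> N k\<close>.\<close>

definition energy :: "nat \<Rightarrow> (real \<Rightarrow> real) \<Rightarrow> real" where
  "energy N \<phi> = (\<Sum>k<2 ^ N. 2 ^ N * (cell_incr \<phi> N k)\<^sup>2) / 2"

lemma energy_nonneg [simp]: "0 \<le> energy N \<phi>"
  by (simp add: energy_def sum_nonneg)

text \<open>Convexity of the square: replacing two half-cell slopes by their mean cannot raise the
  energy.\<close>

lemma energy_Suc: "energy N \<phi> \<le> energy (Suc N) \<phi>"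
proof -
  have *: "(x + y)\<^sup>2 \<le> 2 * (x\<^sup>2 + y\<^sup>2)" for x y :: real
    using zero_le_power2[of "x - y"] by (simp add: power2_eq_square algebra_simps)
  have "(\<Sum>k<2 ^ N. 2 ^ N * (cell_incr \<phi> N k)\<^sup>2) \<le>
     (\<Sum>k<2 ^ N. 2 ^ Suc N * (cell_incr \<phi> (Suc N) (2 * k))\<^sup>2 + 2 ^ Suc N * (cell_incr \<phi> (Suc N) (Suc (2 * k)))\<^sup>2)"
  proof (intro sum_mono)
    fix k
    show "2 ^ N * (cell_incr \<phi> N k)\<^sup>2 \<le>
      2 ^ Suc N * (cell_incr \<phi> (Suc N) (2 * k))\<^sup>2 + 2 ^ Suc N * (cell_incr \<phi> (Suc N) (Suc (2 * k)))\<^sup>2"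
      using mult_left_mono[OF *[of "cell_incr \<phi> (Suc N) (2 * k)" "cell_incr \<phi> (Suc N) (Suc (2 * k))"], of "2 ^ N"]
      by (subst cell_incr_halves) (simp add: algebra_simps)
  qed
  also have "\<dots> = (\<Sum>k<2 ^ Suc N. 2 ^ Suc N * (cell_incr \<phi> (Suc N) k)\<^sup>2)"
    by (simp only: power_Suc[of 2 N] sum_halves)
  finally show ?thesis by (simp add: energy_def divide_right_mono)
qed

lemma energy_mono: "M \<le> N \<Longrightarrow> energy M \<phi> \<le> energy N \<phi>"
  using energy_Suc by (rule lift_Suc_mono_le)

text \<open>Cauchy--Schwarz on the dyadic cells covered by the family, with the end points rounded down to the
  grid; continuity lets the level tend to infinity.\<close>

lemma sum_increments_le_energy:
  fixes a b :: "nat \<Rightarrow> real"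
  assumes cont: "continuous_on {0..1} \<phi>" and r: "\<And>N. energy N \<phi> \<le> r"
    and ab: "\<And>i. i < n \<Longrightarrow> 0 \<le> a i \<and> a i \<le> b i \<and> b i \<le> 1"
    and disj: "disjoint_family_on (\<lambda>i. {a i<..<b i}) {..<n}"
  shows "(\<Sum>i<n. \<bar>\<phi> (b i) - \<phi> (a i)\<bar>)\<^sup>2 \<le> 2 * r * (\<Sum>i<n. b i - a i)"
proof -
  define p where "p N t = dyad N (cell_index N t)" for N t
  have p_lim: "(\<lambda>N. p N t) \<longlonglongrightarrow> t" if "0 \<le> t" for t
    unfolding p_def by (rule tendsto_dyad_cell_index[OF that])
  have \<phi>_lim: "(\<lambda>N. \<phi> (p N t)) \<longlonglongrightarrow> \<phi> t" if "0 \<le> t" "t \<le> 1" for t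
  proof (intro continuous_on_tendsto_compose[OF cont p_lim])
    have "p N t \<le> 1" for N using dyad_cell_index_le[of t N] that unfolding p_def by linarith
    then show "\<forall>\<^sub>F N in sequentially. p N t \<in> {0..1}"
      by (intro always_eventually allI) (simp add: p_def del: dyad_le_1)
  qed (use that in auto)
  have "(\<Sum>i<n. \<bar>\<phi> (p N (b i)) - \<phi> (p N (a i))\<bar>)\<^sup>2 \<le> 2 * r * (\<Sum>i<n. p N (b i) - p N (a i))" for N
  proof -
    define I where "I i = {cell_index N (a i)..<cell_index N (b i)}" for i
    have I_disj: "I i \<inter> I j = {}" if "i < n" "j < n" "i \<noteq> j" for i j
    proof (rule ccontr)
      assume ne: "I i \<inter> I j \<noteq> {}"
      \<comment> \<open>Degenerate intervals have empty index sets, so a common index forces both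
        intervals to be proper. Only then does disjointness of the open intervals determine their
        order.\<close>
      have lt: "a i < b i" "a j < b j"
        using ne cell_index_mono[of "b i" "a i" N] cell_index_mono[of "b j" "a j" N]
        by (force simp: I_def not_less[symmetric])+
      have "b i \<le> a j \<or> b j \<le> a i"
      proof (rule ccontr)
        assume "\<not> (b i \<le> a j \<or> b j \<le> a i)"
        then have "max (a i) (a j) < min (b i) (b j)" using lt by auto
        then obtain z where "max (a i) (a j) < z" "z < min (b i) (b j)" using dense by blast
        then have "z \<in> {a i<..<b i} \<inter> {a j<..<b j}" by auto
        then show False using disj that unfolding disjoint_family_on_def by blast
      qed
      then show False
        using ne cell_index_mono[of "b i" "a j" N] cell_index_mono[of "b j" "a i" N]
        by (auto simp: I_def)
    qed
    define K where "K = (\<Union>i<n. I i)"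
    have K: "K \<subseteq> {..<2 ^ N}"
      using ab cell_index_le[of "b _" N] by (force simp: K_def I_def)
    then have finK: "finite K" using finite_subset by blast
    have sumK: "(\<Sum>i<n. \<Sum>k\<in>I i. g k) = (\<Sum>k\<in>K. g k)" for g :: "nat \<Rightarrow> real"
      unfolding K_def using I_disj by (intro sum.UNION_disjoint[symmetric]) (auto simp: I_def)
    have "(\<Sum>i<n. \<bar>\<phi> (p N (b i)) - \<phi> (p N (a i))\<bar>) \<le> (\<Sum>i<n. \<Sum>k\<in>I i. \<bar>cell_incr \<phi> N k\<bar>)"
    proof (intro sum_mono)
      fix i assume "i \<in> {..<n}"
      then have "cell_index N (a i) \<le> cell_index N (b i)" using ab by (simp add: cell_index_mono)
      from sum_cell_incr[OF this, of \<phi> N]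
      show "\<bar>\<phi> (p N (b i)) - \<phi> (p N (a i))\<bar> \<le> (\<Sum>k\<in>I i. \<bar>cell_incr \<phi> N k\<bar>)"
        unfolding p_def I_def by (metis sum_abs)
    qed
    then have "(\<Sum>i<n. \<bar>\<phi> (p N (b i)) - \<phi> (p N (a i))\<bar>)\<^sup>2 \<le> (\<Sum>k\<in>K. \<bar>cell_incr \<phi> N k\<bar>)\<^sup>2"
      unfolding sumK by (intro power_mono) (auto simp: sum_nonneg)
    also have "\<dots> \<le> (\<Sum>k\<in>K. \<bar>cell_incr \<phi> N k\<bar>\<^sup>2) * real (card K)"
      by (rule sum_squared_le_sum_of_squares)
    also have "(\<Sum>k\<in>K. \<bar>cell_incr \<phi> N k\<bar>\<^sup>2) \<le> (\<Sum>k<2 ^ N. (cell_incr \<phi> N k)\<^sup>2)"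
      using K by (simp add: sum_mono2)
    also have "(\<Sum>k<2 ^ N. (cell_incr \<phi> N k)\<^sup>2) = 2 * energy N \<phi> / 2 ^ N"
      by (simp add: energy_def sum_distrib_left[symmetric])
    also have "2 * energy N \<phi> / 2 ^ N \<le> 2 * r / 2 ^ N" using r by (simp add: divide_right_mono)
    finally have "(\<Sum>i<n. \<bar>\<phi> (p N (b i)) - \<phi> (p N (a i))\<bar>)\<^sup>2 \<le> 2 * r * (real (card K) / 2 ^ N)"
      by (simp add: mult_right_mono)
    also have "real (card K) / 2 ^ N = (\<Sum>i<n. \<Sum>k\<in>I i. 1 / 2 ^ N)"
      unfolding sumK by simp
    also have "\<dots> = (\<Sum>i<n. p N (b i) - p N (a i))"
    proof (intro sum.cong refl)
      fix i assume "i \<in> {..<n}"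
      then have "cell_index N (a i) \<le> cell_index N (b i)" using ab by (simp add: cell_index_mono)
      then show "(\<Sum>k\<in>I i. 1 / 2 ^ N) = p N (b i) - p N (a i)"
        by (simp add: I_def p_def dyad_def diff_divide_distrib)
    qed
    finally show ?thesis .
  qed
  then show ?thesis
    by (intro LIMSEQ_le[of "\<lambda>N. (\<Sum>i<n. \<bar>\<phi> (p N (b i)) - \<phi> (p N (a i))\<bar>)\<^sup>2" _
           "\<lambda>N. 2 * r * (\<Sum>i<n. p N (b i) - p N (a i))"])
       (use ab in \<open>auto intro!: tendsto_intros \<phi>_lim p_lim intro: order_trans\<close>)
qed

lemma energy_bound_increment:
  assumes "continuous_on {0..1} \<phi>" "\<And>N. energy N \<phi> \<le> r" "0 \<le> s" "s \<le> t" "t \<le> 1"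
  shows "(\<phi> t - \<phi> s)\<^sup>2 \<le> 2 * r * (t - s)"
  using sum_increments_le_energy[OF assms(1,2), of 1 "\<lambda>_. s" "\<lambda>_. t"] assms(3-5)
  by (simp add: disjoint_family_on_def)

lemma energy_bound_absolutely_continuous:
  assumes cont: "continuous_on {0..1} \<phi>" and r: "\<And>N. energy N \<phi> \<le> r"
  shows "absolutely_continuous_on {0..1} \<phi>"
  unfolding absolutely_continuous_on_def
proof (intro allI impI)
  fix e :: real assume "0 < e"
  have "0 \<le> r" using r[of 0] energy_nonneg[of 0 \<phi>] by linarith
  show "\<exists>d>0. \<forall>(n::nat) a b. (\<forall>i<n. a i \<le> b i \<and> {a i..b i} \<subseteq> {0..1}) \<and>
        disjoint_family_on (\<lambda>i. {a i<..<b i}) {..<n} \<and> (\<Sum>i<n. b i - a i) < d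
        \<longrightarrow> (\<Sum>i<n. \<bar>\<phi> (b i) - \<phi> (a i)\<bar>) < e"
  \<comment> \<open>The \<open>+ 1\<close> keeps the denominator positive when
    \<open>r = 0\<close>.\<close>
  proof (intro exI[of _ "e\<^sup>2 / (2 * r + 1)"] conjI allI impI)
    show "0 < e\<^sup>2 / (2 * r + 1)" using \<open>0 < e\<close> \<open>0 \<le> r\<close> by simp
    fix n :: nat and a b :: "nat \<Rightarrow> real"
    assume *: "(\<forall>i<n. a i \<le> b i \<and> {a i..b i} \<subseteq> {0..1}) \<and>
        disjoint_family_on (\<lambda>i. {a i<..<b i}) {..<n} \<and> (\<Sum>i<n. b i - a i) < e\<^sup>2 / (2 * r + 1)"
    let ?s = "\<Sum>i<n. b i - a i"
    have s: "0 \<le> ?s" "?s < e\<^sup>2 / (2 * r + 1)" using * by (auto intro: sum_nonneg)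
    have "(\<Sum>i<n. \<bar>\<phi> (b i) - \<phi> (a i)\<bar>)\<^sup>2 \<le> 2 * r * ?s"
      using * by (intro sum_increments_le_energy[OF cont r]) auto
    also have "\<dots> \<le> (2 * r + 1) * ?s" using s(1) by (simp add: mult_right_mono)
    also have "\<dots> < e\<^sup>2" using s(2) \<open>0 \<le> r\<close> by (simp add: pos_less_divide_eq mult.commute)
    finally show "(\<Sum>i<n. \<bar>\<phi> (b i) - \<phi> (a i)\<bar>) < e"
      using \<open>0 < e\<close> by (simp add: power_less_imp_less_base)
  qed
qed

text \<open>Replacing \<open>deriv \<phi>\<close> by a Borel function that agrees with it almost
  everywhere on the unit interval moves the integral from \<open>lebesgue\<close> to
  \<open>lborel\<close>.\<close>

lemma action_eq_nn_integral:
  assumes "\<phi> \<in> AC01"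
  obtains f where "f \<in> borel_measurable borel" "set_integrable lborel {0..1} f"
    "\<And>a b. 0 \<le> a \<Longrightarrow> a \<le> b \<Longrightarrow> b \<le> 1 \<Longrightarrow> \<phi> b - \<phi> a = (LINT t:{a..b}|lborel. f t)"
    "AE x in lborel. x \<in> {0<..<1} \<longrightarrow> (\<phi> has_real_derivative f x) (at x)"
    "action \<phi> = ennreal (1/2) * (\<integral>\<^sup>+t. ennreal ((f t)\<^sup>2) * indicator {0..1} t \<partial>lborel)"
proof (rule absolutely_continuous_on_fundamental)
  show "absolutely_continuous_on {0..1} \<phi>" using assms by (simp add: AC01_def)
  fix f assume f: "f \<in> borel_measurable borel" "set_integrable lborel {0..1} f"
    "\<And>a b. 0 \<le> a \<Longrightarrow> a \<le> b \<Longrightarrow> b \<le> 1 \<Longrightarrow> \<phi> b - \<phi> a = (LINT t:{a..b}|lborel. f t)"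
    "AE x in lebesgue. x \<in> {0<..<1} \<longrightarrow> (\<phi> has_real_derivative f x) (at x)"
  have 01: "AE x in lebesgue. x \<noteq> 0 \<and> x \<noteq> (1::real)"
    unfolding AE_completion_iff
    using AE_lborel_singleton[of 0] AE_lborel_singleton[of "1::real"] by eventually_elim simp
  have "(\<integral>\<^sup>+t\<in>{0..1}. ennreal (\<bar>deriv \<phi> t\<bar>\<^sup>2) \<partial>lebesgue) =
        (\<integral>\<^sup>+t. ennreal ((f t)\<^sup>2) * indicator {0..1} t \<partial>lebesgue)"
  proof (rule nn_integral_cong_AE)
    show "AE t in lebesgue. ennreal (\<bar>deriv \<phi> t\<bar>\<^sup>2) * indicator {0..1} t = ennreal ((f t)\<^sup>2) * indicator {0..1} t"
      using 01 f(4) by eventually_elim (auto split: split_indicator dest!: DERIV_imp_deriv)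
  qed
  then have act: "action \<phi> = ennreal (1/2) * (\<integral>\<^sup>+t. ennreal ((f t)\<^sup>2) * indicator {0..1} t \<partial>lborel)"
    using assms by (simp add: action_def nn_integral_completion)
  show thesis
    by (rule that[OF f(1,2) _ _ act]) (use f(3,4) in \<open>auto simp: AE_completion_iff\<close>)
qed

text \<open>Cauchy--Schwarz against an indicator, in \<open>ennreal\<close> so that the square of
  \<open>f\<close> may have infinite integral. Dropping the end point \<open>a\<close> on the right
  makes the sets of adjacent cells disjoint when the estimates are added.\<close>

lemma square_increment_le_nn_integral:
  fixes f :: "real \<Rightarrow> real"
  assumes fm [measurable]: "f \<in> borel_measurable borel" and fi: "set_integrable lborel {a..b} f" and "a \<le> b"
  shows "ennreal ((LINT t:{a..b}|lborel. f t)\<^sup>2) \<le>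
    ennreal (b - a) * (\<integral>\<^sup>+t. ennreal ((f t)\<^sup>2) * indicator {a<..b} t \<partial>lborel)"
proof -
  have "ennreal \<bar>LINT t:{a..b}|lborel. f t\<bar> \<le> (\<integral>\<^sup>+t. ennreal \<bar>indicator {a..b} t *\<^sub>R f t\<bar> \<partial>lborel)"
    using integral_norm_bound_ennreal[OF fi[unfolded set_integrable_def]]
    by (simp add: set_lebesgue_integral_def)
  also have "\<dots> = (\<integral>\<^sup>+t. indicator {a..b} t * (ennreal \<bar>f t\<bar> * indicator {a<..b} t) \<partial>lborel)"
    using AE_lborel_singleton[of a] by (intro nn_integral_cong_AE) (auto split: split_indicator)
  finally have "(ennreal \<bar>LINT t:{a..b}|lborel. f t\<bar>)\<^sup>2 \<le>
      (\<integral>\<^sup>+t. indicator {a..b} t * (ennreal \<bar>f t\<bar> * indicator {a<..b} t) \<partial>lborel)\<^sup>2"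
    by (rule power_mono) simp
  also have "\<dots> \<le> (\<integral>\<^sup>+t. (indicator {a..b} t)\<^sup>2 \<partial>lborel) * (\<integral>\<^sup>+t. (ennreal \<bar>f t\<bar> * indicator {a<..b} t)\<^sup>2 \<partial>lborel)"
    by (rule Cauchy_Schwarz_nn_integral) auto
  also have "(\<integral>\<^sup>+t. (indicator {a..b} t)\<^sup>2 \<partial>lborel) = (\<integral>\<^sup>+t. indicator {a..b} t \<partial>lborel)"
    by (intro nn_integral_cong) (auto split: split_indicator)
  also have "\<dots> = ennreal (b - a)" using \<open>a \<le> b\<close> by simp
  also have "(\<integral>\<^sup>+t. (ennreal \<bar>f t\<bar> * indicator {a<..b} t)\<^sup>2 \<partial>lborel) =
      (\<integral>\<^sup>+t. ennreal ((f t)\<^sup>2) * indicator {a<..b} t \<partial>lborel)"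
    by (intro nn_integral_cong) (auto split: split_indicator simp: ennreal_power)
  finally show ?thesis by (simp add: ennreal_power)
qed

lemma energy_le_action:
  assumes "\<phi> \<in> AC01" shows "ennreal (energy N \<phi>) \<le> action \<phi>"
proof (rule action_eq_nn_integral[OF assms])
  fix f assume fm [measurable]: "f \<in> borel_measurable borel" and f: "set_integrable lborel {0..1} f"
    "\<And>a b. 0 \<le> a \<Longrightarrow> a \<le> b \<Longrightarrow> b \<le> 1 \<Longrightarrow> \<phi> b - \<phi> a = (LINT t:{a..b}|lborel. f t)"
    and act: "action \<phi> = ennreal (1/2) * (\<integral>\<^sup>+t. ennreal ((f t)\<^sup>2) * indicator {0..1} t \<partial>lborel)"
  define \<mu> where "\<mu> = density lborel (\<lambda>t. ennreal ((f t)\<^sup>2))"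
  have mu: "emeasure \<mu> B = (\<integral>\<^sup>+t. ennreal ((f t)\<^sup>2) * indicator B t \<partial>lborel)" if "B \<in> sets borel" for B
    using that by (simp add: \<mu>_def emeasure_density)
  have "ennreal (\<Sum>k<2 ^ N. 2 ^ N * (cell_incr \<phi> N k)\<^sup>2) = (\<Sum>k<2 ^ N. ennreal (2 ^ N * (cell_incr \<phi> N k)\<^sup>2))"
    by (rule sum_ennreal[symmetric]) simp
  also have "\<dots> \<le> (\<Sum>k<2 ^ N. emeasure \<mu> {dyad N k<..dyad N (Suc k)})"
  proof (intro sum_mono)
    fix k :: nat assume "k \<in> {..<2 ^ N}"
    then have k: "0 \<le> dyad N k" "dyad N k \<le> dyad N (Suc k)" "dyad N (Suc k) \<le> 1"
      by (auto simp: dyad_mono)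
    have "ennreal ((cell_incr \<phi> N k)\<^sup>2) \<le> ennreal (1 / 2 ^ N) * emeasure \<mu> {dyad N k<..dyad N (Suc k)}"
      using square_increment_le_nn_integral[OF fm set_integrable_subset[OF f(1)] k(2)] k
      unfolding cell_incr_def f(2)[OF k] by (auto simp: mu dyad_Suc)
    then have "ennreal (2 ^ N) * ennreal ((cell_incr \<phi> N k)\<^sup>2) \<le>
        ennreal (2 ^ N) * (ennreal (1 / 2 ^ N) * emeasure \<mu> {dyad N k<..dyad N (Suc k)})"
      by (rule mult_left_mono) simp
    then show "ennreal (2 ^ N * (cell_incr \<phi> N k)\<^sup>2) \<le> emeasure \<mu> {dyad N k<..dyad N (Suc k)}"
      by (simp add: ennreal_mult[symmetric] mult.assoc[symmetric])
  qed
  also have "\<dots> = emeasure \<mu> (\<Union>k<2 ^ N. {dyad N k<..dyad N (Suc k)})"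
    by (rule sum_emeasure) (auto simp: disjoint_family_dyad_Ioc \<mu>_def)
  also have "\<dots> \<le> emeasure \<mu> {0..1}"
  proof (rule emeasure_mono)
    show "(\<Union>k<2 ^ N. {dyad N k<..dyad N (Suc k)}) \<subseteq> {0..1}"
    proof (intro UN_least)
      fix k :: nat assume "k \<in> {..<2 ^ N}"
      then have "dyad N (Suc k) \<le> 1" by auto
      then show "{dyad N k<..dyad N (Suc k)} \<subseteq> {0..1}"
        using dyad_nonneg[of N k] by (auto simp del: dyad_le_1 dyad_nonneg)
    qed
  qed (simp add: \<mu>_def)
  finally have "ennreal (1/2) * ennreal (\<Sum>k<2 ^ N. 2 ^ N * (cell_incr \<phi> N k)\<^sup>2) \<le> action \<phi>"
    unfolding act by (intro mult_left_mono) (auto simp: mu)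
  also have "ennreal (1/2) * ennreal (\<Sum>k<2 ^ N. 2 ^ N * (cell_incr \<phi> N k)\<^sup>2) = ennreal (energy N \<phi>)"
    by (subst ennreal_mult[symmetric]) (auto simp: energy_def sum_nonneg)
  finally show ?thesis .
qed

lemma mem_dyad_Ico: "0 \<le> t \<Longrightarrow> t \<in> {dyad N k..<dyad N (Suc k)} \<longleftrightarrow> cell_index N t = k"
proof
  assume "0 \<le> t" "t \<in> {dyad N k..<dyad N (Suc k)}"
  then have "\<lfloor>2 ^ N * t\<rfloor> = int k"
    by (auto simp: dyad_def floor_eq_iff field_simps)
  then show "cell_index N t = k" by (simp add: cell_index_def)
next
  assume "0 \<le> t" "cell_index N t = k"
  then show "t \<in> {dyad N k..<dyad N (Suc k)}"
    using dyad_cell_index_le less_dyad_Suc_cell_index by auto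
qed

text \<open>The cell contains \<open>t\<close> but need not start there. Its increment is split at
  \<open>t\<close>, and the two linearisation errors, each \<open>e / 2\<close> times the length of
  its side, add up to \<open>e / 2\<close> times the length of the cell.\<close>

lemma tendsto_cell_quotient:
  assumes D: "(\<phi> has_real_derivative D) (at t)" and "0 \<le> t"
  shows "(\<lambda>N. 2 ^ N * cell_incr \<phi> N (cell_index N t)) \<longlonglongrightarrow> D"
  unfolding LIMSEQ_iff
proof (intro allI impI)
  fix e :: real assume "0 < e"
  then have "0 < e / 2" by simp
  then obtain d where d: "0 < d" "\<And>y. \<bar>y - t\<bar> < d \<Longrightarrow> \<bar>\<phi> y - \<phi> t - D * (y - t)\<bar> \<le> e / 2 * \<bar>y - t\<bar>"
    using D unfolding has_field_derivative_def has_derivative_at_alt real_norm_def by blast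
  obtain N0 where N0: "(1/2) ^ N0 < d" using d(1) real_arch_pow_inv[of d "1/2"] by auto
  show "\<exists>no. \<forall>n\<ge>no. norm (2 ^ n * cell_incr \<phi> n (cell_index n t) - D) < e"
  proof (intro exI[of _ N0] allI impI)
    fix n assume "N0 \<le> n"
    then have "(1/2) ^ n \<le> (1/2 :: real) ^ N0" by (intro power_decreasing) auto
    then have nd: "1 / 2 ^ n < d" using N0 by (simp add: power_divide)
    let ?a = "dyad n (cell_index n t)" and ?b = "dyad n (Suc (cell_index n t))"
    have ab: "?a \<le> t" "t < ?b" "?b = ?a + 1 / 2 ^ n"
      using dyad_cell_index_le[OF \<open>0 \<le> t\<close>] less_dyad_Suc_cell_index[OF \<open>0 \<le> t\<close>] by (auto simp: dyad_Suc)
    have "\<bar>\<phi> ?a - \<phi> t - D * (?a - t)\<bar> \<le> e / 2 * (t - ?a)"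
      using d(2)[of ?a] ab nd by auto
    moreover have "\<bar>\<phi> ?b - \<phi> t - D * (?b - t)\<bar> \<le> e / 2 * (?b - t)"
      using d(2)[of ?b] ab nd by auto
    moreover have "cell_incr \<phi> n (cell_index n t) - D * (1 / 2 ^ n) =
        (\<phi> ?b - \<phi> t - D * (?b - t)) - (\<phi> ?a - \<phi> t - D * (?a - t))"
      unfolding cell_incr_def using ab(3) by (simp add: algebra_simps)
    moreover have "e / 2 * (t - ?a) + e / 2 * (?b - t) = e / 2 * (1 / 2 ^ n)"
      using ab(3) by (simp add: algebra_simps)
    ultimately have "\<bar>cell_incr \<phi> n (cell_index n t) - D * (1 / 2 ^ n)\<bar> \<le> e / 2 * (1 / 2 ^ n)"
      by linarith
    then have "2 ^ n * \<bar>cell_incr \<phi> n (cell_index n t) - D * (1 / 2 ^ n)\<bar> \<le> 2 ^ n * (e / 2 * (1 / 2 ^ n))"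
      by (rule mult_left_mono) simp
    also have "2 ^ n * \<bar>cell_incr \<phi> n (cell_index n t) - D * (1 / 2 ^ n)\<bar> =
        \<bar>2 ^ n * (cell_incr \<phi> n (cell_index n t) - D * (1 / 2 ^ n))\<bar>" by (simp add: abs_mult)
    also have "2 ^ n * (cell_incr \<phi> n (cell_index n t) - D * (1 / 2 ^ n)) =
        2 ^ n * cell_incr \<phi> n (cell_index n t) - D" by (simp add: right_diff_distrib)
    finally show "norm (2 ^ n * cell_incr \<phi> n (cell_index n t) - D) < e" using \<open>0 < e\<close> by simp
  qed
qed

lemma action_le_energy:
  assumes "\<phi> \<in> AC01" shows "action \<phi> \<le> (SUP N. ennreal (energy N \<phi>))"
proof (rule action_eq_nn_integral[OF assms])
  fix f assume fm [measurable]: "f \<in> borel_measurable borel"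
    and D: "AE x in lborel. x \<in> {0<..<1} \<longrightarrow> (\<phi> has_real_derivative f x) (at x)"
    and act: "action \<phi> = ennreal (1/2) * (\<integral>\<^sup>+t. ennreal ((f t)\<^sup>2) * indicator {0..1} t \<partial>lborel)"
  \<comment> \<open>\<open>h N\<close> is the squared slope of the level-\<open>N\<close> polygon,
    with integral \<open>2 * energy N \<phi>\<close>; it converges to the squared derivative, as
    Fatou's lemma needs.\<close>
  define h where "h N t = (\<Sum>k<2 ^ N. ennreal ((2 ^ N * cell_incr \<phi> N k)\<^sup>2) * indicator {dyad N k..<dyad N (Suc k)} t)" for N t
  have [measurable]: "h N \<in> borel_measurable lborel" for N unfolding h_def by measurable
  have h_eq: "h N t = ennreal ((2 ^ N * cell_incr \<phi> N (cell_index N t))\<^sup>2)" if "0 < t" "t < 1" for N t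
  proof -
    have "h N t = (\<Sum>k<2 ^ N. if cell_index N t = k then ennreal ((2 ^ N * cell_incr \<phi> N k)\<^sup>2) else 0)"
      unfolding h_def using that mem_dyad_Ico[of t N] by (intro sum.cong) (auto simp: indicator_def)
    then show ?thesis using cell_index_less[of t N] that by simp
  qed
  have h_int: "(\<integral>\<^sup>+t. h N t \<partial>lborel) = ennreal (2 * energy N \<phi>)" for N
  proof -
    have "(\<integral>\<^sup>+t. h N t \<partial>lborel) = (\<Sum>k<2 ^ N. ennreal ((2 ^ N * cell_incr \<phi> N k)\<^sup>2) * emeasure lborel {dyad N k..<dyad N (Suc k)})"
      unfolding h_def by (subst nn_integral_sum) (auto simp: nn_integral_cmult_indicator)
    also have "\<dots> = (\<Sum>k<2 ^ N. ennreal (2 ^ N * (cell_incr \<phi> N k)\<^sup>2))"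
    proof (intro sum.cong refl)
      fix k
      have "emeasure lborel {dyad N k..<dyad N (Suc k)} = ennreal (1 / 2 ^ N)" by (simp add: dyad_Suc)
      moreover have "(2 ^ N * cell_incr \<phi> N k)\<^sup>2 * (1 / 2 ^ N) = 2 ^ N * (cell_incr \<phi> N k)\<^sup>2"
        by (simp add: power2_eq_square)
      ultimately show "ennreal ((2 ^ N * cell_incr \<phi> N k)\<^sup>2) * emeasure lborel {dyad N k..<dyad N (Suc k)} =
          ennreal (2 ^ N * (cell_incr \<phi> N k)\<^sup>2)"
        by (metis ennreal_mult' zero_le_power2)
    qed
    also have "\<dots> = ennreal (2 * energy N \<phi>)"
      by (subst sum_ennreal) (auto simp: energy_def)
    finally show ?thesis .
  qed
  have "(\<integral>\<^sup>+t. ennreal ((f t)\<^sup>2) * indicator {0..1} t \<partial>lborel) \<le> (\<integral>\<^sup>+t. liminf (\<lambda>N. h N t) \<partial>lborel)"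
  proof (rule nn_integral_mono_AE)
    show "AE t in lborel. ennreal ((f t)\<^sup>2) * indicator {0..1} t \<le> liminf (\<lambda>N. h N t)"
      using D AE_lborel_singleton[of 0] AE_lborel_singleton[of "1::real"]
    proof eventually_elim
      case (elim t)
      show ?case
      proof (cases "0 < t \<and> t < 1")
        case True
        then have "(\<lambda>N. 2 ^ N * cell_incr \<phi> N (cell_index N t)) \<longlonglongrightarrow> f t"
          using elim by (intro tendsto_cell_quotient) auto
        then have "(\<lambda>N. h N t) \<longlonglongrightarrow> ennreal ((f t)\<^sup>2)"
          using True unfolding h_eq[of t, OF conjunct1[OF True] conjunct2[OF True]]
          by (intro tendsto_ennrealI tendsto_power)
        then have "liminf (\<lambda>N. h N t) = ennreal ((f t)\<^sup>2)"
          by (intro lim_imp_Liminf) auto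
        then show ?thesis by (auto split: split_indicator)
      qed (use elim in \<open>auto split: split_indicator\<close>)
    qed
  qed
  also have "\<dots> \<le> liminf (\<lambda>N. \<integral>\<^sup>+t. h N t \<partial>lborel)"
    by (rule nn_integral_liminf) simp
  also have "\<dots> \<le> (SUP N. ennreal (2 * energy N \<phi>))"
    unfolding h_int liminf_SUP_INF
    by (intro SUP_least) (meson INF_lower2 SUP_upper UNIV_I atLeast_iff order_refl order_trans)
  finally have "action \<phi> \<le> ennreal (1/2) * (SUP N. ennreal (2 * energy N \<phi>))"
    unfolding act by (intro mult_left_mono) auto
  also have "\<dots> = (SUP N. ennreal (1/2) * ennreal (2 * energy N \<phi>))"
    by (rule SUP_mult_left_ennreal)
  also have "(\<lambda>N. ennreal (1/2) * ennreal (2 * energy N \<phi>)) = (\<lambda>N. ennreal (energy N \<phi>))"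
    by (rule ext, subst ennreal_mult[symmetric]) auto
  finally show ?thesis .
qed

theorem action_eq_SUP_energy:
  assumes cont: "continuous_on {0..1} \<phi>" and "\<phi> 0 = 0"
  shows "action \<phi> = (SUP N. ennreal (energy N \<phi>))"
proof (cases "\<phi> \<in> AC01")
  case True
  then show ?thesis
    by (intro antisym action_le_energy SUP_least energy_le_action)
next
  case False
  \<comment> \<open>Bounded energies would make \<open>\<phi>\<close> absolutely continuous.\<close>
  have "(SUP N. ennreal (energy N \<phi>)) = \<infinity>"
  proof (rule ccontr)
    assume "(SUP N. ennreal (energy N \<phi>)) \<noteq> \<infinity>"
    then obtain r where r: "0 \<le> r" "(SUP N. ennreal (energy N \<phi>)) = ennreal r"
      by (cases "SUP N. ennreal (energy N \<phi>)") auto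
    have "energy N \<phi> \<le> r" for N
      using SUP_upper[of N UNIV "\<lambda>N. ennreal (energy N \<phi>)"] r by simp
    then have "absolutely_continuous_on {0..1} \<phi>"
      using energy_bound_absolutely_continuous[OF cont] by blast
    then show False using False \<open>\<phi> 0 = 0\<close> by (simp add: AC01_def)
  qed
  moreover have "action \<phi> = \<infinity>" using False by (simp add: action_def)
  ultimately show ?thesis by (simp only:)
qed

section \<open>The path space\<close>

lemma mspace_C01: "f \<in> mspace C01 \<longleftrightarrow> continuous_on {0..1} f \<and> f \<in> extensional {0..1} \<and> f 0 = 0"
proof -
  have "compactin (top_of_set {0..1::real}) (topspace (top_of_set {0..1}))"
    by (simp add: compactin_subtopology)
  from compactin_mspace_cfunspace[OF this, of "euclidean_metric :: real metric"]
  show ?thesis unfolding C01_def mspace_submetric by auto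
qed

lemma mdist_C01_le:
  assumes "f \<in> mspace C01" "g \<in> mspace C01"
  shows "mdist C01 f g \<le> a \<longleftrightarrow> (\<forall>x\<in>{0..1}. \<bar>f x - g x\<bar> \<le> a)"
proof -
  have "f \<in> mspace (cfunspace (top_of_set {0..1}) euclidean_metric)"
    "g \<in> mspace (cfunspace (top_of_set {0..1}) euclidean_metric)"
    using assms unfolding C01_def mspace_submetric by blast+
  from cfunspace_mdist_le[OF this, of a] show ?thesis
    by (simp add: C01_def dist_real_def)
qed

interpretation C01: Metric_space "mspace C01" "mdist C01"
  by (rule Metric_space_mspace_mdist)

lemma mtopology_of_C01: "mtopology_of C01 = C01.mtopology"
  by (simp add: mtopology_of_def)

lemma action_C01: "\<phi> \<in> mspace C01 \<Longrightarrow> action \<phi> = (SUP N. ennreal (energy N \<phi>))"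
  by (intro action_eq_SUP_energy) (auto simp: mspace_C01)

lemma action_C01_le_iff:
  assumes "\<phi> \<in> mspace C01" "0 \<le> r"
  shows "action \<phi> \<le> ennreal r \<longleftrightarrow> (\<forall>N. energy N \<phi> \<le> r)"
  using assms by (simp add: action_C01 SUP_le_iff)

theorem action_functional_C01: "action_functional C01 action"
  unfolding action_functional_def mtopology_of_C01
proof (intro allI impI)
  fix r :: real assume "0 \<le> r"
  let ?K = "{\<phi> \<in> mspace C01. action \<phi> \<le> ennreal r}"
  show "compactin C01.mtopology ?K"
    unfolding C01.compactin_sequentially
  proof (intro conjI allI impI)
    fix \<sigma> :: "nat \<Rightarrow> real \<Rightarrow> real" assume "range \<sigma> \<subseteq> ?K"
    then have \<sigma>: "\<sigma> n \<in> mspace C01" and en: "energy N (\<sigma> n) \<le> r" for n N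
      using action_C01_le_iff[OF _ \<open>0 \<le> r\<close>] by auto
    have incr: "\<bar>\<sigma> n t - \<sigma> n s\<bar> \<le> sqrt (2 * r * \<bar>t - s\<bar>)" if "s \<in> {0..1}" "t \<in> {0..1}" for n s t
    proof -
      have "(\<sigma> n t - \<sigma> n s)\<^sup>2 \<le> 2 * r * \<bar>t - s\<bar>"
        using energy_bound_increment[of "\<sigma> n" r s t] energy_bound_increment[of "\<sigma> n" r t s]
          en \<sigma>[of n] that by (cases "s \<le> t") (auto simp: mspace_C01 power2_commute)
      then show ?thesis using real_le_rsqrt[of "\<bar>\<sigma> n t - \<sigma> n s\<bar>"] by simp
    qed
    obtain g k where g: "continuous_on {0..1} g" "strict_mono (k :: nat \<Rightarrow> nat)"
      "\<And>e. 0 < e \<Longrightarrow> \<exists>N. \<forall>n x. n \<ge> N \<and> x \<in> {0..1} \<longrightarrow> norm (\<sigma> (k n) x - g x) < e"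
    proof (rule Arzela_Ascoli[of "{0..1}" \<sigma> "sqrt (2 * r)"])
      fix n and x :: real assume x: "x \<in> {0..1}"
      have "\<bar>\<sigma> n x\<bar> \<le> sqrt (2 * r * \<bar>x\<bar>)"
        using incr[of 0 x n] x \<sigma>[of n] by (simp add: mspace_C01)
      also have "\<dots> \<le> sqrt (2 * r)" using x \<open>0 \<le> r\<close> by (simp add: mult_left_le)
      finally show "norm (\<sigma> n x) \<le> sqrt (2 * r)" by simp
    next
      fix x e :: real assume x: "x \<in> {0..1}" "0 < e"
      define d where "d = e\<^sup>2 / (2 * r + 1)"
      have "norm (\<sigma> n x - \<sigma> n y) < e" if "y \<in> {0..1}" "norm (x - y) < d" for n y
      proof -
        have "2 * r * \<bar>x - y\<bar> \<le> (2 * r + 1) * \<bar>x - y\<bar>" by (simp add: mult_right_mono)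
        also have "\<dots> < e\<^sup>2" using that \<open>0 \<le> r\<close> by (simp add: d_def pos_less_divide_eq mult.commute)
        finally have "sqrt (2 * r * \<bar>x - y\<bar>) < e" using x(2) by (simp add: real_less_lsqrt)
        then show ?thesis using incr[of y x n] that(1) x by simp
      qed
      moreover have "0 < d" using x(2) \<open>0 \<le> r\<close> by (simp add: d_def)
      ultimately show "\<exists>d>0. \<forall>n y. y \<in> {0..1} \<and> norm (x - y) < d \<longrightarrow> norm (\<sigma> n x - \<sigma> n y) < e"
        by blast
    qed auto
    \<comment> \<open>Elements of the space are \<open>undefined\<close> off \<open>{0..1}\<close>,
      so the limit has to be restricted.\<close>
    define l where "l = restrict g {0..1}"
    have lim: "(\<lambda>n. \<sigma> (k n) x) \<longlonglongrightarrow> l x" if "x \<in> {0..1}" for x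
      unfolding LIMSEQ_iff using g(3) that by (simp add: l_def) blast
    have "continuous_on {0..1} l" using g(1) by (rule continuous_on_eq) (simp add: l_def)
    moreover have "l 0 = 0"
      using lim[of 0] \<sigma> by (simp add: mspace_C01 LIMSEQ_const_iff)
    ultimately have l: "l \<in> mspace C01" by (simp add: mspace_C01 l_def)
    \<comment> \<open>Each energy involves finitely many values of the path, so the bound passes to
      the pointwise limit.\<close>
    have "energy N l \<le> r" for N
    proof (rule LIMSEQ_le_const2)
      show "(\<lambda>n. energy N (\<sigma> (k n))) \<longlonglongrightarrow> energy N l"
        unfolding energy_def cell_incr_def by (intro tendsto_intros lim) auto
    qed (use en in blast)
    then have "l \<in> ?K" using l action_C01_le_iff[OF l \<open>0 \<le> r\<close>] by simp
    moreover have "limitin C01.mtopology (\<sigma> \<circ> k) l sequentially"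
      unfolding C01.limit_metric_sequentially
    proof (intro conjI allI impI l)
      fix e :: real assume "0 < e"
      then obtain N where N: "\<And>n x. n \<ge> N \<Longrightarrow> x \<in> {0..1} \<Longrightarrow> norm (\<sigma> (k n) x - g x) < e / 2"
        using g(3)[of "e / 2"] by auto
      show "\<exists>N. \<forall>n\<ge>N. (\<sigma> \<circ> k) n \<in> mspace C01 \<and> mdist C01 ((\<sigma> \<circ> k) n) l < e"
      proof (intro exI[of _ N] allI impI conjI)
        fix n assume "N \<le> n"
        then have "mdist C01 (\<sigma> (k n)) l \<le> e / 2"
          unfolding mdist_C01_le[OF \<sigma> l] using N[of n] by (auto simp: l_def intro: less_imp_le)
        then show "mdist C01 ((\<sigma> \<circ> k) n) l < e" using \<open>0 < e\<close> by simp
      qed (simp add: \<sigma>)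
    qed
    ultimately show "\<exists>l k. l \<in> ?K \<and> strict_mono k \<and> limitin C01.mtopology (\<sigma> \<circ> k) l sequentially"
      using g(2) by blast
  qed auto
qed

text \<open>Parametrised by increments, since these are the independent Gaussian data of the
  Brownian path. The clamped factor is a ramp climbing from \<open>0\<close> to \<open>1\<close>
  across cell \<open>k\<close>.\<close>

definition polygon :: "nat \<Rightarrow> (nat \<Rightarrow> real) \<Rightarrow> real \<Rightarrow> real" where
  "polygon N d = (\<lambda>t\<in>{0..1}. \<Sum>k<2 ^ N. d k * max 0 (min 1 (2 ^ N * t - real k)))"

lemma polygon_C01: "polygon N d \<in> mspace C01"
  unfolding mspace_C01
proof (intro conjI)
  have "continuous_on {0..1} (\<lambda>t. \<Sum>k<2 ^ N. d k * max 0 (min 1 (2 ^ N * t - real k)))"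
    by (intro continuous_intros)
  then show "continuous_on {0..1} (polygon N d)"
    by (rule continuous_on_eq) (simp add: polygon_def)
qed (auto simp: polygon_def)

lemma polygon_on_cell:
  assumes j: "j < 2 ^ N" and t: "dyad N j \<le> t" "t \<le> dyad N (Suc j)"
  shows "polygon N d t = (\<Sum>k<j. d k) + d j * (2 ^ N * t - real j)"
proof -
  have "dyad N (Suc j) \<le> 1" using j by simp
  then have t01: "t \<in> {0..1}" using t dyad_nonneg[of N j] by (auto simp del: dyad_le_1 dyad_nonneg)
  have tj: "real j \<le> 2 ^ N * t" "2 ^ N * t \<le> real (Suc j)"
    using t by (auto simp: dyad_def field_simps)
  have "polygon N d t = (\<Sum>k<2 ^ N. d k * (if k < j then 1 else if k = j then 2 ^ N * t - real j else 0))"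
    unfolding polygon_def using t01 tj
    by (auto intro!: sum.cong arg_cong2[where f = "(*)"] simp: max_def min_def)
  also have "\<dots> = (\<Sum>k\<in>{..<j} \<union> {j}. d k * (if k < j then 1 else if k = j then 2 ^ N * t - real j else 0))"
    using j by (intro sum.mono_neutral_right) auto
  also have "\<dots> = (\<Sum>k<j. d k) + d j * (2 ^ N * t - real j)"
    by (subst sum.union_disjoint) auto
  finally show ?thesis .
qed

text \<open>Path and polygon agree on the grid; inside a cell the path departs from its left grid
  value by at most \<open>\<alpha>\<close>, the polygon by at most \<open>\<beta>\<close>.\<close>

lemma polygon_approx:
  assumes f: "f \<in> mspace C01"
    and \<alpha>: "\<And>t. 0 \<le> t \<Longrightarrow> t < 1 \<Longrightarrow> \<bar>f t - f (dyad N (cell_index N t))\<bar> \<le> \<alpha>"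
    and \<beta>: "\<And>k. k < 2 ^ N \<Longrightarrow> \<bar>cell_incr f N k\<bar> \<le> \<beta>"
  shows "mdist C01 f (polygon N (cell_incr f N)) \<le> \<alpha> + \<beta>"
  unfolding mdist_C01_le[OF f polygon_C01]
proof
  fix t :: real assume t: "t \<in> {0..1}"
  have f0: "f 0 = 0" using f by (simp add: mspace_C01)
  have sum: "(\<Sum>k<j. cell_incr f N k) = f (dyad N j)" for j
    using sum_cell_incr[of 0 j f N] f0 by (simp add: lessThan_atLeast0)
  have ab: "0 \<le> \<alpha>" "0 \<le> \<beta>" using \<alpha>[of 0] \<beta>[of 0] by auto
  show "\<bar>f t - polygon N (cell_incr f N) t\<bar> \<le> \<alpha> + \<beta>"
  \<comment> \<open>The index of \<open>1\<close> lies beyond the last cell; at that point all ramps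
    are complete.\<close>
  proof (cases "t = 1")
    case True
    have "polygon N (cell_incr f N) 1 = f 1"
    proof -
      have "max 0 (min 1 (2 ^ N * 1 - real k)) = 1" if "k < 2 ^ N" for k
      proof -
        have "real (Suc k) \<le> real (2 ^ N)" using that by (simp only: of_nat_le_iff Suc_le_eq)
        then show ?thesis by simp
      qed
      then have "polygon N (cell_incr f N) 1 = (\<Sum>k<2 ^ N. cell_incr f N k)"
        by (simp add: polygon_def)
      then show ?thesis using sum[of "2 ^ N"] by simp
    qed
    then show ?thesis using True ab by simp
  next
    case False
    define j where "j = cell_index N t"
    have j: "j < 2 ^ N" "dyad N j \<le> t" "t < dyad N (Suc j)"
      using t False by (auto simp: j_def cell_index_less dyad_cell_index_le less_dyad_Suc_cell_index)
    have tj: "real j \<le> 2 ^ N * t" "2 ^ N * t \<le> real (Suc j)"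
      using j by (auto simp: dyad_def field_simps)
    have "polygon N (cell_incr f N) t = f (dyad N j) + cell_incr f N j * (2 ^ N * t - real j)"
      using polygon_on_cell[of j N t "cell_incr f N"] j sum by simp
    then have "\<bar>f t - polygon N (cell_incr f N) t\<bar> \<le> \<bar>f t - f (dyad N j)\<bar> + \<bar>cell_incr f N j * (2 ^ N * t - real j)\<bar>"
      by linarith
    also have "\<bar>cell_incr f N j * (2 ^ N * t - real j)\<bar> \<le> \<bar>cell_incr f N j\<bar> * 1"
      unfolding abs_mult using tj by (intro mult_left_mono) auto
    also have "\<bar>f t - f (dyad N j)\<bar> \<le> \<alpha>" unfolding j_def using t False by (intro \<alpha>) auto
    finally show ?thesis using \<beta>[OF j(1)] by linarith
  qed
qed

text \<open>Level \<open>N + M\<close> refines both grids, and energies increase with the level;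
  there every increment inside cell \<open>j\<close> is \<open>d j / 2 ^ M\<close>. Holding for all
  \<open>M\<close>, the bound controls the action of the polygon by its level-\<open>N\<close>
  energy.\<close>

lemma energy_polygon_le: "energy M (polygon N d) \<le> (\<Sum>k<2 ^ N. 2 ^ N * (d k)\<^sup>2) / 2"
proof -
  have "energy M (polygon N d) \<le> energy (N + M) (polygon N d)"
    by (rule energy_mono) simp
  also have "energy (N + M) (polygon N d) = (\<Sum>k<2 ^ N. 2 ^ N * (d k)\<^sup>2) / 2"
  proof -
    have incr: "cell_incr (polygon N d) (N + M) i = d j / 2 ^ M"
      if j: "j < 2 ^ N" and i: "i \<in> {j * 2 ^ M..<j * 2 ^ M + 2 ^ M}" for i j
    proof -
      have "j * 2 ^ M \<le> i" "Suc i \<le> Suc j * 2 ^ M" using i by auto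
      then have "dyad (N + M) (j * 2 ^ M) \<le> dyad (N + M) i" "dyad (N + M) (Suc i) \<le> dyad (N + M) (Suc j * 2 ^ M)"
        by (intro dyad_mono; simp)+
      then have "dyad N j \<le> dyad (N + M) i" "dyad (N + M) (Suc i) \<le> dyad N (Suc j)"
        unfolding dyad_refine by auto
      moreover have "dyad (N + M) i \<le> dyad (N + M) (Suc i)" by (simp add: dyad_mono)
      ultimately have "cell_incr (polygon N d) (N + M) i =
          d j * (2 ^ N * dyad (N + M) (Suc i) - real j) - d j * (2 ^ N * dyad (N + M) i - real j)"
        unfolding cell_incr_def by (subst (1 2) polygon_on_cell[OF j]) auto
      also have "\<dots> = d j / 2 ^ M"
        by (simp add: dyad_Suc power_add field_simps)
      finally show ?thesis .
    qed
    have "(\<Sum>i<2 ^ (N + M). 2 ^ (N + M) * (cell_incr (polygon N d) (N + M) i)\<^sup>2) =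
        (\<Sum>j<2 ^ N. \<Sum>i=j * 2 ^ M..<j * 2 ^ M + 2 ^ M. 2 ^ (N + M) * (cell_incr (polygon N d) (N + M) i)\<^sup>2)"
      unfolding sum.nat_group by (simp add: power_add)
    also have "\<dots> = (\<Sum>j<2 ^ N. \<Sum>i=j * 2 ^ M..<j * 2 ^ M + 2 ^ M. 2 ^ (N + M) * (d j / 2 ^ M)\<^sup>2)"
      by (intro sum.cong refl) (simp add: incr)
    also have "\<dots> = (\<Sum>k<2 ^ N. 2 ^ N * (d k)\<^sup>2)"
      by (intro sum.cong refl) (simp add: power_add power2_eq_square)
    finally show ?thesis by (simp add: energy_def)
  qed
  finally show ?thesis .
qed

section \<open>Separability of the path space and measurability of path-valued maps\<close>

lemma C01_uniform_modulus:
  assumes "f \<in> mspace C01" "0 < e"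
  obtains N0 where "\<And>N t. N0 \<le> N \<Longrightarrow> 0 \<le> t \<Longrightarrow> t \<le> 1 \<Longrightarrow> \<bar>f t - f (dyad N (cell_index N t))\<bar> \<le> e"
    "\<And>N k. N0 \<le> N \<Longrightarrow> k < 2 ^ N \<Longrightarrow> \<bar>cell_incr f N k\<bar> \<le> e"
proof -
  have "uniformly_continuous_on {0..1} f"
    using assms(1) by (auto simp: mspace_C01 intro: compact_uniformly_continuous)
  then obtain d where d: "0 < d" "\<And>x y. x \<in> {0..1} \<Longrightarrow> y \<in> {0..1} \<Longrightarrow> dist y x < d \<Longrightarrow> dist (f y) (f x) < e"
    using \<open>0 < e\<close> unfolding uniformly_continuous_on_def by metis
  obtain N0 where N0: "(1/2) ^ N0 < d" using d(1) real_arch_pow_inv[of d "1/2"] by auto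
  have nd: "1 / 2 ^ n < d" if "N0 \<le> n" for n
  proof -
    have "(1/2) ^ n \<le> (1/2 :: real) ^ N0" using that by (intro power_decreasing) auto
    then show ?thesis using N0 by (simp add: power_divide)
  qed
  show thesis
  proof (rule that[of N0])
    fix N and t :: real assume N: "N0 \<le> N" and t: "0 \<le> t" "t \<le> 1"
    have "dyad N (cell_index N t) \<le> t" "t < dyad N (cell_index N t) + 1 / 2 ^ N"
      using dyad_cell_index_le[OF t(1)] less_dyad_Suc_cell_index[OF t(1)] by (auto simp: dyad_Suc)
    then show "\<bar>f t - f (dyad N (cell_index N t))\<bar> \<le> e"
      using d(2)[of "dyad N (cell_index N t)" t] t nd[OF N] dyad_nonneg[of N "cell_index N t"]
      by (auto simp: dist_real_def simp del: dyad_le_1 dyad_nonneg)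
  next
    fix N and k :: nat assume N: "N0 \<le> N" and k: "k < 2 ^ N"
    then have "dyad N k \<in> {0..1}" "dyad N (Suc k) \<in> {0..1}" by auto
    then show "\<bar>cell_incr f N k\<bar> \<le> e"
      using d(2)[of "dyad N k" "dyad N (Suc k)"] nd[OF N]
      by (auto simp: dist_real_def cell_incr_def dyad_Suc[of N k] simp del: dyad_le_1)
  qed
qed

text \<open>Lists of rationals form a countable type, so these are countably many paths; missing
  entries count as zero increments.\<close>

definition rat_polygon :: "nat \<Rightarrow> rat list \<Rightarrow> real \<Rightarrow> real" where
  "rat_polygon N xs = polygon N (\<lambda>k. if k < length xs then of_rat (xs ! k) else 0)"

lemma rat_polygon_dense:
  assumes f: "f \<in> mspace C01" and "0 < e"
  shows "\<exists>N xs. mdist C01 f (rat_polygon N xs) \<le> e"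
proof -
  obtain N where N: "\<And>t. 0 \<le> t \<Longrightarrow> t \<le> 1 \<Longrightarrow> \<bar>f t - f (dyad N (cell_index N t))\<bar> \<le> e / 3"
    "\<And>k. k < 2 ^ N \<Longrightarrow> \<bar>cell_incr f N k\<bar> \<le> e / 3"
    using C01_uniform_modulus[OF f, of "e / 3"] \<open>0 < e\<close> by (metis divide_pos_pos order_refl zero_less_numeral)
  have 1: "mdist C01 f (polygon N (cell_incr f N)) \<le> e / 3 + e / 3"
    using N by (intro polygon_approx[OF f]) auto
  \<comment> \<open>Up to \<open>2 ^ N\<close> increment errors accumulate along the polygon, so
    each gets an equal share of \<open>e / 3\<close>.\<close>
  define \<eta> where "\<eta> = e / 3 / 2 ^ N"
  have "0 < \<eta>" using \<open>0 < e\<close> by (simp add: \<eta>_def)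
  have "\<exists>q. \<bar>cell_incr f N k - real_of_rat q\<bar> \<le> \<eta>" for k
  proof -
    obtain q where "cell_incr f N k < real_of_rat q" "real_of_rat q < cell_incr f N k + \<eta>"
      using of_rat_dense[of "cell_incr f N k" "cell_incr f N k + \<eta>"] \<open>0 < \<eta>\<close> by auto
    then show ?thesis by (intro exI[of _ q]) simp
  qed
  then obtain q where q: "\<And>k. \<bar>cell_incr f N k - real_of_rat (q k)\<bar> \<le> \<eta>" by metis
  define xs where "xs = map q [0..<2 ^ N]"
  have 2: "mdist C01 (polygon N (cell_incr f N)) (rat_polygon N xs) \<le> e / 3"
    unfolding rat_polygon_def mdist_C01_le[OF polygon_C01 polygon_C01]
  proof
    fix t :: real assume "t \<in> {0..1}"
    then have "\<bar>polygon N (cell_incr f N) t - polygon N (\<lambda>k. if k < length xs then of_rat (xs ! k) else 0) t\<bar> =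
        \<bar>\<Sum>k<2 ^ N. (cell_incr f N k - of_rat (q k)) * max 0 (min 1 (2 ^ N * t - real k))\<bar>"
      by (simp add: polygon_def xs_def sum_subtractf[symmetric] left_diff_distrib)
    also have "\<dots> \<le> (\<Sum>k<(2::nat) ^ N. \<eta> * 1)"
    proof (intro sum_abs[THEN order_trans] sum_mono)
      fix k
      show "\<bar>(cell_incr f N k - of_rat (q k)) * max 0 (min 1 (2 ^ N * t - real k))\<bar> \<le> \<eta> * 1"
        unfolding abs_mult using q \<open>0 < \<eta>\<close> by (intro mult_mono) auto
    qed
    also have "\<dots> = e / 3" by (simp add: \<eta>_def)
    finally show "\<bar>polygon N (cell_incr f N) t - polygon N (\<lambda>k. if k < length xs then of_rat (xs ! k) else 0) t\<bar> \<le> e / 3" .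
  qed
  have "mdist C01 f (rat_polygon N xs) \<le> mdist C01 f (polygon N (cell_incr f N)) + mdist C01 (polygon N (cell_incr f N)) (rat_polygon N xs)"
    by (rule C01.triangle) (auto simp: f polygon_C01 rat_polygon_def)
  then show ?thesis using 1 2 by (intro exI[of _ N] exI[of _ xs]) linarith
qed

text \<open>Dyadic points are dense and paths continuous. A closed ball thus becomes a countable
  intersection of conditions on single coordinates, which makes its preimage measurable.\<close>

lemma mdist_C01_le_dyad:
  assumes f: "f \<in> mspace C01" and g: "g \<in> mspace C01"
  shows "mdist C01 f g \<le> a \<longleftrightarrow> (\<forall>N k. k \<le> 2 ^ N \<longrightarrow> \<bar>f (dyad N k) - g (dyad N k)\<bar> \<le> a)"
  unfolding mdist_C01_le[OF f g]
proof (intro iffI ballI)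
  fix t :: real assume *: "\<forall>N k. k \<le> 2 ^ N \<longrightarrow> \<bar>f (dyad N k) - g (dyad N k)\<bar> \<le> a" and t: "t \<in> {0..1}"
  have ci: "cell_index N t \<le> 2 ^ N" for N using t cell_index_le[of t N] by simp
  have "(\<lambda>N. h (dyad N (cell_index N t))) \<longlonglongrightarrow> h t" if "continuous_on {0..1} h" for h :: "real \<Rightarrow> real"
    using t ci by (intro continuous_on_tendsto_compose[OF that tendsto_dyad_cell_index]) auto
  then have "(\<lambda>N. \<bar>f (dyad N (cell_index N t)) - g (dyad N (cell_index N t))\<bar>) \<longlonglongrightarrow> \<bar>f t - g t\<bar>"
    using f g by (intro tendsto_intros) (auto simp: mspace_C01)
  then show "\<bar>f t - g t\<bar> \<le> a"
    by (rule LIMSEQ_le_const2) (use * ci in blast)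
qed auto

text \<open>By separability an open set is the union of those closed balls with rational polygons as
  centres and rational radii that it contains, and there are only countably many.\<close>

lemma measurable_metric_borel_C01:
  assumes X: "\<And>\<omega>. \<omega> \<in> space M \<Longrightarrow> X \<omega> \<in> mspace C01"
    and Xt: "\<And>t. 0 \<le> t \<Longrightarrow> t \<le> 1 \<Longrightarrow> (\<lambda>\<omega>. X \<omega> t) \<in> borel_measurable M"
  shows "X \<in> measurable M (metric_borel C01)"
  unfolding metric_borel_def
proof (rule measurable_measure_of)
  show "{U. openin (mtopology_of C01) U} \<subseteq> Pow (mspace C01)"
    using openin_subset by (fastforce simp: mtopology_of_C01)
  show "X \<in> space M \<rightarrow> mspace C01" using X by auto
  fix U assume "U \<in> {U. openin (mtopology_of C01) U}"
  then have U: "openin C01.mtopology U" by (simp add: mtopology_of_C01)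
  define B where "B = (\<lambda>(N, xs, q :: rat). {g \<in> mspace C01. mdist C01 g (rat_polygon N xs) \<le> of_rat q})"
  have meas: "{\<omega> \<in> space M. X \<omega> \<in> B i} \<in> sets M" for i
  proof -
    obtain N xs q where i: "i = (N, xs, q)" by (cases i)
    let ?g = "rat_polygon N xs"
    have g: "?g \<in> mspace C01" by (simp add: rat_polygon_def polygon_C01)
    have "{\<omega> \<in> space M. X \<omega> \<in> B i} =
       {\<omega> \<in> space M. \<forall>m. \<forall>k\<in>{..2 ^ m}. \<bar>X \<omega> (dyad m k) - ?g (dyad m k)\<bar> \<le> of_rat q}"
      using X by (auto simp: B_def i mdist_C01_le_dyad[OF _ g])
    also have "\<dots> \<in> sets M"
    proof (intro sets.sets_Collect_countable_All sets.sets_Collect_finite_All)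
      fix m k :: nat assume "k \<in> {..2 ^ m}"
      then have [measurable]: "(\<lambda>\<omega>. X \<omega> (dyad m k)) \<in> borel_measurable M" by (intro Xt) auto
      show "{\<omega> \<in> space M. \<bar>X \<omega> (dyad m k) - ?g (dyad m k)\<bar> \<le> of_rat q} \<in> sets M" by measurable
    qed auto
    finally show ?thesis .
  qed
  have "U = (\<Union>i\<in>{i. B i \<subseteq> U}. B i)"
  proof (intro equalityI subsetI)
    fix f assume fU: "f \<in> U"
    then obtain r where r: "0 < r" "C01.mball f r \<subseteq> U" "f \<in> mspace C01"
      using U unfolding C01.openin_mtopology by blast
    \<comment> \<open>A centre within \<open>q\<close> of \<open>f\<close> and a radius
      \<open>q\<close> keep the ball within \<open>2 * q < r\<close> of \<open>f\<close>.\<close>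
    obtain q where q: "0 < real_of_rat q" "real_of_rat q < r / 2"
      using of_rat_dense[of 0 "r / 2"] r(1) by auto
    obtain N xs where g: "mdist C01 f (rat_polygon N xs) \<le> of_rat q"
      using rat_polygon_dense[OF r(3) q(1)] by blast
    have gm: "rat_polygon N xs \<in> mspace C01" by (simp add: rat_polygon_def polygon_C01)
    have "B (N, xs, q) \<subseteq> U"
    proof
      fix h assume "h \<in> B (N, xs, q)"
      then have h: "h \<in> mspace C01" "mdist C01 h (rat_polygon N xs) \<le> of_rat q" by (auto simp: B_def)
      have "mdist C01 f h \<le> mdist C01 f (rat_polygon N xs) + mdist C01 (rat_polygon N xs) h"
        by (rule C01.triangle[OF r(3) gm h(1)])
      then have "mdist C01 f h < r" using g h(2) q(2) by (simp add: C01.commute)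
      then show "h \<in> U" using r h(1) by auto
    qed
    moreover have "f \<in> B (N, xs, q)" using g r(3) by (simp add: B_def)
    ultimately show "f \<in> (\<Union>i\<in>{i. B i \<subseteq> U}. B i)" by blast
  qed auto
  then have "X -` U \<inter> space M = (\<Union>i\<in>{i. B i \<subseteq> U}. {\<omega> \<in> space M. X \<omega> \<in> B i})" by auto
  also have "\<dots> \<in> sets M" using meas by (intro sets.countable_UN'') auto
  finally show "X -` U \<inter> space M \<in> sets M" .
qed

section \<open>Probability estimates\<close>

text \<open>The tilted density is proportional to a centred Gaussian density of variance
  \<open>\<sigma>\<^sup>2 / (1 - \<theta>)\<close>, and the ratio of the normalising constants is
  the value. It is the moment generating function of half a squared standard normal
  variable.\<close>

lemma nn_integral_normal_exp_square:
  assumes \<sigma>: "0 < \<sigma>" and \<theta>: "\<theta> < 1"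
  shows "(\<integral>\<^sup>+x. ennreal (normal_density 0 \<sigma> x) * ennreal (exp (\<theta> * (x\<^sup>2 / (2 * \<sigma>\<^sup>2)))) \<partial>lborel) =
    ennreal (1 / sqrt (1 - \<theta>))"
proof -
  let ?s = "\<sigma> / sqrt (1 - \<theta>)"
  have s: "0 < ?s" using assms by simp
  have s2: "?s\<^sup>2 = \<sigma>\<^sup>2 / (1 - \<theta>)" using \<theta> by (simp add: power_divide)
  have "normal_density 0 \<sigma> x * exp (\<theta> * (x\<^sup>2 / (2 * \<sigma>\<^sup>2))) = 1 / sqrt (1 - \<theta>) * normal_density 0 ?s x" for x
  proof -
    have "- x\<^sup>2 / (2 * \<sigma>\<^sup>2) + \<theta> * (x\<^sup>2 / (2 * \<sigma>\<^sup>2)) = - x\<^sup>2 / (2 * (\<sigma>\<^sup>2 / (1 - \<theta>)))"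
      using \<sigma> \<theta> by (simp add: field_simps)
    then have e: "exp (- x\<^sup>2 / (2 * \<sigma>\<^sup>2)) * exp (\<theta> * (x\<^sup>2 / (2 * \<sigma>\<^sup>2))) = exp (- x\<^sup>2 / (2 * ?s\<^sup>2))"
      unfolding s2 by (simp only: exp_add[symmetric])
    have c: "1 / sqrt (1 - \<theta>) * (1 / sqrt (2 * pi * ?s\<^sup>2)) = 1 / sqrt (2 * pi * \<sigma>\<^sup>2)"
      unfolding s2 using \<sigma> \<theta> by (simp add: real_sqrt_mult real_sqrt_divide)
    have "normal_density 0 \<sigma> x * exp (\<theta> * (x\<^sup>2 / (2 * \<sigma>\<^sup>2))) =
        1 / sqrt (2 * pi * \<sigma>\<^sup>2) * (exp (- x\<^sup>2 / (2 * \<sigma>\<^sup>2)) * exp (\<theta> * (x\<^sup>2 / (2 * \<sigma>\<^sup>2))))"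
      by (simp add: normal_density_def)
    also have "\<dots> = 1 / sqrt (1 - \<theta>) * (1 / sqrt (2 * pi * ?s\<^sup>2) * exp (- x\<^sup>2 / (2 * ?s\<^sup>2)))"
      unfolding e c[symmetric] by simp
    finally show ?thesis by (simp add: normal_density_def)
  qed
  then have "(\<integral>\<^sup>+x. ennreal (normal_density 0 \<sigma> x) * ennreal (exp (\<theta> * (x\<^sup>2 / (2 * \<sigma>\<^sup>2)))) \<partial>lborel) =
     (\<integral>\<^sup>+x. ennreal (1 / sqrt (1 - \<theta>)) * ennreal (normal_density 0 ?s x) \<partial>lborel)"
    using \<theta> by (intro nn_integral_cong) (simp add: ennreal_mult[symmetric] del: ennreal_1)
  also have "\<dots> = ennreal (1 / sqrt (1 - \<theta>)) * (\<integral>\<^sup>+x. ennreal (normal_density 0 ?s x) \<partial>lborel)"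
    by (rule nn_integral_cmult) simp
  also have "(\<integral>\<^sup>+x. ennreal (normal_density 0 ?s x) \<partial>lborel) = 1"
    using prob_space.emeasure_space_1[OF prob_space_normal_density[OF s, of 0]]
    by (simp add: emeasure_density)
  finally show ?thesis by simp
qed

text \<open>Chernoff's method: Markov's inequality for the exponential of \<open>\<theta>\<close>
  times the sum, whose expectation factorises by independence. Values of \<open>\<theta>\<close>
  near \<open>1\<close> give rates as close to the sharp one as desired.\<close>

lemma (in prob_space) normal_square_sum_tail:
  assumes I: "finite I" and indep: "indep_vars (\<lambda>_. borel) X I"
    and dist: "\<And>i. i \<in> I \<Longrightarrow> distributed M lborel (X i) (normal_density 0 \<sigma>)"
    and \<sigma>: "0 < \<sigma>" and \<theta>: "0 < \<theta>" "\<theta> < 1"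
  shows "prob {\<omega> \<in> space M. L \<le> (\<Sum>i\<in>I. (X i \<omega>)\<^sup>2 / (2 * \<sigma>\<^sup>2))} \<le>
    exp (- \<theta> * L) * (1 / sqrt (1 - \<theta>)) ^ card I"
proof -
  define u where "u i \<omega> = ennreal (exp (\<theta> * ((X i \<omega>)\<^sup>2 / (2 * \<sigma>\<^sup>2))))" for i \<omega>
  have Xm: "X i \<in> borel_measurable M" if "i \<in> I" for i
    using dist[OF that] by (simp add: distributed_def)
  have um: "u i \<in> borel_measurable M" if "i \<in> I" for i
    using Xm[OF that] unfolding u_def by measurable
  have u1: "(\<integral>\<^sup>+\<omega>. u i \<omega> \<partial>M) = ennreal (1 / sqrt (1 - \<theta>))" if "i \<in> I" for i
  proof -
    have "(\<integral>\<^sup>+\<omega>. u i \<omega> \<partial>M) =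
      (\<integral>\<^sup>+x. ennreal (normal_density 0 \<sigma> x) * ennreal (exp (\<theta> * (x\<^sup>2 / (2 * \<sigma>\<^sup>2)))) \<partial>lborel)"
      unfolding u_def by (rule distributed_nn_integral[OF dist[OF that], symmetric]) simp
    then show ?thesis using nn_integral_normal_exp_square[OF \<sigma> \<theta>(2)] by simp
  qed
  have "indep_vars (\<lambda>_. borel) (\<lambda>i \<omega>. (\<lambda>x. ennreal (exp (\<theta> * (x\<^sup>2 / (2 * \<sigma>\<^sup>2))))) (X i \<omega>)) I"
    by (rule indep_vars_compose2[OF indep]) simp
  then have indep_u: "indep_vars (\<lambda>_. borel) u I" by (simp add: u_def[abs_def])
  let ?A = "{\<omega> \<in> space M. L \<le> (\<Sum>i\<in>I. (X i \<omega>)\<^sup>2 / (2 * \<sigma>\<^sup>2))}"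
  have "emeasure M ?A \<le> emeasure M {\<omega> \<in> space M. 1 \<le> ennreal (exp (- \<theta> * L)) * (\<Prod>i\<in>I. u i \<omega>)}"
  proof (rule emeasure_mono)
    have "1 \<le> ennreal (exp (- \<theta> * L)) * (\<Prod>i\<in>I. u i \<omega>)" if "L \<le> (\<Sum>i\<in>I. (X i \<omega>)\<^sup>2 / (2 * \<sigma>\<^sup>2))" for \<omega>
    proof -
      have "(\<Prod>i\<in>I. u i \<omega>) = ennreal (exp (\<theta> * (\<Sum>i\<in>I. (X i \<omega>)\<^sup>2 / (2 * \<sigma>\<^sup>2))))"
        unfolding u_def by (subst prod_ennreal) (simp_all add: exp_sum[OF I, symmetric] sum_distrib_left)
      then have "ennreal (exp (- \<theta> * L)) * (\<Prod>i\<in>I. u i \<omega>) =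
          ennreal (exp (\<theta> * ((\<Sum>i\<in>I. (X i \<omega>)\<^sup>2 / (2 * \<sigma>\<^sup>2)) - L)))"
        by (simp add: ennreal_mult[symmetric] exp_add[symmetric] right_diff_distrib)
      moreover have "1 \<le> exp (\<theta> * ((\<Sum>i\<in>I. (X i \<omega>)\<^sup>2 / (2 * \<sigma>\<^sup>2)) - L))"
        using that \<theta>(1) by simp
      ultimately show ?thesis by (metis ennreal_1 ennreal_leI)
    qed
    then show "?A \<subseteq> {\<omega> \<in> space M. 1 \<le> ennreal (exp (- \<theta> * L)) * (\<Prod>i\<in>I. u i \<omega>)}" by blast
    show "{\<omega> \<in> space M. 1 \<le> ennreal (exp (- \<theta> * L)) * (\<Prod>i\<in>I. u i \<omega>)} \<in> sets M"
      using um by measurable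
  qed
  also have "\<dots> \<le> ennreal (exp (- \<theta> * L)) * (\<integral>\<^sup>+\<omega>\<in>space M. (\<Prod>i\<in>I. u i \<omega>) \<partial>M)"
    using um by (intro nn_integral_Markov_inequality) auto
  also have "(\<integral>\<^sup>+\<omega>\<in>space M. (\<Prod>i\<in>I. u i \<omega>) \<partial>M) = (\<integral>\<^sup>+\<omega>. (\<Prod>i\<in>I. u i \<omega>) \<partial>M)"
    by (intro nn_integral_cong) simp
  also have "\<dots> = (\<Prod>i\<in>I. \<integral>\<^sup>+\<omega>. u i \<omega> \<partial>M)"
    by (rule indep_vars_nn_integral[OF I indep_u]) simp
  also have "\<dots> = ennreal (1 / sqrt (1 - \<theta>)) ^ card I" by (simp add: u1)
  also have "ennreal (exp (- \<theta> * L)) * ennreal (1 / sqrt (1 - \<theta>)) ^ card I =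
      ennreal (exp (- \<theta> * L) * (1 / sqrt (1 - \<theta>)) ^ card I)"
    using \<theta> by (simp add: ennreal_mult ennreal_power)
  finally show ?thesis
    using \<theta> by (simp add: emeasure_eq_measure)
qed

text \<open>The one-variable case with \<open>\<theta> = 1/2\<close>, its prefactor
  \<open>sqrt 2\<close> rounded up to \<open>2\<close>. The denominator \<open>4\<close> instead of
  the sharp \<open>2\<close> is harmless: chaining only needs exponents that grow with the
  level.\<close>

lemma (in prob_space) normal_tail:
  assumes dist: "distributed M lborel X (normal_density 0 \<sigma>)" and \<sigma>: "0 < \<sigma>" and "0 \<le> a"
  shows "prob {\<omega> \<in> space M. a \<le> \<bar>X \<omega>\<bar>} \<le> 2 * exp (- (a\<^sup>2 / (4 * \<sigma>\<^sup>2)))"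
proof -
  have Xm: "X \<in> borel_measurable M" using dist by (simp add: distributed_def)
  have "indep_vars (\<lambda>_. borel) (\<lambda>_. X) {()}"
    by (subst indep_vars_def2) (use Xm in \<open>auto simp: indep_sets_def dest!: subset_singletonD\<close>)
  from normal_square_sum_tail[OF _ this, of \<sigma> "1/2" "a\<^sup>2 / (2 * \<sigma>\<^sup>2)"] dist \<sigma>
  have *: "prob {\<omega> \<in> space M. a\<^sup>2 / (2 * \<sigma>\<^sup>2) \<le> (X \<omega>)\<^sup>2 / (2 * \<sigma>\<^sup>2)} \<le>
      exp (- (1/2) * (a\<^sup>2 / (2 * \<sigma>\<^sup>2))) * (1 / sqrt (1 - 1/2))" by simp
  have eq: "{\<omega> \<in> space M. a\<^sup>2 / (2 * \<sigma>\<^sup>2) \<le> (X \<omega>)\<^sup>2 / (2 * \<sigma>\<^sup>2)} = {\<omega> \<in> space M. a \<le> \<bar>X \<omega>\<bar>}"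
    using \<sigma> \<open>0 \<le> a\<close> by (auto simp: divide_le_cancel abs_le_square_iff[symmetric])
  have "1 / sqrt (1 - 1/2) \<le> (2::real)"
  proof -
    have "sqrt (1/4) \<le> sqrt (1 - 1/2 :: real)" by (rule real_sqrt_le_mono) simp
    then have "1/2 \<le> sqrt (1 - 1/2 :: real)" by (simp add: real_sqrt_divide)
    then show ?thesis by (simp add: divide_le_eq del: diff_numeral_special)
  qed
  then have "exp (- (1/2) * (a\<^sup>2 / (2 * \<sigma>\<^sup>2))) * (1 / sqrt (1 - 1/2)) \<le> exp (- (1/2) * (a\<^sup>2 / (2 * \<sigma>\<^sup>2))) * 2"
    by (rule mult_left_mono) simp
  with *[unfolded eq] have "prob {\<omega> \<in> space M. a \<le> \<bar>X \<omega>\<bar>} \<le> exp (- (1/2) * (a\<^sup>2 / (2 * \<sigma>\<^sup>2))) * 2"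
    by (rule order_trans)
  then show ?thesis by (simp add: mult.commute)
qed

lemma (in prob_space) normal_box_lower:
  assumes dist: "distributed M lborel X (normal_density 0 \<sigma>)" and \<sigma>: "0 < \<sigma>" "2 * pi * \<sigma>\<^sup>2 \<le> 1" and "0 < \<rho>"
  shows "2 * \<rho> * exp (- ((\<bar>d\<bar> + \<rho>)\<^sup>2 / (2 * \<sigma>\<^sup>2))) \<le> prob (X -` {d - \<rho>..d + \<rho>} \<inter> space M)"
proof -
  let ?c = "exp (- ((\<bar>d\<bar> + \<rho>)\<^sup>2 / (2 * \<sigma>\<^sup>2)))"
  have "ennreal (2 * \<rho> * ?c) = ennreal ?c * emeasure lborel {d - \<rho>..d + \<rho>}"
    using \<open>0 < \<rho>\<close> by (simp add: ennreal_mult[symmetric] mult.commute)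
  also have "\<dots> = (\<integral>\<^sup>+x. ennreal ?c * indicator {d - \<rho>..d + \<rho>} x \<partial>lborel)"
    by (rule nn_integral_cmult_indicator[symmetric]) simp
  also have "\<dots> \<le> (\<integral>\<^sup>+x\<in>{d - \<rho>..d + \<rho>}. ennreal (normal_density 0 \<sigma> x) \<partial>lborel)"
  proof (rule nn_integral_mono)
    fix x
    have "?c \<le> normal_density 0 \<sigma> x" if "x \<in> {d - \<rho>..d + \<rho>}"
    proof -
      have "\<bar>x\<bar> \<le> \<bar>d\<bar> + \<rho>" using that by auto
      then have "x\<^sup>2 \<le> (\<bar>d\<bar> + \<rho>)\<^sup>2" using \<open>0 < \<rho>\<close> by (simp add: abs_le_square_iff[symmetric])
      then have "?c \<le> exp (- x\<^sup>2 / (2 * \<sigma>\<^sup>2))" using \<sigma>(1) by (simp add: divide_right_mono)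
      moreover have "1 \<le> 1 / sqrt (2 * pi * \<sigma>\<^sup>2)" using \<sigma> by (simp add: le_divide_eq)
      ultimately have "1 * ?c \<le> 1 / sqrt (2 * pi * \<sigma>\<^sup>2) * exp (- x\<^sup>2 / (2 * \<sigma>\<^sup>2))"
        by (intro mult_mono) auto
      then show ?thesis by (simp add: normal_density_def)
    qed
    then show "ennreal ?c * indicator {d - \<rho>..d + \<rho>} x \<le> ennreal (normal_density 0 \<sigma> x) * indicator {d - \<rho>..d + \<rho>} x"
      by (auto split: split_indicator)
  qed
  also have "\<dots> = emeasure M (X -` {d - \<rho>..d + \<rho>} \<inter> space M)"
    by (rule distributed_emeasure[OF dist, symmetric]) simp
  finally show ?thesis by (simp add: emeasure_eq_measure)
qed

text \<open>The ratio \<open>3/4\<close> exceeds \<open>1 / sqrt 2\<close>, the decay rate of the standard deviation of the increments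
  from one level to the next, so that the Gaussian tails are summable over all levels.\<close>

definition regular_path :: "nat \<Rightarrow> real \<Rightarrow> (real \<Rightarrow> real) \<Rightarrow> bool" where
  "regular_path N \<tau> f \<longleftrightarrow> (\<forall>j. \<forall>k<2 ^ (N + j). \<bar>cell_incr f (N + j) k\<bar> \<le> \<tau> * (3/4) ^ j)"

lemma regular_path_cell_incr: "regular_path N \<tau> f \<Longrightarrow> k < 2 ^ N \<Longrightarrow> \<bar>cell_incr f N k\<bar> \<le> \<tau>"
  unfolding regular_path_def by (metis add_0_right mult.right_neutral power_0)

text \<open>Chaining: consecutive dyadic approximations of \<open>t\<close> coincide or differ by
  one increment of the finer level, and the terms \<open>\<tau> * (3/4) ^ j\<close> for
  \<open>j \<ge> 1\<close> sum to \<open>3 * \<tau>\<close>.\<close>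

lemma regular_path_oscillation:
  assumes f: "f \<in> mspace C01" and good: "regular_path N \<tau> f" and t: "0 \<le> t" "t < 1"
  shows "\<bar>f t - f (dyad N (cell_index N t))\<bar> \<le> 3 * \<tau>"
proof -
  define p where "p j = dyad (N + j) (cell_index (N + j) t)" for j
  have \<tau>: "0 \<le> \<tau>" using regular_path_cell_incr[OF good, of 0] by simp
  have step: "\<bar>f (p (Suc j)) - f (p j)\<bar> \<le> \<tau> * (3/4) ^ Suc j" for j
  proof -
    let ?i = "cell_index (N + j) t"
    have eq: "p j = dyad (N + Suc j) (2 * ?i)" by (simp add: p_def dyad_def field_simps)
    from cell_index_Suc[OF t(1), of "N + j"] show ?thesis
    proof
      assume "cell_index (Suc (N + j)) t = 2 * ?i"
      then have "p (Suc j) = p j" unfolding eq by (simp add: p_def)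
      then show ?thesis using \<tau> by simp
    next
      assume *: "cell_index (Suc (N + j)) t = Suc (2 * ?i)"
      have "?i < 2 ^ (N + j)" using t by (rule cell_index_less)
      then have "2 * ?i < 2 ^ (N + Suc j)" by simp
      then have "\<bar>cell_incr f (N + Suc j) (2 * ?i)\<bar> \<le> \<tau> * (3/4) ^ Suc j"
        using good unfolding regular_path_def by blast
      then show ?thesis unfolding eq cell_incr_def using * by (simp add: p_def)
    qed
  qed
  have bound: "\<bar>f (p m) - f (p 0)\<bar> \<le> 3 * \<tau> * (1 - (3/4) ^ m)" for m
  proof (induction m)
    case (Suc m)
    have "\<bar>f (p (Suc m)) - f (p 0)\<bar> \<le> \<bar>f (p (Suc m)) - f (p m)\<bar> + \<bar>f (p m) - f (p 0)\<bar>" by linarith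
    also have "\<dots> \<le> \<tau> * (3/4) ^ Suc m + 3 * \<tau> * (1 - (3/4) ^ m)" using step[of m] Suc by linarith
    also have "\<dots> = 3 * \<tau> * (1 - (3/4) ^ Suc m)" by (simp add: algebra_simps)
    finally show ?case .
  qed simp
  have "(\<lambda>m. f (dyad m (cell_index m t))) \<longlonglongrightarrow> f t"
    using f t cell_index_le[of t]
    by (intro continuous_on_tendsto_compose[OF _ tendsto_dyad_cell_index]) (auto simp: mspace_C01)
  from LIMSEQ_ignore_initial_segment[OF this, of N]
  have "(\<lambda>m. f (p m)) \<longlonglongrightarrow> f t" by (simp add: p_def add.commute)
  then have "(\<lambda>m. \<bar>f (p m) - f (p 0)\<bar>) \<longlonglongrightarrow> \<bar>f t - f (p 0)\<bar>" by (intro tendsto_intros)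
  moreover have "\<bar>f (p m) - f (p 0)\<bar> \<le> 3 * \<tau>" for m
  proof -
    have "3 * \<tau> * (1 - (3/4) ^ m) \<le> 3 * \<tau> * 1" using \<tau> by (intro mult_left_mono) auto
    then show ?thesis using bound[of m] by linarith
  qed
  ultimately show ?thesis
    by (intro LIMSEQ_le_const2[of "\<lambda>m. \<bar>f (p m) - f (p 0)\<bar>"]) (auto simp: p_def)
qed

section \<open>The rescaled Brownian path on the dyadic grids\<close>

context standard_brownian_motion
begin

lemma rescaled_path_C01:
  assumes "0 < \<epsilon>" "\<omega> \<in> space M" shows "rescaled_path B \<epsilon> \<omega> \<in> mspace C01"
  unfolding mspace_C01
proof (intro conjI)
  have "continuous_on {0..1} (\<lambda>t. \<epsilon> * B (t / \<epsilon>) \<omega>)"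
    using assms(1)
    by (intro continuous_intros continuous_on_compose2[OF continuous_paths[OF assms(2)]]) auto
  then show "continuous_on {0..1} (rescaled_path B \<epsilon> \<omega>)"
    by (rule continuous_on_eq) (simp add: rescaled_path_def)
qed (use assms start in \<open>auto simp: rescaled_path_def\<close>)

lemma rescaled_path_random_variable:
  assumes "0 < \<epsilon>" "0 \<le> t" "t \<le> 1"
  shows "(\<lambda>\<omega>. rescaled_path B \<epsilon> \<omega> t) \<in> borel_measurable M"
  using random_variable[of "t / \<epsilon>"] assms by (simp add: rescaled_path_def)

lemma rescaled_path_measurable:
  assumes "0 < \<epsilon>" shows "rescaled_path B \<epsilon> \<in> measurable M (metric_borel C01)"
  using assms by (intro measurable_metric_borel_C01 rescaled_path_C01 rescaled_path_random_variable) auto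

lemma rescaled_cell_incr:
  assumes "k < 2 ^ N"
  shows "cell_incr (rescaled_path B \<epsilon> \<omega>) N k = \<epsilon> * (B (dyad N (Suc k) / \<epsilon>) \<omega> - B (dyad N k / \<epsilon>) \<omega>)"
  using assms by (simp add: cell_incr_def rescaled_path_def right_diff_distrib)

text \<open>Brownian scaling: the variance is \<open>\<epsilon>\<^sup>2 * (1 / 2 ^ N / \<epsilon>) =
  \<epsilon> / 2 ^ N\<close>.\<close>

lemma rescaled_cell_incr_distributed:
  assumes \<epsilon>: "0 < \<epsilon>" and k: "k < 2 ^ N"
  shows "distributed M lborel (\<lambda>\<omega>. cell_incr (rescaled_path B \<epsilon> \<omega>) N k) (normal_density 0 (sqrt (\<epsilon> / 2 ^ N)))"
proof -
  have "dyad N k / \<epsilon> < dyad N (Suc k) / \<epsilon>" using \<epsilon> by (simp add: dyad_Suc divide_strict_right_mono)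
  from normal_increments[OF _ this] \<epsilon>
  have "distributed M lborel (\<lambda>\<omega>. B (dyad N (Suc k) / \<epsilon>) \<omega> - B (dyad N k / \<epsilon>) \<omega>)
      (normal_density 0 (sqrt (1 / 2 ^ N / \<epsilon>)))"
    by (simp add: dyad_Suc diff_divide_distrib[symmetric])
  from normal_density_affine[OF this, of \<epsilon> 0] \<epsilon>
  have "distributed M lborel (\<lambda>\<omega>. \<epsilon> * (B (dyad N (Suc k) / \<epsilon>) \<omega> - B (dyad N k / \<epsilon>) \<omega>))
      (normal_density 0 (\<epsilon> * sqrt (1 / 2 ^ N / \<epsilon>)))"
    by simp
  moreover have "\<epsilon> * sqrt (1 / 2 ^ N / \<epsilon>) = sqrt (\<epsilon> / 2 ^ N)"
  proof -
    have "\<epsilon> * sqrt (1 / 2 ^ N / \<epsilon>) = sqrt (\<epsilon>\<^sup>2 * (1 / 2 ^ N / \<epsilon>))"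
      using \<epsilon> by (simp only: real_sqrt_mult real_sqrt_abs abs_of_pos)
    also have "\<epsilon>\<^sup>2 * (1 / 2 ^ N / \<epsilon>) = \<epsilon> / 2 ^ N" using \<epsilon> by (simp add: power2_eq_square)
    finally show ?thesis .
  qed
  ultimately show ?thesis by (simp add: rescaled_cell_incr[OF k])
qed

lemma rescaled_cell_incr_indep:
  assumes \<epsilon>: "0 < \<epsilon>"
  shows "indep_vars (\<lambda>_. borel) (\<lambda>k \<omega>. cell_incr (rescaled_path B \<epsilon> \<omega>) N k) {..<2 ^ N}"
proof -
  have "indep_vars (\<lambda>_. borel) (\<lambda>i \<omega>. B (dyad N (Suc i) / \<epsilon>) \<omega> - B (dyad N i / \<epsilon>) \<omega>) {..<2 ^ N}"
    using \<epsilon> by (intro indep_increments) (auto intro!: divide_right_mono dyad_mono)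
  from indep_vars_compose2[OF this, of "\<lambda>_ x. \<epsilon> * x" "\<lambda>_. borel"]
  have "indep_vars (\<lambda>_. borel) (\<lambda>i \<omega>. \<epsilon> * (B (dyad N (Suc i) / \<epsilon>) \<omega> - B (dyad N i / \<epsilon>) \<omega>)) {..<2 ^ N}"
    by simp
  then show ?thesis
    by (subst indep_vars_cong[OF refl _ refl]) (auto simp: rescaled_cell_incr fun_eq_iff)
qed

lemma rescaled_cell_incr_measurable:
  assumes "0 < \<epsilon>" "k < 2 ^ N"
  shows "(\<lambda>\<omega>. cell_incr (rescaled_path B \<epsilon> \<omega>) N k) \<in> borel_measurable M"
  using rescaled_cell_incr_distributed[OF assms] by (simp add: distributed_def)

text \<open>With variance \<open>\<epsilon> / 2 ^ N\<close> per cell, the energy divided by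
  \<open>\<epsilon>\<close> is exactly the sum in the Chernoff bound; the prefactor depends on
  \<open>N\<close> but not on \<open>\<epsilon>\<close>.\<close>

lemma energy_tail:
  assumes \<epsilon>: "0 < \<epsilon>" and \<theta>: "0 < \<theta>" "\<theta> < 1"
  shows "prob {\<omega> \<in> space M. L \<le> energy N (rescaled_path B \<epsilon> \<omega>)} \<le>
    exp (- \<theta> * L / \<epsilon>) * (1 / sqrt (1 - \<theta>)) ^ 2 ^ N"
proof -
  let ?s = "sqrt (\<epsilon> / 2 ^ N)"
  have "(\<Sum>k<2 ^ N. (cell_incr f N k)\<^sup>2 / (2 * ?s\<^sup>2)) = energy N f / \<epsilon>" for f
    using \<epsilon> by (simp add: energy_def sum_divide_distrib mult.commute)
  then have "{\<omega> \<in> space M. L \<le> energy N (rescaled_path B \<epsilon> \<omega>)} =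
     {\<omega> \<in> space M. L / \<epsilon> \<le> (\<Sum>k<2 ^ N. (cell_incr (rescaled_path B \<epsilon> \<omega>) N k)\<^sup>2 / (2 * ?s\<^sup>2))}"
    using \<epsilon> by (simp add: divide_le_cancel)
  also have "prob \<dots> \<le> exp (- \<theta> * (L / \<epsilon>)) * (1 / sqrt (1 - \<theta>)) ^ card {..<(2::nat) ^ N}"
    using \<epsilon> \<theta> rescaled_cell_incr_indep[OF \<epsilon>] rescaled_cell_incr_distributed[OF \<epsilon>]
    by (intro normal_square_sum_tail) auto
  finally show ?thesis by simp
qed

lemma regular_path_sets:
  assumes \<epsilon>: "0 < \<epsilon>" shows "{\<omega> \<in> space M. regular_path N \<tau> (rescaled_path B \<epsilon> \<omega>)} \<in> sets M"
proof -
  have "{\<omega> \<in> space M. regular_path N \<tau> (rescaled_path B \<epsilon> \<omega>)} =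
     {\<omega> \<in> space M. \<forall>j. \<forall>k\<in>{..<2 ^ (N + j)}. \<bar>cell_incr (rescaled_path B \<epsilon> \<omega>) (N + j) k\<bar> \<le> \<tau> * (3/4) ^ j}"
    by (auto simp: regular_path_def)
  also have "\<dots> \<in> sets M"
  proof (intro sets.sets_Collect_countable_All sets.sets_Collect_finite_All)
    fix j and k :: nat assume "k \<in> {..<2 ^ (N + j)}"
    then have [measurable]: "(\<lambda>\<omega>. cell_incr (rescaled_path B \<epsilon> \<omega>) (N + j) k) \<in> borel_measurable M"
      using rescaled_cell_incr_measurable[OF \<epsilon>] by auto
    show "{\<omega> \<in> space M. \<bar>cell_incr (rescaled_path B \<epsilon> \<omega>) (N + j) k\<bar> \<le> \<tau> * (3/4) ^ j} \<in> sets M" by measurable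
  qed auto
  finally show ?thesis .
qed

text \<open>Union bound over all cells of all levels \<open>N + j\<close>. Since
  \<open>(3/4)\<^sup>2 * 2 = 9/8\<close>, the exponent at level \<open>N + j\<close> is
  \<open>a / \<epsilon> * (9/8) ^ j\<close>, and Bernoulli's inequality extracts from it a factor
  \<open>exp (- (a / 8 / \<epsilon>)) ^ j\<close>. The hypothesis \<open>small\<close>, true for all
  small \<open>\<epsilon>\<close>, bounds this factor by \<open>(1/4) ^ j\<close>, which beats the
  growth \<open>2 ^ j\<close> of the number of cells.\<close>

lemma irregular_path_prob:
  assumes \<epsilon>: "0 < \<epsilon>" and \<tau>: "0 < \<tau>"
    and small: "exp (- (\<tau>\<^sup>2 * 2 ^ N / 32 / \<epsilon>)) \<le> 1/4"
  shows "prob {\<omega> \<in> space M. \<not> regular_path N \<tau> (rescaled_path B \<epsilon> \<omega>)} \<le>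
    2 ^ (N + 2) * exp (- (\<tau>\<^sup>2 * 2 ^ N / 4 / \<epsilon>))"
proof -
  define a where "a = \<tau>\<^sup>2 * 2 ^ N / 4"
  have a: "0 < a" using \<tau> by (simp add: a_def)
  define E where "E j k = {\<omega> \<in> space M. \<tau> * (3/4) ^ j \<le> \<bar>cell_incr (rescaled_path B \<epsilon> \<omega>) (N + j) k\<bar>}" for j k
  define A where "A j = (\<Union>k<2 ^ (N + j). E j k)" for j
  have Em: "E j k \<in> sets M" if "k < 2 ^ (N + j)" for j k
  proof -
    have [measurable]: "(\<lambda>\<omega>. cell_incr (rescaled_path B \<epsilon> \<omega>) (N + j) k) \<in> borel_measurable M"
      using rescaled_cell_incr_measurable[OF \<epsilon> that] .
    show ?thesis unfolding E_def by measurable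
  qed
  have Am: "A j \<in> sets M" for j unfolding A_def using Em by auto
  have Ej: "prob (E j k) \<le> 2 * exp (- (a / \<epsilon>)) * (1/4) ^ j" if k: "k < 2 ^ (N + j)" for j k
  proof -
    have "prob (E j k) \<le> 2 * exp (- ((\<tau> * (3/4) ^ j)\<^sup>2 / (4 * (sqrt (\<epsilon> / 2 ^ (N + j)))\<^sup>2)))"
      unfolding E_def using \<epsilon> \<tau> by (intro normal_tail rescaled_cell_incr_distributed k) auto
    also have "(\<tau> * (3/4) ^ j)\<^sup>2 / (4 * (sqrt (\<epsilon> / 2 ^ (N + j)))\<^sup>2) = a / \<epsilon> * (9/8) ^ j"
    proof -
      have "((3/4 :: real) ^ j)\<^sup>2 * 2 ^ j = (((3/4)\<^sup>2) * 2) ^ j"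
        by (simp only: power_mult_distrib power_mult[symmetric] mult.commute)
      then have "((3/4 :: real) ^ j)\<^sup>2 * 2 ^ j = (9/8) ^ j" by (simp add: power2_eq_square)
      moreover have "(\<tau> * (3/4) ^ j)\<^sup>2 / (4 * (sqrt (\<epsilon> / 2 ^ (N + j)))\<^sup>2) = a / \<epsilon> * (((3/4) ^ j)\<^sup>2 * 2 ^ j)"
        using \<epsilon> by (simp add: a_def power_mult_distrib power_add)
      ultimately show ?thesis by simp
    qed
    also have "exp (- (a / \<epsilon> * (9/8) ^ j)) \<le> exp (- (a / \<epsilon>)) * (1/4) ^ j"
    proof -
      have "1 + real j * (1/8) \<le> (1 + 1/8) ^ j" by (rule Bernoulli_inequality) simp
      then have "a / \<epsilon> * (1 + real j * (1/8)) \<le> a / \<epsilon> * (9/8) ^ j"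
        using a \<epsilon> by (intro mult_left_mono) auto
      then have "exp (- (a / \<epsilon> * (9/8) ^ j)) \<le> exp (- (a / \<epsilon>) + real j * (- (a / 8 / \<epsilon>)))"
        by (simp add: algebra_simps)
      also have "\<dots> = exp (- (a / \<epsilon>)) * exp (- (a / 8 / \<epsilon>)) ^ j"
        by (simp only: exp_add exp_of_nat_mult)
      also have "\<dots> \<le> exp (- (a / \<epsilon>)) * (1/4) ^ j"
        using small by (intro mult_left_mono power_mono) (auto simp: a_def)
      finally show ?thesis .
    qed
    finally show ?thesis by simp
  qed
  have Aj: "prob (A j) \<le> 2 ^ (N + 1) * exp (- (a / \<epsilon>)) * (1/2) ^ j" for j
  proof -
    have "prob (A j) \<le> (\<Sum>k<2 ^ (N + j). prob (E j k))"
      unfolding A_def using Em by (intro finite_measure_subadditive_finite) auto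
    also have "\<dots> \<le> (\<Sum>k<(2::nat) ^ (N + j). 2 * exp (- (a / \<epsilon>)) * (1/4) ^ j)"
      by (intro sum_mono Ej) auto
    also have "\<dots> = 2 ^ (N + 1) * exp (- (a / \<epsilon>)) * (2 ^ j * (1/4) ^ j)"
      by (simp add: power_add)
    also have "2 ^ j * (1/4 :: real) ^ j = (1/2) ^ j"
      by (simp add: power_mult_distrib[symmetric])
    finally show ?thesis .
  qed
  have sum: "(\<lambda>j. 2 ^ (N + 1) * exp (- (a / \<epsilon>)) * (1/2) ^ j) sums (2 ^ (N + 1) * exp (- (a / \<epsilon>)) * (1 / (1 - 1/2)))"
    by (intro sums_mult geometric_sums) simp
  have sA: "summable (\<lambda>j. prob (A j))"
    by (rule summable_comparison_test'[OF sums_summable[OF sum], of 0]) (use Aj in auto)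
  have "prob {\<omega> \<in> space M. \<not> regular_path N \<tau> (rescaled_path B \<epsilon> \<omega>)} \<le> prob (\<Union>j. A j)"
  proof (rule finite_measure_mono)
    show "{\<omega> \<in> space M. \<not> regular_path N \<tau> (rescaled_path B \<epsilon> \<omega>)} \<subseteq> (\<Union>j. A j)"
      by (auto simp: regular_path_def A_def E_def not_le intro: less_imp_le)
    show "(\<Union>j. A j) \<in> sets M" using Am by auto
  qed
  also have "\<dots> \<le> (\<Sum>j. prob (A j))"
    using Am sA by (intro finite_measure_subadditive_countably) auto
  also have "\<dots> \<le> (\<Sum>j. 2 ^ (N + 1) * exp (- (a / \<epsilon>)) * (1/2) ^ j)"
    by (intro suminf_le Aj sA sums_summable[OF sum])
  also have "\<dots> = 2 ^ (N + 2) * exp (- (a / \<epsilon>))"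
    using sums_unique[OF sum] by simp
  finally show ?thesis by (simp add: a_def)
qed

text \<open>Independence multiplies the one-cell bounds. As \<open>\<rho>\<close> tends to
  \<open>0\<close>, the sum in the exponent tends to the energy of a path with increments
  \<open>d\<close>, while the factor \<open>(2 * \<rho>) ^ 2 ^ N\<close> does not involve
  \<open>\<epsilon>\<close>.\<close>

lemma cell_box_prob:
  assumes \<epsilon>: "0 < \<epsilon>" "2 * pi * (\<epsilon> / 2 ^ N) \<le> 1" and "0 < \<rho>"
  shows "(2 * \<rho>) ^ 2 ^ N * exp (- ((\<Sum>k<2 ^ N. 2 ^ N * (\<bar>d k\<bar> + \<rho>)\<^sup>2) / 2 / \<epsilon>)) \<le>
    prob {\<omega> \<in> space M. \<forall>k<2 ^ N. \<bar>cell_incr (rescaled_path B \<epsilon> \<omega>) N k - d k\<bar> \<le> \<rho>}"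
proof -
  let ?s = "sqrt (\<epsilon> / 2 ^ N)"
  let ?X = "\<lambda>k \<omega>. cell_incr (rescaled_path B \<epsilon> \<omega>) N k"
  have "(2 * \<rho>) ^ 2 ^ N * exp (- ((\<Sum>k<2 ^ N. 2 ^ N * (\<bar>d k\<bar> + \<rho>)\<^sup>2) / 2 / \<epsilon>)) =
     (\<Prod>k<2 ^ N. 2 * \<rho> * exp (- ((\<bar>d k\<bar> + \<rho>)\<^sup>2 / (2 * ?s\<^sup>2))))"
    using \<epsilon>(1) by (simp add: prod.distrib exp_sum[symmetric] sum_negf sum_divide_distrib mult_ac)
  also have "\<dots> \<le> (\<Prod>k<2 ^ N. prob (?X k -` {d k - \<rho>..d k + \<rho>} \<inter> space M))"
    using assms by (intro prod_mono conjI normal_box_lower rescaled_cell_incr_distributed) auto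
  also have "\<dots> = prob (\<Inter>k\<in>{..<2 ^ N}. ?X k -` {d k - \<rho>..d k + \<rho>} \<inter> space M)"
    by (rule indep_varsD[OF rescaled_cell_incr_indep[OF \<epsilon>(1)], symmetric])
       (auto simp: lessThan_empty_iff)
  also have "(\<Inter>k\<in>{..<2 ^ N}. ?X k -` {d k - \<rho>..d k + \<rho>} \<inter> space M) =
      {\<omega> \<in> space M. \<forall>k<2 ^ N. \<bar>?X k \<omega> - d k\<bar> \<le> \<rho>}"
    by (auto simp: abs_le_iff lessThan_empty_iff)
  finally show ?thesis .
qed

end

section \<open>The large deviation bounds\<close>

lemma eventually_exp_small:
  assumes "0 < a" "0 < c"
  shows "\<forall>\<^sub>F \<epsilon> in at_right 0. C * exp (- (a / \<epsilon>)) \<le> (c::real)"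
proof -
  have "((\<lambda>\<epsilon>. exp (- (a / \<epsilon>))) \<longlongrightarrow> 0) (at_right 0)"
  proof (rule filterlim_compose[OF exp_at_bot])
    have "filterlim (\<lambda>\<epsilon>. a * inverse \<epsilon>) at_top (at_right 0)"
      by (rule filterlim_tendsto_pos_mult_at_top[OF tendsto_const assms(1) filterlim_inverse_at_top_right])
    then show "filterlim (\<lambda>\<epsilon>. - (a / \<epsilon>)) at_bot (at_right 0)"
      by (simp add: filterlim_uminus_at_bot divide_inverse)
  qed
  then have "((\<lambda>\<epsilon>. C * exp (- (a / \<epsilon>))) \<longlongrightarrow> C * 0) (at_right 0)" by (intro tendsto_intros)
  then have "\<forall>\<^sub>F \<epsilon> in at_right 0. C * exp (- (a / \<epsilon>)) < c"
    using order_tendstoD(2) assms(2) by fastforce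
  then show ?thesis by eventually_elim simp
qed

lemma log_prob_le:
  assumes "0 < \<epsilon>" "0 \<le> p" "p \<le> exp (- (L / \<epsilon>))"
  shows "ereal \<epsilon> * log_prob p \<le> ereal (- L)"
proof (cases "p = 0")
  case False
  then have "0 < p" using assms by simp
  then have "ln p \<le> ln (exp (- (L / \<epsilon>)))" using assms(3) by (subst ln_le_cancel_iff) auto
  then have "ln p \<le> - (L / \<epsilon>)" by simp
  then have "\<epsilon> * ln p \<le> \<epsilon> * (- (L / \<epsilon>))" using assms(1) by (intro mult_left_mono) auto
  then show ?thesis using False assms(1) by (simp add: log_prob_def)
qed (use assms in \<open>simp add: log_prob_def\<close>)

lemma log_prob_ge:
  assumes "0 < \<epsilon>" "exp (- (L / \<epsilon>)) \<le> p"
  shows "ereal (- L) \<le> ereal \<epsilon> * log_prob p"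
proof -
  have "0 < p" using assms(2) by (rule less_le_trans[OF exp_gt_zero])
  then have "- (L / \<epsilon>) \<le> ln p" using assms(2) by (simp add: ln_ge_iff)
  then have "\<epsilon> * (- (L / \<epsilon>)) \<le> \<epsilon> * ln p" using assms(1) by (intro mult_left_mono) auto
  then show ?thesis using \<open>0 < p\<close> assms(1) by (simp add: log_prob_def)
qed

text \<open>\<open>F\<close> misses the compact sublevel set at \<open>L\<close>, so the two are a
  positive distance apart: otherwise pairs approaching each other would have a common limit in both.
  This lets a path in \<open>F\<close> be replaced by a nearby polygon in the upper bound.\<close>

lemma action_separation:
  assumes F: "closedin C01.mtopology F" and L: "0 \<le> L" "ennreal L < (INF x\<in>F. action x)"
  obtains \<delta> where "0 < \<delta>"
    "\<And>f g. f \<in> F \<Longrightarrow> g \<in> mspace C01 \<Longrightarrow> mdist C01 f g \<le> \<delta> \<Longrightarrow> ennreal L < action g"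
proof -
  have FM: "F \<subseteq> mspace C01" using closedin_subset[OF F] by simp
  define K where "K = {\<phi> \<in> mspace C01. action \<phi> \<le> ennreal L}"
  have "\<exists>n. \<forall>f\<in>F. \<forall>g\<in>mspace C01. mdist C01 f g \<le> 1 / real (Suc n) \<longrightarrow> ennreal L < action g"
  proof (rule ccontr)
    assume "\<not> ?thesis"
    then have "\<forall>n. \<exists>f g. f \<in> F \<and> g \<in> K \<and> mdist C01 f g \<le> 1 / real (Suc n)"
      unfolding K_def by (simp add: not_less) blast
    then obtain f g where fg: "\<And>n. f n \<in> F" "\<And>n. g n \<in> K" "\<And>n. mdist C01 (f n) (g n) \<le> 1 / real (Suc n)"
      by metis
    have "compactin C01.mtopology K"
      using action_functional_C01 L(1) by (auto simp: action_functional_def mtopology_of_C01 K_def)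
    moreover have "range g \<subseteq> K" using fg(2) by auto
    ultimately obtain l r where lr: "l \<in> K" "strict_mono r" "limitin C01.mtopology (g \<circ> r) l sequentially"
      unfolding C01.compactin_sequentially by meson
    have "l \<notin> F"
    proof
      assume "l \<in> F"
      then have "(INF x\<in>F. action x) \<le> action l" by (rule INF_lower)
      then show False using lr(1) L(2) by (auto simp: K_def not_le[symmetric])
    qed
    then have "l \<in> mspace C01 - F" using lr(1) by (simp add: K_def)
    moreover have "openin C01.mtopology (mspace C01 - F)"
      using F by (simp add: closedin_def)
    ultimately obtain s where s: "0 < s" "C01.mball l s \<subseteq> mspace C01 - F"
      unfolding C01.openin_mtopology by blast
    obtain N1 where N1: "\<And>n. n \<ge> N1 \<Longrightarrow> mdist C01 (g (r n)) l < s / 2"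
      using lr(3) s(1) unfolding C01.limit_metric_sequentially by (metis comp_apply half_gt_zero)
    obtain N2 where N2: "1 / real (Suc N2) < s / 2"
      using s(1) by (metis half_gt_zero inverse_eq_divide reals_Archimedean)
    define n where "n = max N1 N2"
    have "1 / real (Suc (r n)) \<le> 1 / real (Suc N2)"
      using seq_suble[OF lr(2), of n] by (intro divide_left_mono) (auto simp: n_def)
    then have "mdist C01 (f (r n)) (g (r n)) < s / 2" using fg(3)[of "r n"] N2 by linarith
    moreover have "mdist C01 (f (r n)) l \<le> mdist C01 (f (r n)) (g (r n)) + mdist C01 (g (r n)) l"
      using fg(1)[of "r n"] fg(2)[of "r n"] lr(1) FM unfolding K_def by (intro C01.triangle) auto
    ultimately have "mdist C01 l (f (r n)) < s" using N1[of n] by (simp add: n_def C01.commute)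
    then have "f (r n) \<in> C01.mball l s" using lr(1) fg(1) FM by (auto simp: K_def)
    then show False using s(2) fg(1) by blast
  qed
  then obtain n where "\<forall>f\<in>F. \<forall>g\<in>mspace C01. mdist C01 f g \<le> 1 / real (Suc n) \<longrightarrow> ennreal L < action g" ..
  then show thesis by (intro that[of "1 / real (Suc n)"]) auto
qed

section \<open>The two bounds for the rescaled path\<close>

context standard_brownian_motion
begin

lemma irregular_path_sets:
  assumes "0 < \<epsilon>" shows "{\<omega> \<in> space M. \<not> regular_path N \<tau> (rescaled_path B \<epsilon> \<omega>)} \<in> sets M"
  using regular_path_sets[OF assms] by (rule sets.sets_Collect_neg)

lemma energy_sets:
  assumes "0 < \<epsilon>" shows "{\<omega> \<in> space M. L \<le> energy N (rescaled_path B \<epsilon> \<omega>)} \<in> sets M"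
proof -
  have "(\<lambda>\<omega>. energy N (rescaled_path B \<epsilon> \<omega>)) \<in> borel_measurable M"
    unfolding energy_def using rescaled_cell_incr_measurable[OF assms, of _ N]
    by (intro borel_measurable_divide borel_measurable_sum borel_measurable_times borel_measurable_power
        borel_measurable_const) auto
  then show ?thesis by measurable
qed

text \<open>A path in \<open>F\<close> is either irregular or so close to its polygon that the
  polygon's action, and with it the level-\<open>N\<close> energy, exceeds \<open>L2\<close>. Either
  event has probability at most a constant times \<open>exp (- (L1 / \<epsilon>))\<close>.\<close>

lemma upper_bound_eventually:
  assumes F: "closedin C01.mtopology F" and L: "0 \<le> L" "ennreal L < (INF x\<in>F. action x)"
  shows "\<forall>\<^sub>F \<epsilon> in at_right 0.
    ereal \<epsilon> * log_prob (prob {\<omega> \<in> space M. rescaled_path B \<epsilon> \<omega> \<in> F}) \<le> ereal (- L)"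
proof -
  \<comment> \<open>Two rates above \<open>L\<close> are needed: Chernoff with
    \<open>\<theta> = L1 / L2\<close> loses the step from \<open>L2\<close> to \<open>L1\<close>,
    and the step from \<open>L1\<close> to \<open>L\<close> absorbs the constant
    \<open>C\<close>.\<close>
  obtain L2 where L2: "L < L2" "ennreal L2 < (INF x\<in>F. action x)"
  proof -
    obtain z where z: "ennreal L < z" "z < (INF x\<in>F. action x)" using dense[OF L(2)] by blast
    then obtain y where "z = ennreal y" "0 \<le> y" by (cases z) auto
    then show thesis using z L(1) that[of y] by (simp add: ennreal_less_iff)
  qed
  define L1 where "L1 = (L + L2) / 2"
  have L1: "L < L1" "L1 < L2" "0 < L1" using L2(1) L(1) by (auto simp: L1_def)
  define \<theta> where "\<theta> = L1 / L2"
  have \<theta>: "0 < \<theta>" "\<theta> < 1" "\<theta> * L2 = L1" using L1 by (auto simp: \<theta>_def)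
  obtain \<delta> where \<delta>: "0 < \<delta>"
    "\<And>f g. f \<in> F \<Longrightarrow> g \<in> mspace C01 \<Longrightarrow> mdist C01 f g \<le> \<delta> \<Longrightarrow> ennreal L2 < action g"
    using action_separation[OF F _ L2(2)] L1 by (metis less_imp_le order_less_trans)
  \<comment> \<open>A regular path is within \<open>3 * \<tau> + \<tau> = \<delta>\<close> of its
    polygon.\<close>
  define \<tau> where "\<tau> = \<delta> / 4"
  have \<tau>: "0 < \<tau>" using \<delta>(1) by (simp add: \<tau>_def)
  \<comment> \<open>The level makes the chaining exponent \<open>a\<close> at least
    \<open>L1\<close>. Below, \<open>a / 8\<close> is the exponent in the smallness hypothesis of
    \<open>irregular_path_prob\<close>.\<close>
  obtain N where N: "4 * L1 / \<tau>\<^sup>2 < 2 ^ N" using real_arch_pow[of 2 "4 * L1 / \<tau>\<^sup>2"] by auto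
  define a where "a = \<tau>\<^sup>2 * 2 ^ N / 4"
  have a: "L1 \<le> a" using N \<tau> by (simp add: a_def field_simps)
  define C where "C = 2 ^ (N + 2) + (1 / sqrt (1 - \<theta>)) ^ 2 ^ N"
  have "\<forall>\<^sub>F \<epsilon> in at_right 0. 1 * exp (- (a / 8 / \<epsilon>)) \<le> 1/4"
    using a L1 by (intro eventually_exp_small) auto
  moreover have "\<forall>\<^sub>F \<epsilon> in at_right 0. C * exp (- ((L1 - L) / \<epsilon>)) \<le> 1"
    using L1 by (intro eventually_exp_small) auto
  ultimately show ?thesis using eventually_at_right_less[of "0::real"]
  proof eventually_elim
    case (elim \<epsilon>)
    then have \<epsilon>: "0 < \<epsilon>" by simp
    let ?Y = "rescaled_path B \<epsilon>"
    have "prob {\<omega> \<in> space M. ?Y \<omega> \<in> F} \<le>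
      prob ({\<omega> \<in> space M. \<not> regular_path N \<tau> (?Y \<omega>)} \<union> {\<omega> \<in> space M. L2 \<le> energy N (?Y \<omega>)})"
    proof (rule finite_measure_mono)
      show "{\<omega> \<in> space M. ?Y \<omega> \<in> F} \<subseteq>
        {\<omega> \<in> space M. \<not> regular_path N \<tau> (?Y \<omega>)} \<union> {\<omega> \<in> space M. L2 \<le> energy N (?Y \<omega>)}"
      proof
        fix \<omega> assume \<omega>: "\<omega> \<in> {\<omega> \<in> space M. ?Y \<omega> \<in> F}"
        have "L2 \<le> energy N (?Y \<omega>)" if reg: "regular_path N \<tau> (?Y \<omega>)"
        proof -
          have Y: "?Y \<omega> \<in> mspace C01" using \<omega> \<epsilon> by (simp add: rescaled_path_C01)
          have "mdist C01 (?Y \<omega>) (polygon N (cell_incr (?Y \<omega>) N)) \<le> 3 * \<tau> + \<tau>"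
            using reg Y by (intro polygon_approx regular_path_oscillation regular_path_cell_incr) auto
          then have "ennreal L2 < action (polygon N (cell_incr (?Y \<omega>) N))"
            using \<omega> by (intro \<delta>(2)[of "?Y \<omega>"]) (auto simp: polygon_C01 \<tau>_def)
          also have "\<dots> \<le> ennreal (energy N (?Y \<omega>))"
            using energy_polygon_le[of _ N "cell_incr (?Y \<omega>) N"]
            by (simp add: action_C01_le_iff[OF polygon_C01] energy_def[of N "?Y \<omega>"] sum_nonneg)
          finally show ?thesis using L1 by (simp add: ennreal_less_iff)
        qed
        then show "\<omega> \<in> {\<omega> \<in> space M. \<not> regular_path N \<tau> (?Y \<omega>)} \<union> {\<omega> \<in> space M. L2 \<le> energy N (?Y \<omega>)}"
          using \<omega> by auto
      qed
    qed (use irregular_path_sets[OF \<epsilon>] energy_sets[OF \<epsilon>] in auto)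
    also have "\<dots> \<le> prob {\<omega> \<in> space M. \<not> regular_path N \<tau> (?Y \<omega>)} + prob {\<omega> \<in> space M. L2 \<le> energy N (?Y \<omega>)}"
      using irregular_path_sets[OF \<epsilon>] energy_sets[OF \<epsilon>] by (intro measure_Un_le)
    also have "prob {\<omega> \<in> space M. \<not> regular_path N \<tau> (?Y \<omega>)} \<le> 2 ^ (N + 2) * exp (- (a / \<epsilon>))"
      using irregular_path_prob[OF \<epsilon> \<tau>, of N] elim(1) by (simp add: a_def)
    also have "\<dots> \<le> 2 ^ (N + 2) * exp (- (L1 / \<epsilon>))"
      using a \<epsilon> by (simp add: divide_right_mono)
    also have "prob {\<omega> \<in> space M. L2 \<le> energy N (?Y \<omega>)} \<le> (1 / sqrt (1 - \<theta>)) ^ 2 ^ N * exp (- (L1 / \<epsilon>))"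
      using energy_tail[OF \<epsilon> \<theta>(1,2), of L2 N] \<theta>(3) by (simp add: mult.commute)
    finally have "prob {\<omega> \<in> space M. ?Y \<omega> \<in> F} \<le> C * exp (- (L1 / \<epsilon>))"
      by (simp add: C_def distrib_right)
    also have "\<dots> = C * exp (- ((L1 - L) / \<epsilon>)) * exp (- (L / \<epsilon>))"
      by (simp add: exp_add[symmetric] diff_divide_distrib)
    also have "\<dots> \<le> 1 * exp (- (L / \<epsilon>))"
      using elim(2) by (intro mult_right_mono) auto
    finally show ?case using \<epsilon> by (intro log_prob_le) auto
  qed
qed

text \<open>Regular paths whose level-\<open>N\<close> increments are all near those of
  \<open>\<phi>\<close> stay in a ball around \<open>\<phi>\<close>. Up to constants their
  probability is at least \<open>exp (- (b1 / \<epsilon>))\<close> for the box of increments, less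
  \<open>exp (- (b / \<epsilon>))\<close> for irregular paths, which is of smaller order because
  \<open>b1 < b\<close>.\<close>

lemma lower_bound_eventually:
  assumes U: "openin C01.mtopology U" and \<phi>: "\<phi> \<in> U" and b: "action \<phi> < ennreal b"
  shows "\<forall>\<^sub>F \<epsilon> in at_right 0.
    ereal (- b) \<le> ereal \<epsilon> * log_prob (prob {\<omega> \<in> space M. rescaled_path B \<epsilon> \<omega> \<in> U})"
proof -
  obtain \<delta> where \<delta>: "0 < \<delta>" "C01.mball \<phi> \<delta> \<subseteq> U" "\<phi> \<in> mspace C01"
    using U \<phi> unfolding C01.openin_mtopology by blast
  obtain r where r: "action \<phi> = ennreal r" "0 \<le> r" "r < b"
  proof -
    from b obtain r where "action \<phi> = ennreal r" "0 \<le> r" by (cases "action \<phi>") auto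
    with b that show thesis by (simp add: ennreal_less_iff)
  qed
  define b1 where "b1 = (r + b) / 2"
  have b1: "r < b1" "b1 < b" using r by (auto simp: b1_def)
  \<comment> \<open>The distance to \<open>\<phi>\<close> will be at most \<open>5 * \<tau>\<close>:
    three for the oscillation of the regular path, one for that of \<open>\<phi>\<close>, one for
    the error on the grid.\<close>
  define \<tau> where "\<tau> = \<delta> / 8"
  have \<tau>: "0 < \<tau>" using \<delta>(1) by (simp add: \<tau>_def)
  obtain N0 where N0: "\<And>N t. N0 \<le> N \<Longrightarrow> 0 \<le> t \<Longrightarrow> t \<le> 1 \<Longrightarrow> \<bar>\<phi> t - \<phi> (dyad N (cell_index N t))\<bar> \<le> \<tau>"
    using C01_uniform_modulus[OF \<delta>(3) \<tau>] by metis
  \<comment> \<open>This raises the chaining exponent \<open>a\<close> to at least \<open>b\<close>,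
    above the rate \<open>b1\<close> of the box.\<close>
  obtain N1 where N1: "4 * b / \<tau>\<^sup>2 < 2 ^ N1" using real_arch_pow[of 2 "4 * b / \<tau>\<^sup>2"] by auto
  define N where "N = max N0 N1"
  define a where "a = \<tau>\<^sup>2 * 2 ^ N / 4"
  have "(2::real) ^ N1 \<le> 2 ^ N" by (intro power_increasing) (auto simp: N_def)
  then have "4 * b / \<tau>\<^sup>2 < 2 ^ N" using N1 by linarith
  then have a: "b \<le> a" using \<tau> by (simp add: a_def field_simps)
  let ?d = "cell_incr \<phi> N"
  \<comment> \<open>Errors of size \<open>\<rho>\<close> accumulate over at most
    \<open>2 ^ N\<close> cells, and the slack between the energy and \<open>b1\<close> pays for
    enlarging the increments by \<open>\<rho>\<close>.\<close>
  obtain \<rho> where \<rho>: "0 < \<rho>" "2 ^ N * \<rho> \<le> \<tau>" "(\<Sum>k<2 ^ N. 2 ^ N * (\<bar>?d k\<bar> + \<rho>)\<^sup>2) / 2 \<le> b1"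
  proof -
    have "((\<lambda>\<rho>. (\<Sum>k<2 ^ N. 2 ^ N * (\<bar>?d k\<bar> + \<rho>)\<^sup>2) / 2) \<longlongrightarrow> (\<Sum>k<2 ^ N. 2 ^ N * (\<bar>?d k\<bar> + 0)\<^sup>2) / 2) (at_right 0)"
      by (intro tendsto_intros) simp
    moreover have "(\<Sum>k<2 ^ N. 2 ^ N * (\<bar>?d k\<bar> + 0)\<^sup>2) / 2 < b1"
    proof -
      have "energy N \<phi> \<le> r" using action_C01_le_iff[OF \<delta>(3) r(2)] r(1) by simp
      then show ?thesis using b1 by (simp add: energy_def)
    qed
    ultimately have "\<forall>\<^sub>F \<rho> in at_right 0. (\<Sum>k<2 ^ N. 2 ^ N * (\<bar>?d k\<bar> + \<rho>)\<^sup>2) / 2 < b1"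
      by (rule order_tendstoD(2))
    moreover have "\<forall>\<^sub>F \<rho> in at_right 0. \<rho> < \<tau> / 2 ^ N"
    proof -
      have "\<forall>\<^sub>F \<rho> in at_right 0. \<rho> \<in> {0<..<\<tau> / 2 ^ N}"
        by (rule eventually_at_right_real) (use \<tau> in simp)
      then show ?thesis by eventually_elim simp
    qed
    ultimately have "\<forall>\<^sub>F \<rho> in at_right (0::real). 0 < \<rho> \<and> 2 ^ N * \<rho> \<le> \<tau> \<and> (\<Sum>k<2 ^ N. 2 ^ N * (\<bar>?d k\<bar> + \<rho>)\<^sup>2) / 2 \<le> b1"
      using eventually_at_right_less[of "0::real"] by eventually_elim (auto simp: field_simps)
    then have "\<exists>\<rho>. 0 < \<rho> \<and> 2 ^ N * \<rho> \<le> \<tau> \<and> (\<Sum>k<2 ^ N. 2 ^ N * (\<bar>?d k\<bar> + \<rho>)\<^sup>2) / 2 \<le> b1"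
      by (rule eventually_happens'[rotated]) simp
    then show thesis using that by blast
  qed
  define c where "c = (2 * \<rho>) ^ 2 ^ N"
  have c: "0 < c" using \<rho>(1) by (simp add: c_def)
  have "\<forall>\<^sub>F \<epsilon> in at_right 0. 1 * exp (- (a / 8 / \<epsilon>)) \<le> 1/4"
    using a r b1 by (intro eventually_exp_small) auto
  \<comment> \<open>The summand \<open>1\<close> yields the final bound
    \<open>exp (- (b / \<epsilon>))\<close>; the summand \<open>2 ^ (N + 2)\<close> pays for the
    irregular paths.\<close>
  moreover have "\<forall>\<^sub>F \<epsilon> in at_right 0. (1 + 2 ^ (N + 2)) * exp (- ((b - b1) / \<epsilon>)) \<le> c"
    using b1 c by (intro eventually_exp_small) auto
  \<comment> \<open>This is the variance condition of \<open>cell_box_prob\<close>.\<close>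
  moreover have "\<forall>\<^sub>F \<epsilon> in at_right 0. \<epsilon> < 2 ^ N / (2 * pi)"
  proof -
    have "\<forall>\<^sub>F \<epsilon> in at_right 0. \<epsilon> \<in> {0<..<2 ^ N / (2 * pi)}"
      by (rule eventually_at_right_real) simp
    then show ?thesis by eventually_elim simp
  qed
  ultimately show ?thesis using eventually_at_right_less[of "0::real"]
  proof eventually_elim
    case (elim \<epsilon>)
    then have \<epsilon>: "0 < \<epsilon>" "2 * pi * (\<epsilon> / 2 ^ N) \<le> 1" by (simp_all add: field_simps)
    let ?Y = "rescaled_path B \<epsilon>"
    let ?box = "{\<omega> \<in> space M. \<forall>k<2 ^ N. \<bar>cell_incr (?Y \<omega>) N k - ?d k\<bar> \<le> \<rho>}"
    have Um: "{\<omega> \<in> space M. ?Y \<omega> \<in> U} \<in> sets M"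
    proof -
      have "U \<in> sets (metric_borel C01)"
        unfolding metric_borel_def mtopology_of_C01 using U openin_subset[of C01.mtopology]
        by (subst sets_measure_of) (auto simp: subset_iff)
      from measurable_sets[OF rescaled_path_measurable[OF \<epsilon>(1)] this]
      show ?thesis by (simp add: vimage_def Int_def conj_commute)
    qed
    have box: "?Y \<omega> \<in> U" if \<omega>: "\<omega> \<in> ?box" and reg: "regular_path N \<tau> (?Y \<omega>)" for \<omega>
    proof -
      have Y: "?Y \<omega> \<in> mspace C01" using \<omega> \<epsilon> by (simp add: rescaled_path_C01)
      have grid: "\<bar>?Y \<omega> (dyad N j) - \<phi> (dyad N j)\<bar> \<le> \<tau>" if "j \<le> 2 ^ N" for j
      proof -
        have "?Y \<omega> (dyad N j) - \<phi> (dyad N j) = (\<Sum>k<j. cell_incr (?Y \<omega>) N k - ?d k)"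
          using sum_cell_incr[of 0 j "?Y \<omega>" N] sum_cell_incr[of 0 j \<phi> N] Y \<delta>(3)
          by (simp add: mspace_C01 lessThan_atLeast0 sum_subtractf)
        also have "\<bar>\<dots>\<bar> \<le> (\<Sum>k<j. \<rho>)"
          using \<omega> that by (intro sum_abs[THEN order_trans] sum_mono) auto
        also have "\<dots> \<le> 2 ^ N * \<rho>"
        proof -
          have "real j \<le> real (2 ^ N)" using that by (simp only: of_nat_le_iff)
          then show ?thesis using \<rho>(1) by (simp add: mult_right_mono)
        qed
        finally show ?thesis using \<rho>(2) by linarith
      qed
      have "mdist C01 \<phi> (?Y \<omega>) \<le> 5 * \<tau>"
        unfolding mdist_C01_le[OF \<delta>(3) Y]
      proof
        fix t :: real assume t: "t \<in> {0..1}"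
        let ?p = "dyad N (cell_index N t)"
        have "\<bar>?Y \<omega> t - ?Y \<omega> ?p\<bar> \<le> 3 * \<tau>"
        proof (cases "t = 1")
          case True
          then have "?p = t" using cell_index_dyad[of N "2 ^ N"] by simp
          then show ?thesis using \<tau> by simp
        next
          case False
          then show ?thesis using t by (intro regular_path_oscillation Y reg) auto
        qed
        moreover have "\<bar>\<phi> t - \<phi> ?p\<bar> \<le> \<tau>" using t by (intro N0) (auto simp: N_def)
        moreover have "\<bar>?Y \<omega> ?p - \<phi> ?p\<bar> \<le> \<tau>" using t by (intro grid cell_index_le) auto
        ultimately show "\<bar>\<phi> t - ?Y \<omega> t\<bar> \<le> 5 * \<tau>" by linarith
      qed
      then have "?Y \<omega> \<in> C01.mball \<phi> \<delta>" using Y \<delta> by (simp add: \<tau>_def)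
      then show ?thesis using \<delta>(2) by blast
    qed
    have "c * exp (- (b1 / \<epsilon>)) \<le> c * exp (- ((\<Sum>k<2 ^ N. 2 ^ N * (\<bar>?d k\<bar> + \<rho>)\<^sup>2) / 2 / \<epsilon>))"
    proof (rule mult_left_mono)
      have "(\<Sum>k<2 ^ N. 2 ^ N * (\<bar>?d k\<bar> + \<rho>)\<^sup>2) / 2 / \<epsilon> \<le> b1 / \<epsilon>"
        using \<rho>(3) \<epsilon>(1) by (intro divide_right_mono) auto
      then show "exp (- (b1 / \<epsilon>)) \<le> exp (- ((\<Sum>k<2 ^ N. 2 ^ N * (\<bar>?d k\<bar> + \<rho>)\<^sup>2) / 2 / \<epsilon>))"
        by (simp only: exp_le_cancel_iff neg_le_iff_le)
    qed (use c in simp)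
    also have "\<dots> \<le> prob ?box"
      unfolding c_def by (rule cell_box_prob[OF \<epsilon> \<rho>(1)])
    also have "prob ?box \<le> prob ({\<omega> \<in> space M. ?Y \<omega> \<in> U} \<union> {\<omega> \<in> space M. \<not> regular_path N \<tau> (?Y \<omega>)})"
      using box Um irregular_path_sets[OF \<epsilon>(1)] by (intro finite_measure_mono) auto
    also have "\<dots> \<le> prob {\<omega> \<in> space M. ?Y \<omega> \<in> U} + prob {\<omega> \<in> space M. \<not> regular_path N \<tau> (?Y \<omega>)}"
      using Um irregular_path_sets[OF \<epsilon>(1)] by (intro measure_Un_le)
    also have "prob {\<omega> \<in> space M. \<not> regular_path N \<tau> (?Y \<omega>)} \<le> 2 ^ (N + 2) * exp (- (a / \<epsilon>))"
      using irregular_path_prob[OF \<epsilon>(1) \<tau>, of N] elim(1) by (simp add: a_def)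
    also have "\<dots> \<le> 2 ^ (N + 2) * exp (- (b / \<epsilon>))"
      using a \<epsilon>(1) by (simp add: divide_right_mono)
    finally have "c * exp (- (b1 / \<epsilon>)) - 2 ^ (N + 2) * exp (- (b / \<epsilon>)) \<le> prob {\<omega> \<in> space M. ?Y \<omega> \<in> U}"
      by linarith
    moreover have "(1 + 2 ^ (N + 2)) * exp (- (b / \<epsilon>)) \<le> c * exp (- (b1 / \<epsilon>))"
    proof -
      have "exp (- (b / \<epsilon>)) = exp (- ((b - b1) / \<epsilon>)) * exp (- (b1 / \<epsilon>))"
        by (simp add: exp_add[symmetric] diff_divide_distrib)
      then have "(1 + 2 ^ (N + 2)) * exp (- (b / \<epsilon>)) = (1 + 2 ^ (N + 2)) * exp (- ((b - b1) / \<epsilon>)) * exp (- (b1 / \<epsilon>))"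
        by simp
      also have "\<dots> \<le> c * exp (- (b1 / \<epsilon>))" using elim(2) by (intro mult_right_mono) auto
      finally show ?thesis .
    qed
    ultimately have "exp (- (b / \<epsilon>)) \<le> prob {\<omega> \<in> space M. ?Y \<omega> \<in> U}"
      by (simp add: distrib_right)
    then show ?case using \<epsilon>(1) by (intro log_prob_ge)
  qed
qed

text \<open>Comparing with real rates above the infimum also covers an infinite infimum, for which
  the strict inequality assumed for contradiction cannot hold.\<close>

lemma large_deviation_lower:
  assumes U: "openin C01.mtopology U"
  shows "- enn2ereal (INF x\<in>U. action x) \<le>
    Liminf (at_right 0) (\<lambda>\<epsilon>. ereal \<epsilon> * log_prob (prob {\<omega> \<in> space M. rescaled_path B \<epsilon> \<omega> \<in> U}))" (is "_ \<le> ?X")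
proof (rule ccontr)
  assume "\<not> - enn2ereal (INF x\<in>U. action x) \<le> ?X"
  then have "enn2ereal (INF x\<in>U. action x) < - ?X"
    by (simp add: not_le ereal_less_uminus_reorder)
  then obtain b where b: "enn2ereal (INF x\<in>U. action x) < ereal b" "ereal b < - ?X"
    using ereal_dense2 by blast
  have "0 < ereal b" using enn2ereal_nonneg b(1) by (rule le_less_trans)
  then have "0 \<le> b" by simp
  then have "enn2ereal (INF x\<in>U. action x) < enn2ereal (ennreal b)" using b(1) by (simp add: enn2ereal_ennreal)
  then have "(INF x\<in>U. action x) < ennreal b" by (simp add: less_ennreal.rep_eq)
  then obtain \<phi> where "\<phi> \<in> U" "action \<phi> < ennreal b" by (auto simp: INF_less_iff)
  then have "ereal (- b) \<le> ?X" by (intro Liminf_bounded lower_bound_eventually U)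
  then have "- ?X \<le> - ereal (- b)" by (simp only: ereal_minus_le_minus)
  then show False using b(2) by (simp add: not_less[symmetric])
qed

lemma large_deviation_upper:
  assumes F: "closedin C01.mtopology F"
  shows "Limsup (at_right 0) (\<lambda>\<epsilon>. ereal \<epsilon> * log_prob (prob {\<omega> \<in> space M. rescaled_path B \<epsilon> \<omega> \<in> F})) \<le>
    - enn2ereal (INF x\<in>F. action x)" (is "?X \<le> _")
proof (rule ccontr)
  assume "\<not> ?X \<le> - enn2ereal (INF x\<in>F. action x)"
  then have "- ?X < enn2ereal (INF x\<in>F. action x)"
    by (simp add: not_le ereal_uminus_less_reorder)
  then obtain L where L: "- ?X < ereal L" "ereal L < enn2ereal (INF x\<in>F. action x)"
    using ereal_dense2 by blast
  \<comment> \<open>Probabilities are at most \<open>1\<close>, so the limit superior is nonpositive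
    and \<open>L\<close> is nonnegative; \<open>ennreal\<close> would cut a negative
    \<open>L\<close> to \<open>0\<close>.\<close>
  have "?X \<le> ereal (- 0)"
    using eventually_at_right_less[of "0::real"]
    by (intro Limsup_bounded, elim eventually_mono, intro log_prob_le) auto
  then have "?X \<le> 0" by (simp add: zero_ereal_def)
  then have "0 \<le> - ?X" by simp
  then have "0 < ereal L" using L(1) by (rule le_less_trans)
  then have "0 \<le> L" by simp
  then have "enn2ereal (ennreal L) < enn2ereal (INF x\<in>F. action x)" using L(2) by (simp add: enn2ereal_ennreal)
  then have "ennreal L < (INF x\<in>F. action x)" by (simp add: less_ennreal.rep_eq)
  then have "?X \<le> ereal (- L)"
    using \<open>0 \<le> L\<close> by (intro Limsup_bounded upper_bound_eventually F)
  then have "- ereal (- L) \<le> - ?X" by (simp only: ereal_minus_le_minus)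
  then show False using L(1) by (simp add: not_less[symmetric])
qed

end

theorem lemma3p2:
  fixes M :: "'a measure" and B :: "real \<Rightarrow> 'a \<Rightarrow> real"
  assumes "standard_brownian_motion M B"
  shows "large_deviation_principle M C01 (rescaled_path B) action"
proof -
  interpret standard_brownian_motion M B by fact
  show ?thesis
    unfolding large_deviation_principle_def mtopology_of_C01
    using prob_space_axioms rescaled_path_measurable action_functional_C01
      large_deviation_lower large_deviation_upper by simp
qed

end
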